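(* Let $\lambda\in(0,1)$, let $d\ge2$ be an integer, and let $(G_N)_{N\ge1}$ be a sequence of regular bipartite graphs with $\gamma(G_N)\to0$ as $N\to\infty$. Then the queue length process $\boldsymbol{X}(t)=(X_v(t))_{v\in V_N}$ is ergodic for all $N\ge1$ and $$\sum_{i=1}^\infty\mathbb{E}\left[\left(q_i^N(\infty)-q_i^*\right)^2\right]\to0\quad\text{as }N\to\infty,$$ where $q_i^*=\lambda^{\frac{d^i-1}{d-1}}$ for $i\in\{1,2,\dots\}$. The convergence holds in particular if $\min_{w\in W_N}d_w^N\to\infty$ as $N\to\infty$.
   Context: Model. Fix $\lambda\in(0,1)$ and an integer $d\ge2$. $G_N=(V_N,W_N,E_N)$ is a finite bipartite graph, with $V_N$ the set of servers, $|V_N|=N$, $W_N$ the set of task types (dispatchers), $|W_N|=M(N)$, and $E_N\subseteq V_N\times W_N$. For $v\in V_N$ let $\mathcal{N}_v=\{w\in W_N:(v,w)\in E_N\}$, $d_v^N=|\mathcal{N}_v|$; for $w\in W_N$ let $\mathcal{N}_w=\{v\in V_N:(v,w)\in E_N\}$, $d_w^N=|\mathcal{N}_w|$; assume $d_w^N\ge1$ for all $w$. Tasks of each type arrive according to independent Poisson processes of rate $\lambda N/M(N)$ each, and each task has an independent exponential service time of mean one. When a task of type $w$ arrives, $d$ servers are sampled uniformly at random with replacement from $\mathcal{N}_w$, and the task joins the shortest queue among the sampled servers, ties broken uniformly at random. Each server serves its queue one task at a time, first come first served. $X_v(t)\in\{0,1,2,\dots\}$ is the queue length (including any task in service) of server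 $v$ at time $t$; $\boldsymbol{X}(t)$ is a continuous-time Markov chain. 'Ergodic' means positive recurrent with a unique stationary distribution. Regular bipartite graph: $G_N$ is called a regular bipartite graph if $(v,w)\in E_N$ implies $N d_v^N=M(N)d_w^N$ (the graph may have several connected components). $\gamma(G_N)=\frac1{M(N)}\sum_{w\in W_N}\frac1{d_w^N}$. Occupancy: $q_i^N(t)=\frac1N\sum_{v\in V_N}\mathbf{1}\{X_v(t)\ge i\}$, and $(q_i^N(\infty))_{i\ge1}$ denotes this functional evaluated on $\boldsymbol{X}(\infty)$, a random vector having the stationary distribution of $\boldsymbol{X}$. *)

theory Defs
  imports "HOL-Probability.Probability"
begin

section \<open>Continuous-time Markov chains\<close>

text \<open>
  A chain on a discrete state space is given by its transition rates: \<open>q x y\<close> is the rate of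
  jumping from \<open>x\<close> to \<open>y\<close> for \<open>x \<noteq> y\<close>, and by convention \<open>q x x = 0\<close>.
\<close>

definition exit_rate :: "('s \<Rightarrow> 's \<Rightarrow> real) \<Rightarrow> 's \<Rightarrow> real" where
  "exit_rate q x = (\<Sum>\<^sub>\<infinity>y. q x y)"

definition jump_pmf :: "('s \<Rightarrow> 's \<Rightarrow> real) \<Rightarrow> 's \<Rightarrow> 's pmf" where
  "jump_pmf q x = (if exit_rate q x > 0 then embed_pmf (\<lambda>y. q x y / exit_rate q x) else return_pmf x)"

text \<open>
  In an absorbing state the infinite sojourn is cut into fictitious sojourns of rate 1 followed by
  jumps from the state to itself; the trajectory is unaffected.
\<close>

definition sojourn_rate :: "('s \<Rightarrow> 's \<Rightarrow> real) \<Rightarrow> 's \<Rightarrow> real" where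
  "sojourn_rate q x = (if exit_rate q x > 0 then exit_rate q x else 1)"

text \<open>
  Sample points are sequences \<open>(Y\<^sub>0, S\<^sub>0), (Y\<^sub>1, S\<^sub>1), \<dots>\<close> of visited states and sojourn
  times. The states form a discrete-time chain with transition matrix \<^const>\<open>jump_pmf\<close>, and given
  the states, the sojourn times are independent exponentials with the rates of these states.
\<close>

abbreviation visit_space :: "('s \<times> real) measure" where
  "visit_space \<equiv> count_space UNIV \<Otimes>\<^sub>M borel"

definition visit_law :: "('s \<Rightarrow> 's \<Rightarrow> real) \<Rightarrow> 's pmf \<Rightarrow> ('s \<times> real) measure" where
  "visit_law q p = measure_pmf p \<bind>
     (\<lambda>y. distr (density lborel (exponential_density (sojourn_rate q y))) visit_space (Pair y))"

primrec visit_kernel ::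
    "('s \<Rightarrow> 's \<Rightarrow> real) \<Rightarrow> 's \<Rightarrow> nat \<Rightarrow> (nat \<Rightarrow> 's \<times> real) \<Rightarrow> ('s \<times> real) measure" where
  "visit_kernel q x 0 = (\<lambda>\<omega>. visit_law q (return_pmf x))"
| "visit_kernel q x (Suc n) = (\<lambda>\<omega>. visit_law q (jump_pmf q (fst (\<omega> n))))"

lemma distr_exponential_visit_space:
  "distr (density lborel (exponential_density (sojourn_rate q y))) visit_space (Pair y)
     \<in> space (prob_algebra visit_space)"
proof -
  have "prob_space (density lborel (exponential_density (sojourn_rate q y)))"
    by (rule prob_space_exponential_density) (simp add: sojourn_rate_def)
  then show ?thesis
    by (auto simp: space_prob_algebra intro!: prob_space.prob_space_distr)
qed

lemma visit_law_prob: "visit_law q p \<in> space (prob_algebra visit_space)"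
proof -
  have "measure_pmf p \<in> space (prob_algebra (count_space UNIV))"
    by (simp add: space_prob_algebra measure_pmf.prob_space_axioms)
  moreover have "(\<lambda>y. distr (density lborel (exponential_density (sojourn_rate q y))) visit_space (Pair y))
      \<in> count_space UNIV \<rightarrow>\<^sub>M prob_algebra visit_space"
    by (simp add: distr_exponential_visit_space)
  ultimately have "(\<lambda>_. measure_pmf p \<bind>
        (\<lambda>y. distr (density lborel (exponential_density (sojourn_rate q y))) visit_space (Pair y)))
      \<in> count_space (UNIV :: unit set) \<rightarrow>\<^sub>M prob_algebra visit_space"
    by (intro measurable_bind_prob_space[where N="count_space UNIV"] measurable_const)
  then show ?thesis
    unfolding visit_law_def by (simp add: Pi_iff)
qed

lemma Ionescu_Tulcea_visit_kernel: "Ionescu_Tulcea (visit_kernel q x) (\<lambda>_. visit_space)"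
proof (rule Ionescu_Tulcea.intro)
  fix i
  show "visit_kernel q x i \<in> PiM {0..<i} (\<lambda>_. visit_space) \<rightarrow>\<^sub>M subprob_algebra visit_space"
  proof (cases i)
    case 0
    then show ?thesis
      using visit_law_prob[of q "return_pmf x"]
      by (auto simp: space_prob_algebra space_subprob_algebra prob_space_imp_subprob_space)
  next
    case (Suc n)
    have f: "(\<lambda>y. visit_law q (jump_pmf q y)) \<in> count_space UNIV \<rightarrow>\<^sub>M subprob_algebra visit_space"
      using visit_law_prob[of q]
      by (auto simp: space_prob_algebra space_subprob_algebra prob_space_imp_subprob_space)
    have g: "(\<lambda>\<omega>. fst (\<omega> n)) \<in> PiM {0..<Suc n} (\<lambda>_. visit_space) \<rightarrow>\<^sub>M count_space UNIV"
      by (rule measurable_compose[OF measurable_component_singleton[where i=n] measurable_fst]) simp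
    show ?thesis
      using measurable_compose[OF g f] by (simp add: Suc)
  qed
next
  fix i and \<omega> :: "nat \<Rightarrow> 'a \<times> real"
  show "prob_space (visit_kernel q x i \<omega>)"
    using visit_law_prob[of q] by (cases i) (auto simp: space_prob_algebra)
qed

text \<open>
  The law of the sequence of visits of the chain started in \<open>x\<close>, i.e.\ the measure given by the
  Ionescu-Tulcea theorem for \<^const>\<open>visit_kernel\<close>.
\<close>

definition ctmc_law :: "('s \<Rightarrow> 's \<Rightarrow> real) \<Rightarrow> 's \<Rightarrow> (nat \<Rightarrow> 's \<times> real) measure" where
  "ctmc_law q x =
     projective_family.lim UNIV (Ionescu_Tulcea.CI (visit_kernel q x) (\<lambda>_. visit_space)) (\<lambda>_. visit_space)"

definition jump_time :: "(nat \<Rightarrow> 's \<times> real) \<Rightarrow> nat \<Rightarrow> real" where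
  "jump_time \<omega> n = (\<Sum>k<n. snd (\<omega> k))"

text \<open>The value \<^const>\<open>None\<close> is taken from the time of an explosion on.\<close>

definition state_at :: "(nat \<Rightarrow> 's \<times> real) \<Rightarrow> real \<Rightarrow> 's option" where
  "state_at \<omega> t = (if \<exists>n. t < jump_time \<omega> (Suc n)
     then Some (fst (\<omega> (LEAST n. t < jump_time \<omega> (Suc n)))) else None)"

definition transition_prob :: "('s \<Rightarrow> 's \<Rightarrow> real) \<Rightarrow> real \<Rightarrow> 's \<Rightarrow> 's \<Rightarrow> real" where
  "transition_prob q t x y =
     measure (ctmc_law q x) {\<omega> \<in> space (ctmc_law q x). state_at \<omega> t = Some y}"

definition stationary_on :: "'s set \<Rightarrow> ('s \<Rightarrow> 's \<Rightarrow> real) \<Rightarrow> 's pmf \<Rightarrow> bool" where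
  "stationary_on S q \<pi> \<longleftrightarrow> set_pmf \<pi> \<subseteq> S \<and>
     (\<forall>t\<ge>0. \<forall>y\<in>S. measure_pmf.expectation \<pi> (\<lambda>x. transition_prob q t x y) = pmf \<pi> y)"

definition return_time :: "'s \<Rightarrow> (nat \<Rightarrow> 's \<times> real) \<Rightarrow> ennreal" where
  "return_time x \<omega> = Inf {ennreal t | t.
     0 \<le> t \<and> state_at \<omega> t = Some x \<and> (\<exists>s. 0 \<le> s \<and> s < t \<and> state_at \<omega> s \<noteq> Some x)}"

text \<open>An absorbing state is positive recurrent although it is never left and returned to.\<close>

definition positive_recurrent :: "('s \<Rightarrow> 's \<Rightarrow> real) \<Rightarrow> 's \<Rightarrow> bool" where
  "positive_recurrent q x \<longleftrightarrow>
     exit_rate q x = 0 \<or> (\<integral>\<^sup>+ \<omega>. return_time x \<omega> \<partial>ctmc_law q x) < \<infinity>"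

definition ergodic_on :: "'s set \<Rightarrow> ('s \<Rightarrow> 's \<Rightarrow> real) \<Rightarrow> bool" where
  "ergodic_on S q \<longleftrightarrow> (\<forall>x\<in>S. positive_recurrent q x) \<and> (\<exists>!\<pi>. stationary_on S q \<pi>)"


section \<open>Bipartite graphs of servers and task types\<close>

record ('v, 'w) bigraph =
  servers :: "'v set"
  task_types :: "'w set"
  edges :: "('v \<times> 'w) set"

definition server_degree :: "('v, 'w) bigraph \<Rightarrow> 'v \<Rightarrow> nat" where
  "server_degree G v = card {w \<in> task_types G. (v, w) \<in> edges G}"

definition compatible_servers :: "('v, 'w) bigraph \<Rightarrow> 'w \<Rightarrow> 'v set" where
  "compatible_servers G w = {v \<in> servers G. (v, w) \<in> edges G}"

definition task_degree :: "('v, 'w) bigraph \<Rightarrow> 'w \<Rightarrow> nat" where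
  "task_degree G w = card (compatible_servers G w)"

definition bipartite_graph :: "('v, 'w) bigraph \<Rightarrow> bool" where
  "bipartite_graph G \<longleftrightarrow>
     finite (servers G) \<and> servers G \<noteq> {} \<and> finite (task_types G) \<and> task_types G \<noteq> {} \<and>
     edges G \<subseteq> servers G \<times> task_types G \<and> (\<forall>w\<in>task_types G. task_degree G w \<ge> 1)"

definition regular_bipartite_graph :: "('v, 'w) bigraph \<Rightarrow> bool" where
  "regular_bipartite_graph G \<longleftrightarrow> bipartite_graph G \<and>
     (\<forall>(v, w)\<in>edges G. card (servers G) * server_degree G v = card (task_types G) * task_degree G w)"

definition graph_gamma :: "('v, 'w) bigraph \<Rightarrow> real" where
  "graph_gamma G = (\<Sum>w\<in>task_types G. 1 / real (task_degree G w)) / real (card (task_types G))"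


section \<open>The queue length process\<close>

text \<open>Queue length vectors, extended by zero outside the set of servers.\<close>

definition queue_states :: "('v, 'w) bigraph \<Rightarrow> ('v \<Rightarrow> nat) set" where
  "queue_states G = {x. \<forall>v. v \<notin> servers G \<longrightarrow> x v = 0}"

definition dispatch_pmf :: "nat \<Rightarrow> ('v, 'w) bigraph \<Rightarrow> ('v \<Rightarrow> nat) \<Rightarrow> 'w \<Rightarrow> 'v pmf" where
  "dispatch_pmf d G x w = do {
     sample \<leftarrow> replicate_pmf d (pmf_of_set (compatible_servers G w));
     pmf_of_set {v \<in> set sample. \<forall>u\<in>set sample. x v \<le> x u}
   }"

text \<open>
  Tasks of each type arrive at rate \<open>\<lambda> N / M(N)\<close> and are dispatched instantaneously; every
  nonempty queue has departures at rate 1.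
\<close>

definition queue_rates ::
    "real \<Rightarrow> nat \<Rightarrow> ('v, 'w) bigraph \<Rightarrow> ('v \<Rightarrow> nat) \<Rightarrow> ('v \<Rightarrow> nat) \<Rightarrow> real" where
  "queue_rates lam d G x y =
     (\<Sum>w\<in>task_types G. lam * real (card (servers G)) / real (card (task_types G)) *
        pmf (map_pmf (\<lambda>v. x(v := x v + 1)) (dispatch_pmf d G x w)) y) +
     (\<Sum>v\<in>servers G. if x v > 0 \<and> y = x(v := x v - 1) then 1 else 0)"

definition occupancy :: "('v, 'w) bigraph \<Rightarrow> nat \<Rightarrow> ('v \<Rightarrow> nat) \<Rightarrow> real" where
  "occupancy G i x = real (card {v \<in> servers G. x v \<ge> i}) / real (card (servers G))"

definition qstar :: "real \<Rightarrow> nat \<Rightarrow> nat \<Rightarrow> real" where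
  "qstar lam d i = lam powr ((real d ^ i - 1) / (real d - 1))"

text \<open>
  The series over \<open>i \<ge> 1\<close>, as an extended nonnegative real so that a divergent series has the
  value \<open>\<infinity>\<close>.
\<close>

definition occupancy_error ::
    "real \<Rightarrow> nat \<Rightarrow> ('v, 'w) bigraph \<Rightarrow> ('v \<Rightarrow> nat) pmf \<Rightarrow> ennreal" where
  "occupancy_error lam d G \<pi> = (\<Sum>i. ennreal (measure_pmf.expectation \<pi>
     (\<lambda>x. (occupancy G (Suc i) x - qstar lam d (Suc i))\<^sup>2)))"

end

theory Submission
  imports Defs
begin

text \<open>
  By uniformization the queue length process is run by a discrete-time kernel, whose invariant
  distributions are the stationary ones; a quadratic Lyapunov function gives ergodicity, and the
  flow balance between levels gives \<open>E q\<^sub>i \<le> lam ^ i\<close>, so that only finitely many levels matter.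

  The product of the laws with tails \<open>q\<^sub>i\<^sup>*\<close> is invariant for a chain in which each server accepts
  arrivals by itself. Under this product law the occupancies in the neighbourhood of \<open>w\<close> have
  variance of order \<open>1 / deg w\<close>, so the arrival rates of the true dispatching rule differ from those
  of the product chain by \<open>O(sqrt (graph_gamma G))\<close> on average. Join the shortest queue is monotone
  enough that, in the natural coupling, a weighted sum of the discrepancies
  \<open>\<Sum>v. \<bar>(x v - j)\<^sup>+ - (y v - j)\<^sup>+\<bar>\<close> decreases at a rate proportional to the number of servers on
  which the two configurations differ at a given level. Applied to a nearly optimal coupling of the
  stationary law and the product law, one step of the dynamics shows that this number is on average
  \<open>O(N * sqrt (graph_gamma G))\<close>.
\<close>

section \<open>Paths of a continuous-time Markov chain\<close>

text \<open>Only one step is compared, so no rate of convergence to equilibrium enters: the step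
  returns a coupling of the same two laws, whose cost is at least the infimum over couplings. Hence
  the gain of the coupled dynamics is at most the error of the replaced kernel plus the slack of the
  starting coupling. Cancelling the infimum needs a finite mean cost, which the geometric tails
  give.

  The acceptance rates of the product chain are forced by detailed balance:
  \<open>lam * (a ^ d - b ^ d) / (a - b)\<close> with \<open>a = qs k\<close> and
  \<open>b = qs (Suc k)\<close>, which is at most \<open>lam * d\<close>. Hence the clock rate
  \<open>N * (1 + lam * d)\<close>, of whose arrival events the true chain uses the fraction
  \<open>1 / d\<close>.

  No single discrepancy contracts: arrivals raise the one at level \<open>j\<close> through
  mismatches at level \<open>j\<close>, departures lower it through mismatches at level
  \<open>j + 1\<close>. Weights of ratio \<open>1 / (2 * d)\<close> repair this, at the price of a
  constant growing like \<open>(2 * d) ^ j\<close>; so the estimate serves level by level.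

  Stationarity is stated through the path measure, so transition probabilities must first be
  identified with Poisson mixtures of kernel powers.\<close>

abbreviation path_space :: "(nat \<Rightarrow> 's \<times> real) measure" where
  "path_space \<equiv> PiM UNIV (\<lambda>_. visit_space)"

lemma sets_ctmc_law[simp, measurable_cong]: "sets (ctmc_law q x) = sets path_space"
proof -
  interpret Ionescu_Tulcea "visit_kernel q x" "\<lambda>_. visit_space"
    by (rule Ionescu_Tulcea_visit_kernel)
  show ?thesis by (simp add: ctmc_law_def)
qed

lemma space_ctmc_law[simp]: "space (ctmc_law q x) = UNIV"
  using sets_eq_imp_space_eq[OF sets_ctmc_law[of q x]] by (simp add: space_PiM space_pair_measure)

text \<open>The only access to the projective limit: its first \<open>n\<close> coordinates have the
  law built by iterating the kernels, so integrals over finitely many visits can be unfolded kernel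
  by kernel.\<close>

lemma distr_ctmc_law_restrict:
  "distr (ctmc_law q x) (PiM {0..<n} (\<lambda>_. visit_space)) (\<lambda>\<omega>. restrict \<omega> {0..<n})
     = Ionescu_Tulcea.C (visit_kernel q x) (\<lambda>_. visit_space) 0 n (\<lambda>_. undefined)"
proof -
  interpret IT: Ionescu_Tulcea "visit_kernel q x" "\<lambda>_. visit_space"
    by (rule Ionescu_Tulcea_visit_kernel)
  show ?thesis
  proof (rule measure_eqI)
    show "sets (distr (ctmc_law q x) (Pi\<^sub>M {0..<n} (\<lambda>_. visit_space)) (\<lambda>\<omega>. restrict \<omega> {0..<n})) =
        sets (IT.C 0 n (\<lambda>_. undefined))"
      by (subst IT.sets_C) (auto simp: space_PiM)
    fix A
    assume "A \<in> sets (distr (ctmc_law q x) (Pi\<^sub>M {0..<n} (\<lambda>_. visit_space)) (\<lambda>\<omega>. restrict \<omega> {0..<n}))"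
    then have A: "A \<in> sets (Pi\<^sub>M {0..<n} (\<lambda>_. visit_space))" by simp
    have "emeasure (distr (ctmc_law q x) (Pi\<^sub>M {0..<n} (\<lambda>_. visit_space)) (\<lambda>\<omega>. restrict \<omega> {0..<n})) A
        = emeasure (ctmc_law q x) (prod_emb UNIV (\<lambda>_. visit_space) {0..<n} A)"
      by (rule emeasure_distr_restrict) (use A in \<open>auto simp: ctmc_law_def\<close>)
    also have "\<dots> = emeasure (IT.CI {0..<n}) A"
      unfolding ctmc_law_def using A by (intro IT.lim) auto
    also have "\<dots> = emeasure (IT.C 0 n (\<lambda>_. undefined)) (prod_emb {0..<n} (\<lambda>_. visit_space) {0..<n} A)"
      by (rule IT.emeasure_CI) (use A in auto)
    also have "prod_emb {0..<n} (\<lambda>_. visit_space) {0..<n} A = A"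
      using A sets.sets_into_space[OF A] by (auto simp: prod_emb_def space_PiM)
    finally show "emeasure (distr (ctmc_law q x) (Pi\<^sub>M {0..<n} (\<lambda>_. visit_space)) (\<lambda>\<omega>. restrict \<omega> {0..<n})) A
       = emeasure (IT.C 0 n (\<lambda>_. undefined)) A" .
  qed
qed

lemma prob_space_ctmc_law: "prob_space (ctmc_law q x)"
proof -
  interpret IT: Ionescu_Tulcea "visit_kernel q x" "\<lambda>_. visit_space"
    by (rule Ionescu_Tulcea_visit_kernel)
  have "prob_space (distr (ctmc_law q x) (PiM {0..<0} (\<lambda>_. visit_space)) (\<lambda>\<omega>. restrict \<omega> {0..<0}))"
    unfolding distr_ctmc_law_restrict by (rule IT.prob_space_C) (simp add: space_PiM)
  then show ?thesis
    by (rule prob_space_distrD[rotated]) (auto intro!: measurable_restrict)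
qed

text \<open>Markov property of the sequence of visits: given the visits before \<open>n\<close>,
  visit \<open>n\<close> has the law \<open>visit_kernel q x n\<close>. The condition
  \<open>dep\<close> says that \<open>g\<close> sees only those earlier visits.\<close>

lemma nn_integral_ctmc_law_step:
  assumes g: "case_prod g \<in> borel_measurable (path_space \<Otimes>\<^sub>M visit_space)"
    and dep: "\<And>\<omega> \<omega>' a. (\<And>i. i < n \<Longrightarrow> \<omega> i = \<omega>' i) \<Longrightarrow> g \<omega> a = g \<omega>' a"
  shows "(\<integral>\<^sup>+\<omega>. g \<omega> (\<omega> n) \<partial>ctmc_law q x) = (\<integral>\<^sup>+\<omega>. \<integral>\<^sup>+a. g \<omega> a \<partial>visit_kernel q x n \<omega> \<partial>ctmc_law q x)"
proof -
  interpret IT: Ionescu_Tulcea "visit_kernel q x" "\<lambda>_. visit_space"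
    by (rule Ionescu_Tulcea_visit_kernel)
  define M where "M = (\<lambda>m. PiM {0..<m} (\<lambda>_::nat. visit_space :: ('a \<times> real) measure))"
  \<comment> \<open>\<open>g\<close> lives on full paths, the finite-dimensional laws on
    \<open>{0..<m}\<close>. Overwriting all coordinates from \<open>n\<close> on makes
    \<open>g\<close> applicable there, and by \<open>dep\<close> its value does not change.\<close>
  define e where "e = (\<lambda>(\<omega> :: nat \<Rightarrow> 'a \<times> real) i. if i < n then \<omega> i else undefined)"
  have e: "e \<in> M m \<rightarrow>\<^sub>M path_space" if "n \<le> m" for m
    unfolding M_def
  proof (rule measurable_PiM_single')
    show "e \<in> space (PiM {0..<m} (\<lambda>_. visit_space)) \<rightarrow> (\<Pi>\<^sub>E i\<in>UNIV. space visit_space)"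
      by (auto simp: space_pair_measure)
    show "(\<lambda>\<omega>. e \<omega> i) \<in> PiM {0..<m} (\<lambda>_. visit_space) \<rightarrow>\<^sub>M visit_space" for i
      using that unfolding e_def
      by (cases "i < n") (auto intro!: measurable_component_singleton simp: space_pair_measure)
  qed
  have C[simp]: "(\<lambda>_. undefined) \<in> space (PiM {0..<0::nat} (\<lambda>_. visit_space))"
    by (simp add: space_PiM)
  define h where "h = (\<lambda>\<omega>. g (e \<omega>) (\<omega> n))"
  have h: "h \<in> borel_measurable (M (Suc n))"
  proof -
    have "(\<lambda>\<omega>. (e \<omega>, \<omega> n)) \<in> M (Suc n) \<rightarrow>\<^sub>M path_space \<Otimes>\<^sub>M visit_space"
      by (intro measurable_Pair e) (auto simp: M_def intro!: measurable_component_singleton)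
    from measurable_compose[OF this g] show ?thesis by (simp add: h_def)
  qed
  have k: "(\<lambda>\<omega>. \<integral>\<^sup>+a. g (e \<omega>) a \<partial>visit_kernel q x n \<omega>) \<in> borel_measurable (M n)"
  proof (rule nn_integral_measurable_subprob_algebra2)
    show "(\<lambda>(\<omega>, a). g (e \<omega>) a) \<in> borel_measurable (M n \<Otimes>\<^sub>M visit_space)"
      using measurable_compose[OF measurable_Pair[OF measurable_compose[OF measurable_fst e[OF order_refl]] measurable_snd] g]
      by (simp add: split_beta')
    show "visit_kernel q x n \<in> M n \<rightarrow>\<^sub>M subprob_algebra visit_space"
      unfolding M_def by (rule IT.P)
  qed
  have r: "(\<lambda>\<omega>. restrict \<omega> {0..<m}) \<in> ctmc_law q x \<rightarrow>\<^sub>M M m" for m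
    unfolding M_def by (auto intro!: measurable_restrict)
  have er: "g (e (restrict \<omega> {0..<m})) a = g \<omega> a" if "n \<le> m" for \<omega> a m
    using that by (intro dep) (auto simp: e_def)
  have eP: "IT.eP n \<in> IT.C 0 n (\<lambda>_. undefined) \<rightarrow>\<^sub>M subprob_algebra (M (Suc n))"
  proof -
    have "sets (IT.C 0 n (\<lambda>_. undefined)) = sets (PiM {0..<n} (\<lambda>_. visit_space))"
      using IT.sets_C[OF C, of n] by simp
    note eq = measurable_cong_sets[OF this refl]
    show ?thesis
      unfolding M_def eq by (rule IT.measurable_eP)
  qed
  have "(\<integral>\<^sup>+\<omega>. g \<omega> (\<omega> n) \<partial>ctmc_law q x) = (\<integral>\<^sup>+\<omega>. h (restrict \<omega> {0..<Suc n}) \<partial>ctmc_law q x)"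
    unfolding h_def by (subst er) auto
  also have "\<dots> = (\<integral>\<^sup>+\<omega>. h \<omega> \<partial>IT.C 0 (Suc n) (\<lambda>_. undefined))"
    unfolding distr_ctmc_law_restrict[symmetric]
    by (subst nn_integral_distr) (use h r[of "Suc n"] in \<open>auto simp: M_def\<close>)
  also have "\<dots> = (\<integral>\<^sup>+\<omega>. \<integral>\<^sup>+\<omega>'. h \<omega>' \<partial>IT.eP n \<omega> \<partial>IT.C 0 n (\<lambda>_. undefined))"
    using h eP unfolding M_def
    by (simp, intro nn_integral_bind[where B="PiM {0..<Suc n} (\<lambda>_. visit_space)"]) auto
  also have "\<dots> = (\<integral>\<^sup>+\<omega>. \<integral>\<^sup>+a. h (fun_upd \<omega> n a) \<partial>visit_kernel q x n \<omega> \<partial>IT.C 0 n (\<lambda>_. undefined))"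
    using h unfolding M_def
    by (intro nn_integral_cong IT.nn_integral_eP) (auto simp: IT.space_C[OF C])
  also have "\<dots> = (\<integral>\<^sup>+\<omega>. \<integral>\<^sup>+a. g (e \<omega>) a \<partial>visit_kernel q x n \<omega> \<partial>IT.C 0 n (\<lambda>_. undefined))"
    unfolding h_def by (intro nn_integral_cong) (auto simp: e_def intro!: dep)
  also have "\<dots> = (\<integral>\<^sup>+\<omega>. \<integral>\<^sup>+a. g (e (restrict \<omega> {0..<n})) a \<partial>visit_kernel q x n (restrict \<omega> {0..<n}) \<partial>ctmc_law q x)"
    unfolding distr_ctmc_law_restrict[symmetric]
    by (subst nn_integral_distr) (use k r[of n] in \<open>auto simp: M_def\<close>)
  also have "\<dots> = (\<integral>\<^sup>+\<omega>. \<integral>\<^sup>+a. g \<omega> a \<partial>visit_kernel q x n \<omega> \<partial>ctmc_law q x)"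
    by (subst er) (cases n; auto)+
  finally show ?thesis .
qed

abbreviation sojourn_law :: "('s \<Rightarrow> 's \<Rightarrow> real) \<Rightarrow> 's \<Rightarrow> real measure" where
  "sojourn_law q y \<equiv> density lborel (exponential_density (sojourn_rate q y))"

lemma nn_integral_visit_law:
  assumes h: "h \<in> borel_measurable visit_space"
  shows "(\<integral>\<^sup>+a. h a \<partial>visit_law q p) = (\<integral>\<^sup>+z. \<integral>\<^sup>+s. h (z, s) \<partial>sojourn_law q z \<partial>measure_pmf p)"
proof -
  have "(\<integral>\<^sup>+a. h a \<partial>visit_law q p)
     = (\<integral>\<^sup>+z. \<integral>\<^sup>+a. h a \<partial>distr (sojourn_law q z) visit_space (Pair z) \<partial>measure_pmf p)"
    unfolding visit_law_def using h
    by (intro nn_integral_bind[where B=visit_space])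
       (use distr_exponential_visit_space[of q] in \<open>auto simp: space_prob_algebra space_subprob_algebra prob_space_imp_subprob_space\<close>)
  also have "\<dots> = (\<integral>\<^sup>+z. \<integral>\<^sup>+s. h (z, s) \<partial>sojourn_law q z \<partial>measure_pmf p)"
    using h by (subst nn_integral_distr) auto
  finally show ?thesis .
qed

lemma prob_space_sojourn_law: "prob_space (sojourn_law q y)"
  by (rule prob_space_exponential_density) (simp add: sojourn_rate_def)

lemma measurable_sojourn_law:
  "sojourn_law q \<in> count_space UNIV \<rightarrow>\<^sub>M subprob_algebra borel"
  using prob_space_sojourn_law[of q]
  by (auto simp: space_subprob_algebra prob_space_imp_subprob_space)

lemma visit_kernel_eq:
  "visit_kernel q x n \<omega> = visit_law q (case n of 0 \<Rightarrow> return_pmf x | Suc m \<Rightarrow> jump_pmf q (fst (\<omega> m)))"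
  by (cases n) auto

text \<open>Given the past and the current state, the current sojourn is a fresh exponential.
  \<open>nn_integral_ctmc_law_step\<close> is used twice: forwards for \<open>g\<close> and
  backwards for its average \<open>g2\<close> over the sojourn.\<close>

lemma nn_integral_resample_sojourn:
  assumes g: "(\<lambda>(\<omega>, z, s). g \<omega> z s) \<in> borel_measurable (path_space \<Otimes>\<^sub>M visit_space)"
    and dep: "\<And>\<omega> \<omega>' z s. (\<And>i. i < n \<Longrightarrow> \<omega> i = \<omega>' i) \<Longrightarrow> g \<omega> z s = g \<omega>' z s"
  shows "(\<integral>\<^sup>+\<omega>. g \<omega> (fst (\<omega> n)) (snd (\<omega> n)) \<partial>ctmc_law q x)
       = (\<integral>\<^sup>+\<omega>. \<integral>\<^sup>+s. g \<omega> (fst (\<omega> n)) s \<partial>sojourn_law q (fst (\<omega> n)) \<partial>ctmc_law q x)"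
proof -
  define p where "p = (\<lambda>\<omega>. case n of 0 \<Rightarrow> return_pmf x | Suc m \<Rightarrow> jump_pmf q (fst ((\<omega> :: nat \<Rightarrow> 'a \<times> real) m)))"
  have g1: "(\<lambda>(\<omega>, a). g \<omega> (fst a) (snd a)) \<in> borel_measurable (path_space \<Otimes>\<^sub>M visit_space)"
    using g by (simp add: split_beta')
  have g1\<omega>: "(\<lambda>a. g \<omega> (fst a) (snd a)) \<in> borel_measurable visit_space" for \<omega>
    using measurable_compose[OF measurable_Pair1'[of \<omega> path_space visit_space] g1]
    by (simp add: space_PiM space_pair_measure)
  define g2 where "g2 = (\<lambda>\<omega> (a :: 'a \<times> real). \<integral>\<^sup>+s. g \<omega> (fst a) s \<partial>sojourn_law q (fst a))"
  have g2: "case_prod g2 \<in> borel_measurable (path_space \<Otimes>\<^sub>M visit_space)"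
    unfolding g2_def split_beta'
  proof (rule nn_integral_measurable_subprob_algebra2)
    have "(\<lambda>p. (fst (fst p), fst (snd (fst p)), snd p))
       \<in> (path_space \<Otimes>\<^sub>M visit_space) \<Otimes>\<^sub>M borel \<rightarrow>\<^sub>M path_space \<Otimes>\<^sub>M visit_space"
      by measurable
    from measurable_compose[OF this g]
    show "(\<lambda>(p, s). g (fst p) (fst (snd p)) s)
       \<in> borel_measurable ((path_space \<Otimes>\<^sub>M visit_space) \<Otimes>\<^sub>M borel)"
      by (simp add: split_beta')
    have "(\<lambda>p. fst (snd p)) \<in> path_space \<Otimes>\<^sub>M visit_space \<rightarrow>\<^sub>M count_space UNIV"
      by measurable
    from measurable_compose[OF this measurable_sojourn_law]
    show "(\<lambda>p. sojourn_law q (fst (snd p)))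
      \<in> path_space \<Otimes>\<^sub>M visit_space \<rightarrow>\<^sub>M subprob_algebra borel" .
  qed
  have g2\<omega>: "g2 \<omega> \<in> borel_measurable visit_space" for \<omega>
    using measurable_compose[OF measurable_Pair1'[of \<omega> path_space visit_space] g2]
    by (simp add: space_PiM space_pair_measure)
  have dep2: "g2 \<omega> a = g2 \<omega>' a" if "\<And>i. i < n \<Longrightarrow> \<omega> i = \<omega>' i" for \<omega> \<omega>' a
    unfolding g2_def by (intro nn_integral_cong dep that)
  have "(\<integral>\<^sup>+\<omega>. g \<omega> (fst (\<omega> n)) (snd (\<omega> n)) \<partial>ctmc_law q x)
      = (\<integral>\<^sup>+\<omega>. \<integral>\<^sup>+a. g \<omega> (fst a) (snd a) \<partial>visit_law q (p \<omega>) \<partial>ctmc_law q x)"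
    unfolding p_def
    by (rule nn_integral_ctmc_law_step[OF g1, of n q x, unfolded visit_kernel_eq])
       (rule dep, simp)
  also have "\<dots> = (\<integral>\<^sup>+\<omega>. \<integral>\<^sup>+z. \<integral>\<^sup>+s. g \<omega> z s \<partial>sojourn_law q z \<partial>p \<omega> \<partial>ctmc_law q x)"
    by (subst nn_integral_visit_law[OF g1\<omega>]) simp
  \<comment> \<open>A second, idle sojourn \<open>s'\<close> of total mass one restores the shape of
    an integral over \<open>visit_law\<close>, to which the Markov property applies
    backwards.\<close>
  also have "\<dots> = (\<integral>\<^sup>+\<omega>. \<integral>\<^sup>+z. \<integral>\<^sup>+s'. \<integral>\<^sup>+s. g \<omega> z s \<partial>sojourn_law q z \<partial>sojourn_law q z \<partial>p \<omega> \<partial>ctmc_law q x)"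
    by (simp add: prob_space.emeasure_space_1[OF prob_space_sojourn_law, simplified])
  also have "\<dots> = (\<integral>\<^sup>+\<omega>. \<integral>\<^sup>+a. g2 \<omega> a \<partial>visit_law q (p \<omega>) \<partial>ctmc_law q x)"
    by (subst nn_integral_visit_law[OF g2\<omega>]) (simp add: g2_def)
  also have "\<dots> = (\<integral>\<^sup>+\<omega>. g2 \<omega> (\<omega> n) \<partial>ctmc_law q x)"
    unfolding p_def
    by (rule nn_integral_ctmc_law_step[OF g2, of n q x, unfolded visit_kernel_eq, symmetric])
       (rule dep2, simp)
  finally show ?thesis by (simp add: g2_def)
qed

text \<open>\<open>g\<close> may look at the sojourn \<open>n\<close> as well, since the next state
  is drawn from the state of visit \<open>n\<close> alone.\<close>

lemma nn_integral_jump: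
  assumes g: "case_prod g \<in> borel_measurable (path_space \<Otimes>\<^sub>M count_space UNIV)"
    and dep: "\<And>\<omega> \<omega>' z. (\<And>i. i \<le> n \<Longrightarrow> \<omega> i = \<omega>' i) \<Longrightarrow> g \<omega> z = g \<omega>' z"
  shows "(\<integral>\<^sup>+\<omega>. g \<omega> (fst (\<omega> (Suc n))) \<partial>ctmc_law q x)
       = (\<integral>\<^sup>+\<omega>. \<integral>\<^sup>+z. g \<omega> z \<partial>jump_pmf q (fst (\<omega> n)) \<partial>ctmc_law q x)"
proof -
  have "(\<lambda>p. (fst p, fst (snd p))) \<in> path_space \<Otimes>\<^sub>M visit_space \<rightarrow>\<^sub>M path_space \<Otimes>\<^sub>M count_space UNIV"
    by measurable
  from measurable_compose[OF this g]
  have g1: "(\<lambda>(\<omega>, a). g \<omega> (fst a)) \<in> borel_measurable (path_space \<Otimes>\<^sub>M visit_space)"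
    by (simp add: split_beta')
  have g1\<omega>: "(\<lambda>a. g \<omega> (fst a)) \<in> borel_measurable visit_space" for \<omega>
    using measurable_compose[OF measurable_Pair1'[of \<omega> path_space visit_space] g1]
    by (simp add: space_PiM space_pair_measure)
  have "(\<integral>\<^sup>+\<omega>. g \<omega> (fst (\<omega> (Suc n))) \<partial>ctmc_law q x)
      = (\<integral>\<^sup>+\<omega>. \<integral>\<^sup>+a. g \<omega> (fst a) \<partial>visit_law q (jump_pmf q (fst (\<omega> n))) \<partial>ctmc_law q x)"
    by (rule nn_integral_ctmc_law_step[OF g1, of "Suc n" q x, unfolded visit_kernel.simps])
       (rule dep, simp)
  also have "\<dots> = (\<integral>\<^sup>+\<omega>. \<integral>\<^sup>+z. g \<omega> z \<partial>jump_pmf q (fst (\<omega> n)) \<partial>ctmc_law q x)"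
    by (subst nn_integral_visit_law[OF g1\<omega>])
       (simp add: prob_space.emeasure_space_1[OF prob_space_sojourn_law, simplified])
  finally show ?thesis .
qed

lemma nn_integral_initial:
  "(\<integral>\<^sup>+\<omega>. h (fst (\<omega> 0)) \<partial>ctmc_law q x) = h x"
proof -
  have [measurable]: "h \<in> borel_measurable (count_space UNIV)" by simp
  have g1: "(\<lambda>(\<omega>, a). h (fst a)) \<in> borel_measurable (path_space \<Otimes>\<^sub>M visit_space)"
    by measurable
  have g1\<omega>: "(\<lambda>a. h (fst a)) \<in> borel_measurable visit_space"
    by measurable
  have "(\<integral>\<^sup>+\<omega>. h (fst (\<omega> 0)) \<partial>ctmc_law q x)
      = (\<integral>\<^sup>+\<omega>. \<integral>\<^sup>+a. h (fst a) \<partial>visit_law q (return_pmf x) \<partial>ctmc_law q x)"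
    using nn_integral_ctmc_law_step[OF g1, of 0 q x] by simp
  also have "\<dots> = h x"
    by (subst nn_integral_visit_law[OF g1\<omega>])
       (simp add: prob_space.emeasure_space_1[OF prob_space_sojourn_law, simplified]
          prob_space.emeasure_space_1[OF prob_space_ctmc_law, simplified])
  finally show ?thesis .
qed

lemma measurable_fst_path[measurable]: "(\<lambda>\<omega>. fst (\<omega> n)) \<in> path_space \<rightarrow>\<^sub>M count_space UNIV"
  by (rule measurable_compose[OF measurable_component_singleton[of n UNIV "\<lambda>_. visit_space"] measurable_fst]) simp

lemma measurable_path_state[measurable]: "(\<lambda>\<omega>. h (fst (\<omega> n)) :: ennreal) \<in> borel_measurable path_space"
  by (rule measurable_compose[OF measurable_fst_path]) simp

lemma measurable_ctmc_law[simp]: "ctmc_law q x \<rightarrow>\<^sub>M N = path_space \<rightarrow>\<^sub>M N"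
  by (rule measurable_cong_sets) simp_all

lemma measurable_jump_time[measurable]: "(\<lambda>\<omega>. jump_time \<omega> n) \<in> borel_measurable path_space"
  unfolding jump_time_def by measurable

lemma jump_time_Suc: "jump_time \<omega> (Suc n) = jump_time \<omega> n + snd (\<omega> n)"
  by (simp add: jump_time_def)

lemma jump_time_cong: "(\<And>i. i < n \<Longrightarrow> \<omega> i = \<omega>' i) \<Longrightarrow> jump_time \<omega> n = jump_time \<omega>' n"
  by (simp add: jump_time_def)

text \<open>The sample space contains paths with nonpositive sojourns. Off this null set the jump
  times increase, as the path arguments below require.\<close>

lemma AE_sojourn_pos: "AE \<omega> in ctmc_law q x. \<forall>n. 0 < snd (\<omega> n)"
  unfolding AE_all_countable
proof
  fix n
  have "(\<integral>\<^sup>+\<omega>. indicator {..0} (snd (\<omega> n)) \<partial>ctmc_law q x)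
     = (\<integral>\<^sup>+\<omega>. \<integral>\<^sup>+s. indicator {..0} s \<partial>sojourn_law q (fst (\<omega> n)) \<partial>ctmc_law q x)"
    by (rule nn_integral_resample_sojourn[where g="\<lambda>\<omega> z s. indicator {..0} s"]) auto
  also have "\<dots> = (\<integral>\<^sup>+\<omega>. 0 \<partial>ctmc_law q x)"
  proof (intro nn_integral_cong)
    fix \<omega> :: "nat \<Rightarrow> 'a \<times> real"
    have "(\<integral>\<^sup>+s. indicator {..0} s \<partial>sojourn_law q (fst (\<omega> n)))
        = (\<integral>\<^sup>+s. ennreal (exponential_density (sojourn_rate q (fst (\<omega> n))) s) * indicator {..0} s \<partial>lborel)"
      by (subst nn_integral_density) auto
    also have "\<dots> = (\<integral>\<^sup>+(s::real). 0 \<partial>lborel)"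
      by (rule nn_integral_cong_AE, rule eventually_mono[OF AE_lborel_singleton[of 0]])
         (auto simp: exponential_density_def split: split_indicator)
    finally show "(\<integral>\<^sup>+s. indicator {..0} s \<partial>sojourn_law q (fst (\<omega> n))) = 0" by simp
  qed
  finally have "AE \<omega> in ctmc_law q x. (indicator {..0} (snd (\<omega> n)) :: ennreal) = 0"
    by (subst nn_integral_0_iff_AE[symmetric]) auto
  then show "AE \<omega> in ctmc_law q x. 0 < snd (\<omega> n)"
    by eventually_elim (auto split: split_indicator_asm)
qed

lemma AE_closed:
  assumes "x \<in> S" and "\<And>y. y \<in> S \<Longrightarrow> set_pmf (jump_pmf q y) \<subseteq> S"
  shows "AE \<omega> in ctmc_law q x. \<forall>n. fst (\<omega> n) \<in> S"
  unfolding AE_all_countable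
proof
  fix n
  show "AE \<omega> in ctmc_law q x. fst (\<omega> n) \<in> S"
  proof (induction n)
    case 0
    have "(\<integral>\<^sup>+\<omega>. indicator (-S) (fst (\<omega> 0)) \<partial>ctmc_law q x) = 0"
      using assms by (subst nn_integral_initial) simp
    then have "AE \<omega> in ctmc_law q x. (indicator (-S) (fst (\<omega> 0)) :: ennreal) = 0"
      by (subst nn_integral_0_iff_AE[symmetric]) auto
    then show ?case
      by eventually_elim (auto split: split_indicator_asm)
  next
    case (Suc n)
    have "(\<integral>\<^sup>+\<omega>. indicator (-S) (fst (\<omega> (Suc n))) \<partial>ctmc_law q x)
      = (\<integral>\<^sup>+\<omega>. \<integral>\<^sup>+z. indicator (-S) z \<partial>jump_pmf q (fst (\<omega> n)) \<partial>ctmc_law q x)"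
      by (rule nn_integral_jump[where g="\<lambda>\<omega> z. indicator (-S) z"])
         (simp_all add: split_beta' measurable_compose[OF measurable_snd])
    also have "\<dots> = (\<integral>\<^sup>+\<omega>. 0 \<partial>ctmc_law q x)"
    proof (rule nn_integral_cong_AE)
      show "AE \<omega> in ctmc_law q x. (\<integral>\<^sup>+z. indicator (-S) z \<partial>jump_pmf q (fst (\<omega> n))) = 0"
        using Suc
      proof eventually_elim
        case (elim \<omega>)
        then have "set_pmf (jump_pmf q (fst (\<omega> n))) \<subseteq> S" using assms(2) by blast
        then show ?case
          by (subst nn_integral_cong_AE[where v="\<lambda>_. 0"])
             (auto simp: AE_measure_pmf_iff split: split_indicator)
      qed
    qed
    finally have "AE \<omega> in ctmc_law q x. (indicator (-S) (fst (\<omega> (Suc n))) :: ennreal) = 0"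
      by (subst nn_integral_0_iff_AE[symmetric]) auto
    then show ?case
      by eventually_elim (auto split: split_indicator_asm)
  qed
qed

text \<open>The state type need not be countable, and then measurability of all sections does not
  give joint measurability. Enumerating the countable support writes \<open>g\<close> as a countable
  sum of measurable products.\<close>

lemma measurable_countable_support:
  fixes g :: "'b \<Rightarrow> 's \<Rightarrow> ennreal"
  assumes S: "countable S"
    and g: "\<And>z. z \<in> S \<Longrightarrow> (\<lambda>\<omega>. g \<omega> z) \<in> borel_measurable M"
    and g0: "\<And>\<omega> z. z \<notin> S \<Longrightarrow> g \<omega> z = 0"
  shows "case_prod g \<in> borel_measurable (M \<Otimes>\<^sub>M count_space UNIV)"
proof -
  define k where "k = (\<lambda>n (p :: 'b \<times> 's). if n \<in> to_nat_on S ` S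
     then indicator {from_nat_into S n} (snd p) * g (fst p) (from_nat_into S n) else 0)"
  have k: "k n \<in> borel_measurable (M \<Otimes>\<^sub>M count_space UNIV)" for n
  proof (cases "n \<in> to_nat_on S ` S")
    case True
    then have "from_nat_into S n \<in> S" using S by auto
    then have "(\<lambda>\<omega>. g \<omega> (from_nat_into S n)) \<in> borel_measurable M" by (rule g)
    from measurable_compose[OF measurable_fst this]
    have [measurable]: "(\<lambda>p. g (fst p) (from_nat_into S n)) \<in> borel_measurable (M \<Otimes>\<^sub>M count_space UNIV)" .
    have [measurable]: "(\<lambda>p. indicator {from_nat_into S n} (snd p) :: ennreal) \<in> borel_measurable (M \<Otimes>\<^sub>M count_space UNIV)"
      by (rule measurable_compose[OF measurable_snd]) simp
    show ?thesis unfolding k_def using True by simp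
  qed (simp add: k_def)
  have "g \<omega> z = (\<Sum>n. k n (\<omega>, z))" for \<omega> z
  proof (cases "z \<in> S")
    case False
    have "k n (\<omega>, z) = 0" for n
      using False S by (auto simp: k_def split: split_indicator)
    then show ?thesis using False g0 by simp
  next
    case True
    have "(\<Sum>n. k n (\<omega>, z)) = (\<Sum>n\<in>{to_nat_on S z}. k n (\<omega>, z))"
      using True S by (intro suminf_finite) (auto simp: k_def split: split_indicator)
    also have "\<dots> = g \<omega> z" using True S by (auto simp: k_def)
    finally show ?thesis by simp
  qed
  then have "case_prod g = (\<lambda>p. \<Sum>n. k n p)" by auto
  with k show ?thesis by simp
qed

section \<open>Uniformization\<close>

primrec pmf_iterate :: "('s \<Rightarrow> 's pmf) \<Rightarrow> nat \<Rightarrow> 's \<Rightarrow> 's pmf" where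
  "pmf_iterate Q 0 x = return_pmf x"
| "pmf_iterate Q (Suc n) x = bind_pmf (Q x) (pmf_iterate Q n)"

text \<open>\<open>L\<close> is the rate of a common clock and \<open>Q\<close> the law of the move
  at each tick; staying put under \<open>Q\<close> absorbs the differences between exit rates.
  \<open>not_absorbing\<close> makes \<open>sojourn_rate\<close> the true exit rate on
  \<open>S\<close>, and \<open>finite_Q\<close> turns expectations into finite sums.\<close>

locale uniformized =
  fixes q :: "'s \<Rightarrow> 's \<Rightarrow> real" and Q :: "'s \<Rightarrow> 's pmf" and L :: real and S :: "'s set"
  assumes L_pos: "0 < L"
    and countable_S: "countable S"
    and closed: "x \<in> S \<Longrightarrow> set_pmf (Q x) \<subseteq> S"
    and finite_Q: "x \<in> S \<Longrightarrow> finite (set_pmf (Q x))"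
    and rate: "x \<in> S \<Longrightarrow> q x y = (if y = x then 0 else L * pmf (Q x) y)"
    and not_absorbing: "x \<in> S \<Longrightarrow> pmf (Q x) x < 1"
begin

lemma expectation_Q: "x \<in> S \<Longrightarrow> measure_pmf.expectation (Q x) f = (\<Sum>z\<in>set_pmf (Q x). pmf (Q x) z * f z)"
  using finite_Q by (subst integral_measure_pmf_real[of "set_pmf (Q x)"]) (auto simp: mult.commute)

lemma sum_off_diagonal:
  fixes f :: "'s \<Rightarrow> real"
  assumes "x \<in> S"
  shows "(\<Sum>z\<in>set_pmf (Q x) - {x}. pmf (Q x) z * f z) = measure_pmf.expectation (Q x) f - pmf (Q x) x * f x"
proof (cases "x \<in> set_pmf (Q x)")
  case True
  then show ?thesis
    using finite_Q[OF assms] by (simp add: expectation_Q[OF assms] sum.remove[of _ x])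
next
  case False
  then show ?thesis
    by (simp add: expectation_Q[OF assms] pmf_eq_0_set_pmf)
qed

lemma exit_rate_eq: "x \<in> S \<Longrightarrow> exit_rate q x = L * (1 - pmf (Q x) x)"
proof -
  assume x: "x \<in> S"
  have "exit_rate q x = infsum (q x) (set_pmf (Q x) - {x})"
    unfolding exit_rate_def
    by (rule infsum_cong_neutral) (auto simp: rate[OF x] set_pmf_iff)
  also have "\<dots> = (\<Sum>z\<in>set_pmf (Q x) - {x}. L * pmf (Q x) z)"
    using finite_Q[OF x] by (simp add: rate[OF x])
  also have "\<dots> = L * (\<Sum>z\<in>set_pmf (Q x) - {x}. pmf (Q x) z * 1)"
    by (simp add: sum_distrib_left)
  finally show ?thesis by (subst (asm) sum_off_diagonal[OF x]) simp
qed

lemma exit_rate_pos: "x \<in> S \<Longrightarrow> 0 < exit_rate q x"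
  using L_pos not_absorbing by (simp add: exit_rate_eq)

lemma exit_rate_le: "x \<in> S \<Longrightarrow> exit_rate q x \<le> L"
  using L_pos by (simp add: exit_rate_eq)

lemma sojourn_rate_eq: "x \<in> S \<Longrightarrow> sojourn_rate q x = exit_rate q x"
  using exit_rate_pos by (simp add: sojourn_rate_def)

lemma pmf_jump: "x \<in> S \<Longrightarrow> pmf (jump_pmf q x) y = q x y / exit_rate q x"
proof -
  assume x: "x \<in> S"
  have "(\<integral>\<^sup>+y. ennreal (q x y / exit_rate q x) \<partial>count_space UNIV)
      = (\<Sum>y\<in>set_pmf (Q x) - {x}. ennreal (q x y / exit_rate q x))"
    by (rule nn_integral_count_space'[of _ _ _, simplified])
       (use finite_Q[OF x] in \<open>auto simp: rate[OF x] set_pmf_iff\<close>)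
  also have "\<dots> = ennreal (\<Sum>y\<in>set_pmf (Q x) - {x}. q x y / exit_rate q x)"
    using exit_rate_pos[OF x] L_pos by (intro sum_ennreal) (auto simp: rate[OF x])
  also have "(\<Sum>y\<in>set_pmf (Q x) - {x}. q x y / exit_rate q x)
     = (L * (\<Sum>z\<in>set_pmf (Q x) - {x}. pmf (Q x) z * 1)) / exit_rate q x"
    unfolding sum_divide_distrib sum_distrib_left by (intro sum.cong) (auto simp: rate[OF x])
  also have "\<dots> = 1"
    unfolding sum_off_diagonal[OF x] using exit_rate_pos[OF x] by (auto simp: exit_rate_eq[OF x])
  finally show ?thesis
    using exit_rate_pos[OF x] L_pos unfolding jump_pmf_def
    by (simp, subst pmf_embed_pmf) (auto simp: rate[OF x])
qed

lemma set_jump: "x \<in> S \<Longrightarrow> set_pmf (jump_pmf q x) = set_pmf (Q x) - {x}"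
  using exit_rate_pos[of x] L_pos by (auto simp: set_pmf_iff pmf_jump rate split: if_splits)

lemma jump_closed: "x \<in> S \<Longrightarrow> set_pmf (jump_pmf q x) \<subseteq> S"
  using set_jump closed by blast

text \<open>The jump chain is \<open>Q\<close> conditioned to move, whence the missing diagonal term
  and the factor \<open>L / exit_rate q x\<close>.\<close>

lemma nn_integral_jump_pmf:
  assumes x: "x \<in> S" and f: "\<And>z. z \<in> S \<Longrightarrow> 0 \<le> f z"
  shows "(\<integral>\<^sup>+z. ennreal (f z) \<partial>jump_pmf q x)
     = ennreal (L * (measure_pmf.expectation (Q x) f - pmf (Q x) x * f x) / exit_rate q x)"
proof -
  have fin: "finite (set_pmf (jump_pmf q x))" using finite_Q[OF x] set_jump[OF x] by simp
  have "(\<integral>\<^sup>+z. ennreal (f z) \<partial>jump_pmf q x)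
     = (\<Sum>z\<in>set_pmf (Q x) - {x}. ennreal (f z) * ennreal (pmf (jump_pmf q x) z))"
    using nn_integral_measure_pmf_finite[OF fin] unfolding set_jump[OF x] by simp
  also have "\<dots> = (\<Sum>z\<in>set_pmf (Q x) - {x}. ennreal (L * (pmf (Q x) z * f z) / exit_rate q x))"
    using closed[OF x] f
    by (intro sum.cong) (auto simp: pmf_jump[OF x] rate[OF x] ennreal_mult'[symmetric] algebra_simps)
  also have "\<dots> = ennreal (\<Sum>z\<in>set_pmf (Q x) - {x}. L * (pmf (Q x) z * f z) / exit_rate q x)"
    using closed[OF x] f exit_rate_pos[OF x] L_pos by (intro sum_ennreal) (auto intro!: divide_nonneg_pos mult_nonneg_nonneg)
  finally show ?thesis
    unfolding sum_off_diagonal[OF x, symmetric] by (simp add: sum_divide_distrib sum_distrib_left)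
qed

section \<open>The semigroup of the uniformized chain\<close>

definition series_coeff :: "'s \<Rightarrow> 's \<Rightarrow> nat \<Rightarrow> real" where
  "series_coeff y x n = L ^ n / fact n * pmf (pmf_iterate Q n x) y"

text \<open>Poisson mixture: the clock of rate \<open>L\<close> ticks a Poisson number
  \<open>n\<close> of times up to \<open>t\<close>, after which the law is that of \<open>n\<close>
  steps of \<open>Q\<close>. The form of a power series in \<open>t\<close> allows termwise
  differentiation.\<close>

definition semigroup :: "real \<Rightarrow> 's \<Rightarrow> 's \<Rightarrow> real" where
  "semigroup t x y = exp (- (L * t)) * (\<Sum>n. series_coeff y x n * t ^ n)"

lemma pmf_iterate_Suc:
  "pmf (pmf_iterate Q (Suc n) x) y = measure_pmf.expectation (Q x) (\<lambda>z. pmf (pmf_iterate Q n z) y)"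
  by (simp add: pmf_bind)

lemma summable_series: "summable (\<lambda>n. series_coeff y x n * t ^ n)"
proof (rule summable_comparison_test')
  show "summable (\<lambda>n. (L * \<bar>t\<bar>) ^ n / fact n)"
    using summable_exp[of "L * \<bar>t\<bar>"] by (simp add: field_simps)
  fix n
  show "norm (series_coeff y x n * t ^ n) \<le> (L * \<bar>t\<bar>) ^ n / fact n"
    using L_pos pmf_le_1[of "pmf_iterate Q n x" y]
    by (simp add: series_coeff_def abs_mult power_abs power_mult_distrib field_simps mult_left_le_one_le mult_right_le_one_le)
qed

text \<open>Differentiating the power series shifts its index, and the additional step of
  \<open>Q\<close> is split off at the front. In \<open>semigroup_deriv\<close> this becomes
  Kolmogorov's backward equation.\<close>

lemma series_deriv:
  assumes x: "x \<in> S"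
  shows "((\<lambda>t. \<Sum>n. series_coeff y x n * t ^ n) has_field_derivative
     L * measure_pmf.expectation (Q x) (\<lambda>z. \<Sum>n. series_coeff y z n * t ^ n)) (at t)"
proof -
  have d: "diffs (series_coeff y x) n * t ^ n
     = L * (\<Sum>z\<in>set_pmf (Q x). pmf (Q x) z * (series_coeff y z n * t ^ n))" for n
  proof -
    have "diffs (series_coeff y x) n = L * (L ^ n / fact n) * pmf (pmf_iterate Q (Suc n) x) y"
      unfolding diffs_def series_coeff_def fact_Suc power_Suc
      by (simp del: pmf_iterate.simps of_nat_Suc)
    then show ?thesis
      unfolding pmf_iterate_Suc expectation_Q[OF x]
      by (simp add: sum_distrib_left sum_distrib_right series_coeff_def algebra_simps)
  qed
  have "(\<Sum>n. diffs (series_coeff y x) n * t ^ n)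
     = L * (\<Sum>z\<in>set_pmf (Q x). pmf (Q x) z * (\<Sum>n. series_coeff y z n * t ^ n))"
    unfolding d
    by (subst suminf_mult) (auto simp: suminf_sum suminf_mult summable_series intro!: summable_sum summable_mult)
  moreover have "((\<lambda>t. \<Sum>n. series_coeff y x n * t ^ n) has_field_derivative
      (\<Sum>n. diffs (series_coeff y x) n * t ^ n)) (at t)"
    by (rule termdiffs_strong_converges_everywhere) (rule summable_series)
  ultimately show ?thesis by (simp add: expectation_Q[OF x])
qed

lemma semigroup_deriv:
  assumes x: "x \<in> S"
  shows "((\<lambda>t. semigroup t x y) has_field_derivative
     L * (measure_pmf.expectation (Q x) (\<lambda>z. semigroup t z y) - semigroup t x y)) (at t)"
  unfolding semigroup_def
  by (rule derivative_eq_intros series_deriv[OF x] refl)+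
     (simp add: expectation_Q[OF x] sum_distrib_left algebra_simps)

lemma semigroup_0: "semigroup 0 x y = indicator {x} y"
proof -
  have "(\<Sum>n. series_coeff y x n * 0 ^ n) = series_coeff y x 0"
    using powser_zero[of "series_coeff y x"] by simp
  then show ?thesis by (simp add: semigroup_def series_coeff_def split: split_indicator)
qed

lemma semigroup_nonneg: "0 \<le> t \<Longrightarrow> 0 \<le> semigroup t x y"
  unfolding semigroup_def using L_pos
  by (intro mult_nonneg_nonneg suminf_nonneg summable_series) (auto simp: series_coeff_def)

lemma ennreal_semigroup:
  assumes t: "0 \<le> t"
  shows "ennreal (semigroup t x y)
    = (\<Sum>n. ennreal (exp (- (L * t)) * (L * t) ^ n / fact n) * ennreal (pmf (pmf_iterate Q n x) y))"
proof -
  have "(\<Sum>n. ennreal (exp (- (L * t)) * (L * t) ^ n / fact n) * ennreal (pmf (pmf_iterate Q n x) y))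
    = (\<Sum>n. ennreal (exp (- (L * t)) * (series_coeff y x n * t ^ n)))"
    using t L_pos
    by (intro suminf_cong) (simp add: ennreal_mult'[symmetric] series_coeff_def power_mult_distrib)
  also have "\<dots> = ennreal (\<Sum>n. exp (- (L * t)) * (series_coeff y x n * t ^ n))"
    using t L_pos by (intro suminf_ennreal2 summable_mult summable_series) (auto simp: series_coeff_def)
  also have "\<dots> = ennreal (semigroup t x y)"
    unfolding semigroup_def by (subst suminf_mult[OF summable_series]) simp
  finally show ?thesis by simp
qed

lemma poisson_sums: "(\<lambda>n. exp (- (L * t)) * (L * t) ^ n / fact n) sums 1"
proof -
  have "(\<lambda>n. exp (- (L * t)) * ((L * t) ^ n /\<^sub>R fact n)) sums (exp (- (L * t)) * exp (L * t))"
    by (intro sums_mult exp_converges)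
  then show ?thesis by (simp add: exp_minus field_simps)
qed

lemma suminf_poisson: "0 \<le> t \<Longrightarrow> (\<Sum>n. ennreal (exp (- (L * t)) * (L * t) ^ n / fact n)) = 1"
  using poisson_sums[of t] L_pos
  by (subst suminf_ennreal2) (auto simp: sums_iff)

lemma semigroup_le_1: "0 \<le> t \<Longrightarrow> semigroup t x y \<le> 1"
proof -
  assume t: "0 \<le> t"
  have "ennreal (semigroup t x y) \<le> (\<Sum>n. ennreal (exp (- (L * t)) * (L * t) ^ n / fact n) * 1)"
    unfolding ennreal_semigroup[OF t]
    by (intro suminf_le mult_left_mono) (auto simp: pmf_le_1)
  then show ?thesis using suminf_poisson[OF t] by simp
qed

text \<open>The backward equation, integrated against the law of the first sojourn.\<close>

lemma semigroup_first_jump: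
  assumes x: "x \<in> S" and r: "0 \<le> r"
  shows "(\<integral>\<^sup>+s. (if s \<le> r then \<integral>\<^sup>+z. ennreal (semigroup (r - s) z y) \<partial>jump_pmf q x else indicator {x} y)
      \<partial>sojourn_law q x) = ennreal (semigroup r x y)"
proof -
  define a where "a = exit_rate q x"
  have a: "0 < a" using exit_rate_pos[OF x] by (simp add: a_def)
  define E where "E = (\<lambda>s. L * (measure_pmf.expectation (Q x) (\<lambda>z. semigroup (r - s) z y)
      - pmf (Q x) x * semigroup (r - s) x y))"
  \<comment> \<open>An antiderivative of the integrand on \<open>s \<le> r\<close>: since
    \<open>a = L * (1 - pmf (Q x) x)\<close>, the derivative of the exponential cancels the diagonal
    part of the backward equation. If \<open>y = x\<close>, its value at \<open>r\<close> is minus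
    the probability of no jump up to \<open>r\<close>, which the other branch of the integrand
    adds.\<close>
  define G where "G = (\<lambda>s. - exp (- (a * s)) * semigroup (r - s) x y)"
  have cont: "continuous_on UNIV (\<lambda>t. semigroup t z y)" if "z \<in> S" for z
    using semigroup_deriv[OF that] by (auto intro!: continuous_at_imp_continuous_on DERIV_isCont)
  have E_nonneg: "0 \<le> E s" if "s \<le> r" for s
  proof -
    have "E s = L * (\<Sum>z\<in>set_pmf (Q x) - {x}. pmf (Q x) z * semigroup (r - s) z y)"
      unfolding E_def sum_off_diagonal[OF x] ..
    also have "0 \<le> \<dots>"
      using L_pos that by (intro mult_nonneg_nonneg sum_nonneg semigroup_nonneg) auto
    finally show ?thesis .
  qed
  have G: "(G has_real_derivative exp (- (a * s)) * E s) (at s)" for s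
  proof -
    have D: "((\<lambda>s. semigroup (r - s) x y) has_field_derivative
       - (L * (measure_pmf.expectation (Q x) (\<lambda>z. semigroup (r - s) z y) - semigroup (r - s) x y))) (at s)"
    proof -
      have "((\<lambda>s. r - s) has_field_derivative - 1) (at s)"
        by (auto intro!: derivative_eq_intros)
      from DERIV_chain2[where f="\<lambda>t. semigroup t x y" and g="\<lambda>s. r - s", OF semigroup_deriv[OF x] this]
      show ?thesis by simp
    qed
    have "(G has_real_derivative
        - exp (- (a * s)) * - (L * (measure_pmf.expectation (Q x) (\<lambda>z. semigroup (r - s) z y) - semigroup (r - s) x y))
        + (a * exp (- (a * s))) * semigroup (r - s) x y) (at s)"
      unfolding G_def by (rule derivative_eq_intros D refl)+ (simp add: algebra_simps)
    then show ?thesis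
      by (rule back_subst[of "\<lambda>D. (G has_real_derivative D) (at s)"])
         (simp add: E_def a_def exit_rate_eq[OF x] algebra_simps)
  qed
  have [measurable]: "(\<lambda>s. E s) \<in> borel_measurable borel"
    unfolding E_def expectation_Q[OF x] using closed[OF x] x
    by (intro borel_measurable_continuous_onI continuous_intros
          continuous_on_compose2[OF cont, where f="\<lambda>s. r - s"]) auto
  have "(\<integral>\<^sup>+s. (if s \<le> r then \<integral>\<^sup>+z. ennreal (semigroup (r - s) z y) \<partial>jump_pmf q x else indicator {x} y)
      \<partial>sojourn_law q x)
    = (\<integral>\<^sup>+s. (if s \<le> r then ennreal (E s / a) else indicator {x} y) \<partial>sojourn_law q x)"
    by (intro nn_integral_cong)
       (auto simp: E_def a_def x semigroup_nonneg intro!: nn_integral_jump_pmf)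
  also have "\<dots> = (\<integral>\<^sup>+s. ennreal (exponential_density a s) * (if s \<le> r then ennreal (E s / a) else indicator {x} y) \<partial>lborel)"
    by (subst nn_integral_density) (auto simp: sojourn_rate_eq[OF x] a_def)
  also have "\<dots> = (\<integral>\<^sup>+s. ennreal (exp (- (a * s)) * E s) * indicator {0..r} s
        + indicator {x} y * (ennreal (a * exp (- (a * s))) * indicator {r<..} s) \<partial>lborel)"
    using r a E_nonneg
    by (intro nn_integral_cong)
       (auto simp: exponential_density_def ennreal_mult'[symmetric] mult.commute split: split_indicator)
  also have "\<dots> = (\<integral>\<^sup>+s. ennreal (exp (- (a * s)) * E s) * indicator {0..r} s \<partial>lborel)
        + indicator {x} y * (\<integral>\<^sup>+s. ennreal (a * exp (- (a * s))) * indicator {r<..} s \<partial>lborel)"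
    by (subst nn_integral_add) (auto simp: nn_integral_cmult)
  also have "(\<integral>\<^sup>+s. ennreal (exp (- (a * s)) * E s) * indicator {0..r} s \<partial>lborel) = G r - G 0"
    using r E_nonneg G by (intro nn_integral_FTC_Icc) auto
  also have "(\<integral>\<^sup>+s. ennreal (a * exp (- (a * s))) * indicator {r<..} s \<partial>lborel)
      = (\<integral>\<^sup>+s. ennreal (a * exp (- (a * s))) * indicator {r..} s \<partial>lborel)"
    by (intro nn_integral_cong_AE eventually_mono[OF AE_lborel_singleton[of r]])
       (auto split: split_indicator)
  also have "\<dots> = ennreal (0 - (- exp (- (a * r))))"
  proof (rule nn_integral_FTC_atLeast)
    show "((\<lambda>s. - exp (- (a * s))) \<longlongrightarrow> 0) at_top"
    proof -
      have "LIM s at_top. - (a * s) :> at_bot"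
        unfolding filterlim_uminus_at_bot using a
        by (simp, intro filterlim_tendsto_pos_mult_at_top[OF tendsto_const] filterlim_ident) auto
      from tendsto_minus[OF filterlim_compose[OF exp_at_bot this]] show ?thesis by simp
    qed
  qed (use a in \<open>auto intro!: derivative_eq_intros\<close>)
  also have "ennreal (G r - G 0) + indicator {x} y * ennreal (0 - - exp (- (a * r))) = ennreal (semigroup r x y)"
  proof (cases "y = x")
    case True
    have "ennreal (G r - G 0) + ennreal (exp (- (a * r))) = ennreal (G r - G 0 + exp (- (a * r)))"
    proof (rule ennreal_plus[symmetric])
      have "G 0 \<le> G r"
        using r G E_nonneg by (intro DERIV_nonneg_imp_nondecreasing[of 0 r G]) (force intro!: mult_nonneg_nonneg)+
      then show "0 \<le> G r - G 0" by simp
    qed simp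
    then show ?thesis using True by (simp add: G_def semigroup_0)
  qed (simp add: G_def semigroup_0)
  finally show ?thesis .
qed

end

section \<open>Transition probabilities from the path measure\<close>

lemma state_at_eq_Some_iff:
  "state_at \<omega> t = Some y \<longleftrightarrow>
     (\<exists>n. t < jump_time \<omega> (Suc n) \<and> (\<forall>k<n. \<not> t < jump_time \<omega> (Suc k)) \<and> fst (\<omega> n) = y)"
proof
  assume s: "state_at \<omega> t = Some y"
  then have ex: "\<exists>n. t < jump_time \<omega> (Suc n)" and y: "fst (\<omega> (LEAST n. t < jump_time \<omega> (Suc n))) = y"
    by (auto simp: state_at_def split: if_splits)
  show "\<exists>n. t < jump_time \<omega> (Suc n) \<and> (\<forall>k<n. \<not> t < jump_time \<omega> (Suc k)) \<and> fst (\<omega> n) = y"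
    using LeastI_ex[OF ex] not_less_Least y by blast
next
  assume "\<exists>n. t < jump_time \<omega> (Suc n) \<and> (\<forall>k<n. \<not> t < jump_time \<omega> (Suc k)) \<and> fst (\<omega> n) = y"
  then obtain n where n: "t < jump_time \<omega> (Suc n)" "\<forall>k<n. \<not> t < jump_time \<omega> (Suc k)" "fst (\<omega> n) = y"
    by blast
  then have "(LEAST n. t < jump_time \<omega> (Suc n)) = n"
    by (intro Least_equality) (auto simp: not_less[symmetric])
  with n show "state_at \<omega> t = Some y" by (auto simp: state_at_def)
qed

lemma jump_time_mono:
  assumes "\<forall>n. 0 < snd (\<omega> n)" "m \<le> n"
  shows "jump_time \<omega> m \<le> jump_time \<omega> n"
  unfolding jump_time_def using assms by (intro sum_mono2) (auto intro: less_imp_le)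

lemma jump_time_0[simp]: "jump_time \<omega> 0 = 0"
  by (simp add: jump_time_def)

lemma jump_time_nonneg: "\<forall>n. 0 < snd (\<omega> n) \<Longrightarrow> 0 \<le> jump_time \<omega> n"
  using jump_time_mono[of \<omega> 0 n] by simp

lemma state_at_between_jumps:
  assumes pos: "\<forall>n. 0 < snd (\<omega> n)" and "jump_time \<omega> n \<le> t" "t < jump_time \<omega> (Suc n)"
  shows "state_at \<omega> t = Some (fst (\<omega> n))"
  unfolding state_at_eq_Some_iff
proof (rule exI[of _ n], intro conjI allI impI)
  fix k assume "k < n"
  then show "\<not> t < jump_time \<omega> (Suc k)"
    using jump_time_mono[OF pos, of "Suc k" n] assms by simp
qed (use assms in auto)

lemma first_passage_iff:
  assumes pos: "\<forall>n. 0 < snd (\<omega> n)" and t: "0 \<le> t"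
  shows "(t < jump_time \<omega> (Suc n) \<and> (\<forall>k<n. \<not> t < jump_time \<omega> (Suc k)))
     \<longleftrightarrow> (jump_time \<omega> n \<le> t \<and> t < jump_time \<omega> (Suc n))"
proof -
  have "jump_time \<omega> n \<le> t" if "\<forall>k<n. \<not> t < jump_time \<omega> (Suc k)"
    using that t by (cases n) auto
  moreover have "\<not> t < jump_time \<omega> (Suc k)" if "jump_time \<omega> n \<le> t" "k < n" for k
    using that jump_time_mono[OF pos, of "Suc k" n] by simp
  ultimately show ?thesis by blast
qed

lemma nn_integral_exponential_laplace:
  assumes a: "0 < a"
  shows "(\<integral>\<^sup>+s. ennreal (exp (- s)) \<partial>density lborel (exponential_density a)) = ennreal (a / (a + 1))"
proof -
  have "(\<integral>\<^sup>+s. ennreal (exp (- s)) \<partial>density lborel (exponential_density a))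
      = (\<integral>\<^sup>+s. ennreal (exponential_density a s) * ennreal (exp (- s)) \<partial>lborel)"
    by (subst nn_integral_density) auto
  also have "\<dots> = (\<integral>\<^sup>+s. ennreal (a / (a + 1)) * ennreal (exponential_density (a + 1) s) \<partial>lborel)"
  proof (intro nn_integral_cong)
    fix s :: real
    have "exponential_density a s * exp (- s) = a / (a + 1) * exponential_density (a + 1) s"
    proof -
      have "exp (- (a * s)) * exp (- s) = exp (- ((a + 1) * s))"
        by (simp add: exp_add[symmetric] algebra_simps)
      then show ?thesis
        using a by (simp add: exponential_density_def mult.assoc mult.commute)
    qed
    then show "ennreal (exponential_density a s) * ennreal (exp (- s))
       = ennreal (a / (a + 1)) * ennreal (exponential_density (a + 1) s)"
      using a by (simp add: ennreal_mult'[symmetric] ennreal_mult''[symmetric])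
  qed
  also have "\<dots> = ennreal (a / (a + 1)) * emeasure (density lborel (exponential_density (a + 1))) UNIV"
    by (simp add: nn_integral_cmult emeasure_density)
  also have "emeasure (density lborel (exponential_density (a + 1))) UNIV = 1"
    using prob_space.emeasure_space_1[OF prob_space_exponential_density[of "a + 1"]] a by simp
  finally show ?thesis by simp
qed

lemma nn_integral_exponential_mean:
  assumes a: "0 < a"
  shows "(\<integral>\<^sup>+s. ennreal s \<partial>density lborel (exponential_density a)) = ennreal (1 / a)"
proof -
  have "(\<integral>\<^sup>+s. ennreal s \<partial>density lborel (exponential_density a))
      = (\<integral>\<^sup>+s. ennreal (erlang_density 0 a s * s ^ 1) \<partial>lborel)"
    by (subst nn_integral_density)
       (auto intro!: nn_integral_cong simp: ennreal_mult''[symmetric] ennreal_neg erlang_density_def)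
  also have "\<dots> = ennreal (1 / a)"
    using nn_integral_erlang_ith_moment[OF a, of 0 1] by simp
  finally show ?thesis .
qed

context uniformized
begin

lemma AE_in_S: "x \<in> S \<Longrightarrow> AE \<omega> in ctmc_law q x. \<forall>n. fst (\<omega> n) \<in> S"
  by (rule AE_closed) (use jump_closed in auto)

text \<open>All exit rates are at most \<open>L\<close>, so each sojourn contributes a factor of at
  most \<open>L / (L + 1)\<close> to the Laplace transform at 1. By comparison with
  \<open>exp t\<close>, many jumps before a fixed time \<open>t\<close> are unlikely.\<close>

lemma nonexplosion:
  assumes x: "x \<in> S"
  shows "(\<integral>\<^sup>+\<omega>. ennreal (exp (- jump_time \<omega> n)) \<partial>ctmc_law q x) \<le> ennreal ((L / (L + 1)) ^ n)"
proof (induction n)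
  case 0
  show ?case using prob_space.emeasure_space_1[OF prob_space_ctmc_law[of q x]] by simp
next
  case (Suc n)
  have "(\<integral>\<^sup>+\<omega>. ennreal (exp (- jump_time \<omega> (Suc n))) \<partial>ctmc_law q x)
     = (\<integral>\<^sup>+\<omega>. ennreal (exp (- jump_time \<omega> n)) * ennreal (exp (- snd (\<omega> n))) \<partial>ctmc_law q x)"
    by (simp add: jump_time_Suc exp_add[symmetric] ennreal_mult'[symmetric])
  also have "\<dots> = (\<integral>\<^sup>+\<omega>. \<integral>\<^sup>+s. ennreal (exp (- jump_time \<omega> n)) * ennreal (exp (- s))
      \<partial>sojourn_law q (fst (\<omega> n)) \<partial>ctmc_law q x)"
    by (rule nn_integral_resample_sojourn[where g="\<lambda>\<omega> z s. ennreal (exp (- jump_time \<omega> n)) * ennreal (exp (- s))"])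
       (auto cong: jump_time_cong)
  also have "\<dots> \<le> (\<integral>\<^sup>+\<omega>. ennreal (exp (- jump_time \<omega> n)) * ennreal (L / (L + 1)) \<partial>ctmc_law q x)"
  proof (rule nn_integral_mono_AE, use AE_in_S[OF x] in eventually_elim)
    case (elim \<omega>)
    define a where "a = sojourn_rate q (fst (\<omega> n))"
    have a: "0 < a" "a \<le> L"
      using elim exit_rate_pos exit_rate_le by (auto simp: a_def sojourn_rate_eq)
    then have "a / (a + 1) \<le> L / (L + 1)"
      using L_pos by (simp add: field_simps)
    then show ?case
      using nn_integral_exponential_laplace[OF a(1)]
      by (subst nn_integral_cmult) (auto simp: a_def intro!: mult_left_mono ennreal_leI)
  qed
  also have "\<dots> = (\<integral>\<^sup>+\<omega>. ennreal (exp (- jump_time \<omega> n)) \<partial>ctmc_law q x) * ennreal (L / (L + 1))"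
    by (rule nn_integral_multc) measurable
  also have "\<dots> \<le> ennreal ((L / (L + 1)) ^ n) * ennreal (L / (L + 1))"
    by (intro mult_right_mono Suc) simp
  also have "\<dots> = ennreal ((L / (L + 1)) ^ Suc n)"
    using L_pos by (simp add: ennreal_mult'[symmetric] mult.commute)
  finally show ?case .
qed

text \<open>
  By the strong Markov property this should be the conditional probability of being in \<open>y\<close> at time
  \<open>t\<close> given the path up to the jump \<open>n\<close>, if that jump occurs before \<open>t\<close>.
\<close>

definition remaining :: "real \<Rightarrow> 's \<Rightarrow> nat \<Rightarrow> (nat \<Rightarrow> 's \<times> real) \<Rightarrow> ennreal" where
  "remaining t y n \<omega> = (if jump_time \<omega> n \<le> t \<and> fst (\<omega> n) \<in> S
     then ennreal (semigroup (t - jump_time \<omega> n) (fst (\<omega> n)) y) else 0)"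

lemma measurable_semigroup: "z \<in> S \<Longrightarrow> (\<lambda>t. semigroup t z y) \<in> borel_measurable borel"
  using semigroup_deriv[of z y]
  by (auto intro!: borel_measurable_continuous_onI continuous_at_imp_continuous_on DERIV_isCont)

text \<open>Either the sojourn \<open>n\<close> lasts beyond \<open>t\<close>, which the event
  counts, or the rest is left to visit \<open>Suc n\<close>. This is
  \<open>semigroup_first_jump\<close> with the fresh sojourn and jump replaced by those of the
  path.\<close>

lemma nn_integral_remaining:
  assumes x: "x \<in> S"
  shows "(\<integral>\<^sup>+\<omega>. remaining t y n \<omega> \<partial>ctmc_law q x)
     = emeasure (ctmc_law q x) {\<omega>. jump_time \<omega> n \<le> t \<and> t < jump_time \<omega> (Suc n) \<and> fst (\<omega> n) = y}
     + (\<integral>\<^sup>+\<omega>. remaining t y (Suc n) \<omega> \<partial>ctmc_law q x)"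
proof -
  define B where "B = {\<omega> :: nat \<Rightarrow> 's \<times> real. jump_time \<omega> n \<le> t \<and> t < jump_time \<omega> (Suc n) \<and> fst (\<omega> n) = y}"
  define g where "g = (\<lambda>(\<omega> :: nat \<Rightarrow> 's \<times> real) z s. if jump_time \<omega> n \<le> t \<and> z \<in> S
     then (if s \<le> t - jump_time \<omega> n then \<integral>\<^sup>+z'. ennreal (semigroup (t - jump_time \<omega> n - s) z' y) \<partial>jump_pmf q z
           else indicator {z} y) else 0)"
  define h where "h = (\<lambda>(\<omega> :: nat \<Rightarrow> 's \<times> real) z. if jump_time \<omega> (Suc n) \<le> t \<and> z \<in> S
     then ennreal (semigroup (t - jump_time \<omega> (Suc n)) z y) else 0)"
  have g_meas: "(\<lambda>(\<omega>, z, s). g \<omega> z s) \<in> borel_measurable (path_space \<Otimes>\<^sub>M visit_space)"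
  proof -
    have m1: "case_prod (\<lambda>(\<omega>, s) z. g \<omega> z s) \<in> borel_measurable ((path_space \<Otimes>\<^sub>M borel) \<Otimes>\<^sub>M count_space UNIV)"
    proof (rule measurable_countable_support[OF countable_S])
      fix z assume z: "z \<in> S"
      have fin: "finite (set_pmf (jump_pmf q z))"
        using finite_Q[OF z] set_jump[OF z] by simp
      have ms: "(\<lambda>p :: (nat \<Rightarrow> 's \<times> real) \<times> real. semigroup (t - jump_time (fst p) n - snd p) z' y)
          \<in> borel_measurable (path_space \<Otimes>\<^sub>M borel)" if "z' \<in> set_pmf (jump_pmf q z)" for z'
      proof -
        have "z' \<in> S" using that jump_closed[OF z] by blast
        from measurable_compose[OF _ measurable_semigroup[OF this]]
        show ?thesis by measurable
      qed
      define K where "K = (\<lambda>p :: (nat \<Rightarrow> 's \<times> real) \<times> real. \<Sum>z'\<in>set_pmf (jump_pmf q z).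
         ennreal (semigroup (t - jump_time (fst p) n - snd p) z' y) * ennreal (pmf (jump_pmf q z) z'))"
      have [measurable]: "K \<in> borel_measurable (path_space \<Otimes>\<^sub>M borel)"
        unfolding K_def
        by (intro borel_measurable_sum borel_measurable_times_ennreal measurable_compose[OF ms measurable_ennreal] measurable_const) auto
      have K: "(\<integral>\<^sup>+z'. ennreal (semigroup (t - jump_time (fst p) n - snd p) z' y) \<partial>jump_pmf q z) = K p" for p
        unfolding K_def by (rule nn_integral_measure_pmf_finite[OF fin]) simp
      have "(\<lambda>p. g (fst p) z (snd p)) = (\<lambda>p. if jump_time (fst p) n \<le> t then
          (if snd p \<le> t - jump_time (fst p) n then K p else indicator {z} y) else 0)"
        unfolding g_def K using z by simp
      also have "\<dots> \<in> borel_measurable (path_space \<Otimes>\<^sub>M borel)"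
        by measurable
      finally have gz: "(\<lambda>p. g (fst p) z (snd p)) \<in> borel_measurable (path_space \<Otimes>\<^sub>M borel)" .
      show "(\<lambda>p. (case p of (\<omega>, s) \<Rightarrow> \<lambda>z. g \<omega> z s) z) \<in> borel_measurable (path_space \<Otimes>\<^sub>M borel)"
        using gz by (simp add: split_beta')
    qed (auto simp: g_def)
    have m2: "(\<lambda>p. ((fst p, snd (snd p)), fst (snd p)))
       \<in> path_space \<Otimes>\<^sub>M visit_space \<rightarrow>\<^sub>M (path_space \<Otimes>\<^sub>M borel) \<Otimes>\<^sub>M count_space UNIV"
      by measurable
    show ?thesis
      using measurable_compose[OF m2 m1] by (simp add: split_beta')
  qed
  have h_meas: "case_prod h \<in> borel_measurable (path_space \<Otimes>\<^sub>M count_space UNIV)"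
  proof (rule measurable_countable_support[OF countable_S])
    fix z assume z: "z \<in> S"
    have [measurable]: "(\<lambda>\<omega>. semigroup (t - jump_time \<omega> (Suc n)) z y) \<in> borel_measurable path_space"
      by (rule measurable_compose[OF _ measurable_semigroup[OF z]]) measurable
    show "(\<lambda>\<omega>. h \<omega> z) \<in> borel_measurable path_space"
      unfolding h_def by measurable
  qed (auto simp: h_def)
  have [measurable]: "B \<in> sets path_space"
  proof -
    have "Measurable.pred path_space (\<lambda>\<omega>. jump_time \<omega> n \<le> t \<and> t < jump_time \<omega> (Suc n) \<and> fst (\<omega> n) = y)"
      by measurable
    then show ?thesis unfolding B_def by (simp add: pred_def space_PiM space_pair_measure)
  qed
  have "(\<integral>\<^sup>+\<omega>. remaining t y n \<omega> \<partial>ctmc_law q x)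
      = (\<integral>\<^sup>+\<omega>. \<integral>\<^sup>+s. g \<omega> (fst (\<omega> n)) s \<partial>sojourn_law q (fst (\<omega> n)) \<partial>ctmc_law q x)"
  proof (intro nn_integral_cong)
    fix \<omega> :: "nat \<Rightarrow> 's \<times> real"
    show "remaining t y n \<omega> = (\<integral>\<^sup>+s. g \<omega> (fst (\<omega> n)) s \<partial>sojourn_law q (fst (\<omega> n)))"
    proof (cases "jump_time \<omega> n \<le> t \<and> fst (\<omega> n) \<in> S")
      case True
      then show ?thesis
        using semigroup_first_jump[of "fst (\<omega> n)" "t - jump_time \<omega> n" y]
        by (simp add: remaining_def g_def)
    qed (auto simp: remaining_def g_def)
  qed
  also have "\<dots> = (\<integral>\<^sup>+\<omega>. g \<omega> (fst (\<omega> n)) (snd (\<omega> n)) \<partial>ctmc_law q x)"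
  proof (rule nn_integral_resample_sojourn[OF g_meas, symmetric])
    fix \<omega> \<omega>' :: "nat \<Rightarrow> 's \<times> real" and z s assume "\<And>i. i < n \<Longrightarrow> \<omega> i = \<omega>' i"
    then have "jump_time \<omega> n = jump_time \<omega>' n" by (rule jump_time_cong)
    then show "g \<omega> z s = g \<omega>' z s" by (simp add: g_def)
  qed
  also have "\<dots> = (\<integral>\<^sup>+\<omega>. indicator B \<omega> + (\<integral>\<^sup>+z. h \<omega> z \<partial>jump_pmf q (fst (\<omega> n))) \<partial>ctmc_law q x)"
  proof (rule nn_integral_cong_AE, use AE_in_S[OF x] AE_sojourn_pos[of q x] in eventually_elim)
    case (elim \<omega>)
    then have "(\<integral>\<^sup>+z. h \<omega> z \<partial>jump_pmf q (fst (\<omega> n)))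
      = (\<integral>\<^sup>+z. (if jump_time \<omega> (Suc n) \<le> t then ennreal (semigroup (t - jump_time \<omega> (Suc n)) z y) else 0)
           \<partial>jump_pmf q (fst (\<omega> n)))"
      using jump_closed by (intro nn_integral_cong_AE) (auto simp: AE_measure_pmf_iff h_def)
    moreover have "0 < snd (\<omega> n)" "fst (\<omega> n) \<in> S" using elim by simp_all
    ultimately show ?case
      by (auto simp: g_def B_def jump_time_Suc algebra_simps split: split_indicator)
  qed
  also have "\<dots> = emeasure (ctmc_law q x) B + (\<integral>\<^sup>+\<omega>. \<integral>\<^sup>+z. h \<omega> z \<partial>jump_pmf q (fst (\<omega> n)) \<partial>ctmc_law q x)"
  proof (subst nn_integral_add)
    have "(\<lambda>\<omega>. \<integral>\<^sup>+z. h \<omega> z \<partial>jump_pmf q (fst (\<omega> n))) \<in> borel_measurable path_space"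
    proof (rule nn_integral_measurable_subprob_algebra2[OF h_meas])
      show "(\<lambda>\<omega>. measure_pmf (jump_pmf q (fst (\<omega> n)))) \<in> path_space \<rightarrow>\<^sub>M subprob_algebra (count_space UNIV)"
        by (rule measurable_compose[OF measurable_fst_path]) (auto simp: measure_subprob)
    qed
    then show "(\<lambda>\<omega>. \<integral>\<^sup>+z. h \<omega> z \<partial>jump_pmf q (fst (\<omega> n))) \<in> borel_measurable (ctmc_law q x)" by simp
  qed auto
  also have "(\<integral>\<^sup>+\<omega>. \<integral>\<^sup>+z. h \<omega> z \<partial>jump_pmf q (fst (\<omega> n)) \<partial>ctmc_law q x)
      = (\<integral>\<^sup>+\<omega>. h \<omega> (fst (\<omega> (Suc n))) \<partial>ctmc_law q x)"
  proof (rule nn_integral_jump[OF h_meas, symmetric])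
    fix \<omega> \<omega>' :: "nat \<Rightarrow> 's \<times> real" and z assume "\<And>i. i \<le> n \<Longrightarrow> \<omega> i = \<omega>' i"
    then have "jump_time \<omega> (Suc n) = jump_time \<omega>' (Suc n)" by (intro jump_time_cong) auto
    then show "h \<omega> z = h \<omega>' z" by (simp add: h_def)
  qed
  also have "(\<lambda>\<omega>. h \<omega> (fst (\<omega> (Suc n)))) = remaining t y (Suc n)"
    by (auto simp: h_def remaining_def)
  finally show ?thesis by (simp add: B_def)
qed

text \<open>Iterating \<open>nn_integral_remaining\<close> expresses the semigroup by the disjoint
  events that visit \<open>k\<close> is in progress at time \<open>t\<close>, up to a remainder
  which \<open>nonexplosion\<close> sends to zero.\<close>

lemma transition_prob_eq_semigroup:
  assumes x: "x \<in> S" and t: "0 \<le> t"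
  shows "transition_prob q t x y = semigroup t x y"
proof -
  define M where "M = ctmc_law q x"
  interpret M: prob_space M unfolding M_def by (rule prob_space_ctmc_law)
  define B where "B = (\<lambda>n. {\<omega> :: nat \<Rightarrow> 's \<times> real. jump_time \<omega> n \<le> t \<and> t < jump_time \<omega> (Suc n) \<and> fst (\<omega> n) = y})"
  define B' where "B' = (\<lambda>n. {\<omega> :: nat \<Rightarrow> 's \<times> real. t < jump_time \<omega> (Suc n) \<and> (\<forall>k<n. \<not> t < jump_time \<omega> (Suc k)) \<and> fst (\<omega> n) = y})"
  have sp: "space path_space = (UNIV :: (nat \<Rightarrow> 's \<times> real) set)" by (simp add: space_PiM space_pair_measure)
  have B[measurable]: "B n \<in> sets path_space" for n
  proof -
    have "Measurable.pred path_space (\<lambda>\<omega>. jump_time \<omega> n \<le> t \<and> t < jump_time \<omega> (Suc n) \<and> fst (\<omega> n) = y)"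
      by measurable
    then show ?thesis unfolding B_def by (simp add: pred_def sp)
  qed
  have B'[measurable]: "B' n \<in> sets path_space" for n
  proof -
    have "Measurable.pred path_space (\<lambda>\<omega>. t < jump_time \<omega> (Suc n) \<and> (\<forall>k<n. \<not> t < jump_time \<omega> (Suc k)) \<and> fst (\<omega> n) = y)"
      by measurable
    then show ?thesis unfolding B'_def by (simp add: pred_def sp)
  qed
  have sets_M: "sets M = sets path_space" by (simp add: M_def)
  have "{\<omega>. state_at \<omega> t = Some y} = (\<Union>n. B' n)"
    by (auto simp: state_at_eq_Some_iff B'_def)
  then have "emeasure M {\<omega>. state_at \<omega> t = Some y} = emeasure M (\<Union>n. B' n)" by simp
  also have "\<dots> = (\<Sum>n. emeasure M (B' n))"
  proof (rule suminf_emeasure[symmetric])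
    show "disjoint_family B'"
    proof -
      have "m = n" if "\<omega> \<in> B' m" "\<omega> \<in> B' n" for m n \<omega>
        using that unfolding B'_def by (cases m n rule: linorder_cases) auto
      then show ?thesis by (auto simp: disjoint_family_on_def)
    qed
  qed (auto simp: sets_M)
  also have "\<dots> = (\<Sum>n. emeasure M (B n))"
  proof (intro suminf_cong emeasure_eq_AE)
    fix n
    show "AE \<omega> in M. \<omega> \<in> B' n \<longleftrightarrow> \<omega> \<in> B n"
      unfolding M_def using AE_sojourn_pos[of q x]
    proof eventually_elim
      case (elim \<omega>)
      show ?case
        unfolding B_def B'_def mem_Collect_eq conj_assoc[symmetric] first_passage_iff[OF elim t] ..
    qed
  qed (auto simp: sets_M)
  finally have eq: "emeasure M {\<omega>. state_at \<omega> t = Some y} = (\<Sum>n. emeasure M (B n))" .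
  have partial: "ennreal (semigroup t x y) = (\<Sum>k<n. emeasure M (B k)) + (\<integral>\<^sup>+\<omega>. remaining t y n \<omega> \<partial>M)" for n
  proof (induction n)
    case 0
    have "(\<integral>\<^sup>+\<omega>. remaining t y 0 \<omega> \<partial>M) = (\<integral>\<^sup>+\<omega>. (if fst (\<omega> 0) \<in> S then ennreal (semigroup t (fst (\<omega> 0)) y) else 0) \<partial>M)"
      using t by (intro nn_integral_cong) (simp add: remaining_def)
    also have "\<dots> = ennreal (semigroup t x y)"
      unfolding M_def using x by (subst nn_integral_initial[where h="\<lambda>z. if z \<in> S then ennreal (semigroup t z y) else 0"]) simp
    finally show ?case by simp
  next
    case (Suc n)
    then show ?case
      unfolding M_def B_def using nn_integral_remaining[OF x, of t y n] by (simp add: add.assoc)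
  qed
  have rest: "(\<integral>\<^sup>+\<omega>. remaining t y n \<omega> \<partial>M) \<le> ennreal (exp t * (L / (L + 1)) ^ n)" for n
  proof -
    have "(\<integral>\<^sup>+\<omega>. remaining t y n \<omega> \<partial>M) \<le> (\<integral>\<^sup>+\<omega>. ennreal (exp t) * ennreal (exp (- jump_time \<omega> n)) \<partial>M)"
    proof (intro nn_integral_mono)
      fix \<omega> :: "nat \<Rightarrow> 's \<times> real"
      have "semigroup (t - jump_time \<omega> n) (fst (\<omega> n)) y \<le> exp t * exp (- jump_time \<omega> n)" if "jump_time \<omega> n \<le> t"
      proof -
        have "semigroup (t - jump_time \<omega> n) (fst (\<omega> n)) y \<le> 1" using that by (intro semigroup_le_1) simp
        also have "1 \<le> exp (t - jump_time \<omega> n)" using that by simp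
        finally show ?thesis by (simp add: exp_diff exp_minus field_simps)
      qed
      then show "remaining t y n \<omega> \<le> ennreal (exp t) * ennreal (exp (- jump_time \<omega> n))"
        by (auto simp: remaining_def ennreal_mult'[symmetric] intro!: ennreal_leI)
    qed
    also have "\<dots> = ennreal (exp t) * (\<integral>\<^sup>+\<omega>. ennreal (exp (- jump_time \<omega> n)) \<partial>M)"
      unfolding M_def by (rule nn_integral_cmult) simp
    also have "\<dots> \<le> ennreal (exp t) * ennreal ((L / (L + 1)) ^ n)"
      unfolding M_def by (intro mult_left_mono nonexplosion x) simp
    finally show ?thesis using L_pos by (simp add: ennreal_mult'[symmetric])
  qed
  have "(\<lambda>n. ennreal (exp t * (L / (L + 1)) ^ n)) \<longlonglongrightarrow> ennreal (exp t * 0)"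
    using L_pos by (intro tendsto_ennrealI tendsto_mult tendsto_const LIMSEQ_realpow_zero) auto
  then have lim0: "(\<lambda>n. ennreal (exp t * (L / (L + 1)) ^ n)) \<longlonglongrightarrow> 0" by simp
  have rest0: "(\<lambda>n. \<integral>\<^sup>+\<omega>. remaining t y n \<omega> \<partial>M) \<longlonglongrightarrow> 0"
    by (rule tendsto_sandwich[OF _ _ tendsto_const lim0]) (simp_all add: rest)
  have "(\<lambda>n. \<Sum>k<n. emeasure M (B k)) \<longlonglongrightarrow> (\<Sum>k. emeasure M (B k))"
    by (rule summable_LIMSEQ) simp
  from tendsto_add[OF this rest0]
  have "(\<lambda>n. ennreal (semigroup t x y)) \<longlonglongrightarrow> (\<Sum>k. emeasure M (B k))"
    by (simp only: partial[symmetric] add_0_right)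
  then have "ennreal (semigroup t x y) = (\<Sum>k. emeasure M (B k))"
    by (simp only: LIMSEQ_const_iff)
  with eq have "emeasure M {\<omega>. state_at \<omega> t = Some y} = ennreal (semigroup t x y)" by simp
  then show ?thesis
    unfolding transition_prob_def using semigroup_nonneg[OF t]
    by (simp add: measure_def M_def)
qed

end

lemma integrable_pmf_bounded:
  fixes f :: "'s \<Rightarrow> real"
  assumes "\<And>x. \<bar>f x\<bar> \<le> B"
  shows "integrable (measure_pmf p) f"
  by (rule measure_pmf.integrable_const_bound[where B=B]) (use assms in auto)

lemma ennreal_le_divideI:
  fixes a b c :: ennreal
  assumes "c \<noteq> 0" "c < \<infinity>" "c * a \<le> b"
  shows "a \<le> b / c"
proof -
  have "a = a * c / c" using assms(1,2) by (simp add: ennreal_mult_divide_eq)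
  also have "\<dots> \<le> b / c" using assms(3) by (intro divide_right_mono_ennreal) (simp add: mult.commute)
  finally show ?thesis .
qed

lemma ennreal_divide_finite: "a < \<infinity> \<Longrightarrow> 0 < c \<Longrightarrow> a / ennreal c < \<infinity>"
  by (cases a) (auto simp: divide_ennreal)

context uniformized
begin

section \<open>Stationary distributions and recurrence\<close>

lemma pmf_iterate_fun:
  "pmf_iterate Q 0 = return_pmf"
  "pmf_iterate Q (Suc n) = (\<lambda>x. bind_pmf (Q x) (pmf_iterate Q n))"
  by (simp_all add: fun_eq_iff)

lemma bind_pmf_iterate: "bind_pmf \<pi> Q = \<pi> \<Longrightarrow> bind_pmf \<pi> (pmf_iterate Q n) = \<pi>"
proof (induction n)
  case 0
  then show ?case by (simp add: pmf_iterate_fun bind_return_pmf')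
next
  case (Suc n)
  have "bind_pmf \<pi> (pmf_iterate Q (Suc n)) = bind_pmf (bind_pmf \<pi> Q) (pmf_iterate Q n)"
    by (simp add: pmf_iterate_fun bind_assoc_pmf)
  then show ?case using Suc by (simp del: pmf_iterate.simps)
qed

lemma expectation_transition_prob:
  assumes "set_pmf \<pi> \<subseteq> S" "0 \<le> t"
  shows "measure_pmf.expectation \<pi> (\<lambda>x. transition_prob q t x y) = measure_pmf.expectation \<pi> (\<lambda>x. semigroup t x y)"
  using assms by (intro integral_cong_AE) (auto simp: AE_measure_pmf_iff transition_prob_eq_semigroup)

text \<open>A law invariant under \<open>Q\<close> is invariant under all iterates of
  \<open>Q\<close>, hence under their Poisson mixtures.\<close>

lemma stationary_onI:
  assumes \<pi>: "set_pmf \<pi> \<subseteq> S" and inv: "bind_pmf \<pi> Q = \<pi>"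
  shows "stationary_on S q \<pi>"
  unfolding stationary_on_def
proof (intro conjI allI impI ballI \<pi>)
  fix t :: real and y assume t: "0 \<le> t"
  have "(\<integral>\<^sup>+x. ennreal (semigroup t x y) \<partial>\<pi>)
     = (\<Sum>n. \<integral>\<^sup>+x. ennreal (exp (- (L * t)) * (L * t) ^ n / fact n) * ennreal (pmf (pmf_iterate Q n x) y) \<partial>\<pi>)"
    unfolding ennreal_semigroup[OF t] by (rule nn_integral_suminf) simp
  also have "\<dots> = (\<Sum>n. ennreal (exp (- (L * t)) * (L * t) ^ n / fact n) * ennreal (pmf (bind_pmf \<pi> (pmf_iterate Q n)) y))"
    by (simp add: nn_integral_cmult ennreal_pmf_bind)
  also have "\<dots> = (\<Sum>n. ennreal (exp (- (L * t)) * (L * t) ^ n / fact n)) * ennreal (pmf \<pi> y)"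
    unfolding bind_pmf_iterate[OF inv] by simp
  finally have "(\<integral>\<^sup>+x. ennreal (semigroup t x y) \<partial>\<pi>) = ennreal (pmf \<pi> y)"
    using suminf_poisson[OF t] by simp
  moreover have "measure_pmf.expectation \<pi> (\<lambda>x. semigroup t x y) = enn2real (\<integral>\<^sup>+x. ennreal (semigroup t x y) \<partial>\<pi>)"
    by (rule integral_eq_nn_integral) (auto simp: semigroup_nonneg t)
  ultimately show "measure_pmf.expectation \<pi> (\<lambda>x. transition_prob q t x y) = pmf \<pi> y"
    using expectation_transition_prob[OF \<pi> t] by simp
qed

lemma semigroup_lower_bound:
  assumes t: "0 \<le> t"
  shows "exp (- (L * t)) * (indicator {x} y + L * t * pmf (Q x) y) \<le> semigroup t x y"
proof -
  let ?f = "\<lambda>n. exp (- (L * t)) * (series_coeff y x n * t ^ n)"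
  have "sum ?f {..<2} \<le> suminf ?f"
    using t L_pos by (intro sum_le_suminf summable_mult summable_series) (auto simp: series_coeff_def)
  also have "suminf ?f = semigroup t x y"
    unfolding semigroup_def by (rule suminf_mult[OF summable_series])
  finally show ?thesis
    by (cases "x = y")
       (simp_all add: numeral_2_eq_2 series_coeff_def pmf_iterate_fun bind_return_pmf' algebra_simps)
qed

text \<open>\<open>semigroup_lower_bound\<close> keeps only the terms with at most one tick of the
  clock. If \<open>\<pi>\<close> were not invariant, some state \<open>y\<close> would gain mass
  under \<open>Q\<close>, total mass being conserved; but stationarity at small times gives
  \<open>b \<le> a * (1 + h)\<close> for every small \<open>h\<close>.\<close>

lemma stationary_onD:
  assumes st: "stationary_on S q \<pi>"
  shows "bind_pmf \<pi> Q = \<pi>"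
proof (rule ccontr)
  assume "bind_pmf \<pi> Q \<noteq> \<pi>"
  then obtain y where y: "pmf \<pi> y < pmf (bind_pmf \<pi> Q) y"
    using pmf_neq_exists_less[of \<pi> "bind_pmf \<pi> Q"] by metis
  have \<pi>: "set_pmf \<pi> \<subseteq> S" using st by (simp add: stationary_on_def)
  have "y \<in> set_pmf (bind_pmf \<pi> Q)"
    using y by (metis pmf_nonneg pmf_positive_iff less_le_trans not_le order.strict_trans2)
  then have "y \<in> S" using \<pi> closed by auto
  define a b where "a = pmf \<pi> y" and "b = pmf (bind_pmf \<pi> Q) y"
  have bound: "b \<le> a * (1 + h)" if h: "0 < h" "h \<le> 1" for h
  proof -
    define t where "t = h / L"
    have t: "0 \<le> t" "L * t = h" using h L_pos by (auto simp: t_def)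
    have ind: "measure_pmf.expectation \<pi> (\<lambda>x. indicator {x} y :: real) = a"
    proof -
      have "(\<lambda>x. indicator {x} y :: real) = indicator {y}"
        by (auto simp: fun_eq_iff split: split_indicator)
      then show ?thesis by (simp add: a_def measure_pmf_single)
    qed
    have Q: "measure_pmf.expectation \<pi> (\<lambda>x. pmf (Q x) y) = b"
      by (simp add: pmf_bind b_def)
    have i1: "integrable (measure_pmf \<pi>) (\<lambda>x. indicator {x} y :: real)"
      by (rule integrable_pmf_bounded[of _ 1]) (simp split: split_indicator)
    have i2: "integrable (measure_pmf \<pi>) (\<lambda>x. pmf (Q x) y)"
      by (rule integrable_pmf_bounded[of _ 1]) (simp add: pmf_le_1)
    have "exp (- h) * (a + h * b)
      = measure_pmf.expectation \<pi> (\<lambda>x. exp (- h) * (indicator {x} y + h * pmf (Q x) y))"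
      using i1 i2 by (simp add: ind Q)
    also have "\<dots> \<le> measure_pmf.expectation \<pi> (\<lambda>x. semigroup t x y)"
    proof (rule integral_mono)
      show "integrable (measure_pmf \<pi>) (\<lambda>x. exp (- h) * (indicator {x} y + h * pmf (Q x) y))"
        using i1 i2 by simp
      show "integrable (measure_pmf \<pi>) (\<lambda>x. semigroup t x y)"
        by (rule integrable_pmf_bounded[of _ 1]) (simp add: semigroup_nonneg semigroup_le_1 t)
      show "exp (- h) * (indicator {x} y + h * pmf (Q x) y) \<le> semigroup t x y" for x
        using semigroup_lower_bound[OF t(1), of x y] by (simp only: t(2))
    qed
    also have "\<dots> = a"
      using st t(1) \<open>y \<in> S\<close> expectation_transition_prob[OF \<pi> t(1), of y]
      by (auto simp: stationary_on_def a_def)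
    finally have "a + h * b \<le> a * exp h"
      by (simp add: exp_minus field_simps)
    also have "\<dots> \<le> a * (1 + h + h\<^sup>2)"
      using exp_bound[of h] h by (intro mult_left_mono) (auto simp: a_def)
    finally have "h * b \<le> h * (a * (1 + h))"
      by (simp add: power2_eq_square algebra_simps)
    then show ?thesis using h by simp
  qed
  have "b \<le> a + e" if "0 < e" for e
  proof -
    have "b \<le> a * (1 + min e 1)" using bound[of "min e 1"] that by simp
    also have "a * min e 1 \<le> 1 * min e 1"
      using pmf_le_1[of \<pi> y] that by (intro mult_right_mono) (auto simp: a_def)
    then have "a * (1 + min e 1) \<le> a + min e 1" by (simp add: algebra_simps)
    finally show ?thesis by simp
  qed
  then have "b \<le> a" by (rule field_le_epsilon)
  then show False using y by (simp add: a_def b_def)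
qed

text \<open>The indicator that visits \<open>1\<close> to \<open>n\<close> miss \<open>x\<close>;
  visit 0 is exempt because the path starts there. It is a product with values in
  \<open>ennreal\<close> so that the last factor can be integrated by
  \<open>nn_integral_jump\<close>.\<close>

primrec avoids :: "'s \<Rightarrow> nat \<Rightarrow> (nat \<Rightarrow> 's \<times> real) \<Rightarrow> ennreal" where
  "avoids x 0 \<omega> = 1"
| "avoids x (Suc n) \<omega> = avoids x n \<omega> * indicator (- {x}) (fst (\<omega> (Suc n)))"

lemma measurable_avoids[measurable]: "avoids x n \<in> borel_measurable path_space"
proof (induction n)
  case (Suc n)
  note [measurable] = Suc
  show ?case by simp
qed simp

lemma avoids_cong: "(\<And>i. i \<le> n \<Longrightarrow> \<omega> i = \<omega>' i) \<Longrightarrow> avoids x n \<omega> = avoids x n \<omega>'"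
  by (induction n) auto

lemma avoids_cases: "avoids x n \<omega> = 0 \<or> avoids x n \<omega> = 1"
  by (induction n) (auto split: split_indicator)

lemma nn_integral_avoids_jump:
  "(\<integral>\<^sup>+\<omega>. avoids x (Suc n) \<omega> * f (fst (\<omega> (Suc n))) \<partial>ctmc_law q x0)
   = (\<integral>\<^sup>+\<omega>. avoids x n \<omega> * (\<integral>\<^sup>+z. indicator (- {x}) z * f z \<partial>jump_pmf q (fst (\<omega> n))) \<partial>ctmc_law q x0)"
proof -
  have [measurable]: "(\<lambda>p. indicator (- {x}) (snd p) * f (snd p)) \<in> borel_measurable (path_space \<Otimes>\<^sub>M count_space UNIV)"
    by (rule measurable_compose[OF measurable_snd]) simp
  have "(\<integral>\<^sup>+\<omega>. avoids x n \<omega> * (indicator (- {x}) (fst (\<omega> (Suc n))) * f (fst (\<omega> (Suc n)))) \<partial>ctmc_law q x0)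
    = (\<integral>\<^sup>+\<omega>. \<integral>\<^sup>+z. avoids x n \<omega> * (indicator (- {x}) z * f z) \<partial>jump_pmf q (fst (\<omega> n)) \<partial>ctmc_law q x0)"
  proof (rule nn_integral_jump[where g="\<lambda>\<omega> z. avoids x n \<omega> * (indicator (- {x}) z * f z)"])
    show "(\<lambda>(\<omega>, z). avoids x n \<omega> * (indicator (- {x}) z * f z)) \<in> borel_measurable (path_space \<Otimes>\<^sub>M count_space UNIV)"
      unfolding split_beta' by measurable
    fix \<omega> \<omega>' :: "nat \<Rightarrow> 's \<times> real" and z assume "\<And>i. i \<le> n \<Longrightarrow> \<omega> i = \<omega>' i"
    then have "avoids x n \<omega> = avoids x n \<omega>'" by (rule avoids_cong)
    then show "avoids x n \<omega> * (indicator (- {x}) z * f z) = avoids x n \<omega>' * (indicator (- {x}) z * f z)"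
      by simp
  qed
  then show ?thesis by (simp add: nn_integral_cmult mult.assoc)
qed

lemma nn_integral_avoids_sojourn:
  assumes x0: "x0 \<in> S"
  shows "(\<integral>\<^sup>+\<omega>. avoids x n \<omega> * ennreal (snd (\<omega> n)) \<partial>ctmc_law q x0)
   = (\<integral>\<^sup>+\<omega>. avoids x n \<omega> * ennreal (1 / exit_rate q (fst (\<omega> n))) \<partial>ctmc_law q x0)"
proof -
  \<comment> \<open>Splits \<open>avoids\<close> into a part determined by the visits before
    \<open>n\<close> and the state of visit \<open>n\<close>, the form which resampling the sojourn
    requires.\<close>
  define p :: "(nat \<Rightarrow> 's \<times> real) \<Rightarrow> 's \<Rightarrow> ennreal"
    where "p = (\<lambda>\<omega> z. case n of 0 \<Rightarrow> 1 | Suc m \<Rightarrow> avoids x m \<omega> * indicator (- {x}) z)"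
  have p: "avoids x n \<omega> = p \<omega> (fst (\<omega> n))" for \<omega>
    by (cases n) (auto simp: p_def)
  have dep: "p \<omega> z = p \<omega>' z" if "\<And>i. i < n \<Longrightarrow> \<omega> i = \<omega>' i" for \<omega> \<omega>' z
    using that avoids_cong[of "n - 1" \<omega> \<omega>' x] by (cases n) (auto simp: p_def)
  have [measurable]: "(\<lambda>r. indicator (- {x}) (fst (snd r)) :: ennreal) \<in> borel_measurable (path_space \<Otimes>\<^sub>M visit_space)"
    by (rule measurable_compose[OF measurable_compose[OF measurable_snd measurable_fst]]) simp
  have pm[measurable]: "(\<lambda>r. p (fst r) (fst (snd r))) \<in> borel_measurable (path_space \<Otimes>\<^sub>M visit_space)"
    unfolding p_def by (cases n) auto
  have "(\<integral>\<^sup>+\<omega>. p \<omega> (fst (\<omega> n)) * ennreal (snd (\<omega> n)) \<partial>ctmc_law q x0)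
      = (\<integral>\<^sup>+\<omega>. \<integral>\<^sup>+s. p \<omega> (fst (\<omega> n)) * ennreal s \<partial>sojourn_law q (fst (\<omega> n)) \<partial>ctmc_law q x0)"
  proof (rule nn_integral_resample_sojourn[where g="\<lambda>\<omega> z s. p \<omega> z * ennreal s"])
    show "(\<lambda>(\<omega>, z, s). p \<omega> z * ennreal s) \<in> borel_measurable (path_space \<Otimes>\<^sub>M visit_space)"
      unfolding split_beta' by measurable
    fix \<omega> \<omega>' :: "nat \<Rightarrow> 's \<times> real" and z s assume "\<And>i. i < n \<Longrightarrow> \<omega> i = \<omega>' i"
    then have "p \<omega> z = p \<omega>' z" by (rule dep)
    then show "p \<omega> z * ennreal s = p \<omega>' z * ennreal s" by simp
  qed
  also have "\<dots> = (\<integral>\<^sup>+\<omega>. p \<omega> (fst (\<omega> n)) * ennreal (1 / exit_rate q (fst (\<omega> n))) \<partial>ctmc_law q x0)"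
  proof (rule nn_integral_cong_AE, use AE_in_S[OF x0] in eventually_elim)
    case (elim \<omega>)
    then show ?case
      using nn_integral_exponential_mean[OF exit_rate_pos[of "fst (\<omega> n)"]]
      by (simp add: nn_integral_cmult sojourn_rate_eq)
  qed
  finally show ?thesis unfolding p .
qed

lemma AE_initial: "AE \<omega> in ctmc_law q x. fst (\<omega> 0) = x"
proof -
  have "(\<integral>\<^sup>+\<omega>. indicator (- {x}) (fst (\<omega> 0)) \<partial>ctmc_law q x) = 0"
    by (subst nn_integral_initial) simp
  then have "AE \<omega> in ctmc_law q x. (indicator (- {x}) (fst (\<omega> 0)) :: ennreal) = 0"
    by (subst nn_integral_0_iff_AE[symmetric]) auto
  then show ?thesis by eventually_elim (auto split: split_indicator_asm)
qed

lemma AE_first_jump: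
  assumes x: "x \<in> S"
  shows "AE \<omega> in ctmc_law q x. fst (\<omega> 1) \<noteq> x"
proof -
  have "(\<integral>\<^sup>+\<omega>. indicator {x} (fst (\<omega> (Suc 0))) \<partial>ctmc_law q x)
    = (\<integral>\<^sup>+\<omega>. \<integral>\<^sup>+z. indicator {x} z \<partial>jump_pmf q (fst (\<omega> 0)) \<partial>ctmc_law q x)"
    by (rule nn_integral_jump[where g="\<lambda>\<omega> z. indicator {x} z"])
       (simp_all add: split_beta' measurable_compose[OF measurable_snd])
  also have "\<dots> = (\<integral>\<^sup>+\<omega>. 0 \<partial>ctmc_law q x)"
    by (rule nn_integral_cong_AE, use AE_initial[of x] in eventually_elim)
       (simp add: emeasure_pmf_single pmf_jump[OF x] rate[OF x])
  finally have "AE \<omega> in ctmc_law q x. (indicator {x} (fst (\<omega> (Suc 0))) :: ennreal) = 0"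
    by (subst nn_integral_0_iff_AE[symmetric]) auto
  then show ?thesis by eventually_elim (auto split: split_indicator_asm)
qed

text \<open>At the first visit \<open>m\<close> to \<open>x\<close> after the start, the jump time
  is the sum of the sojourns that \<open>avoids\<close> has not yet cut off. As
  \<open>return_time\<close> is an infimum, exhibiting this time is enough; the beginning of visit 1
  witnesses that \<open>x\<close> was left before.\<close>

lemma return_time_le:
  assumes pos: "\<forall>n. 0 < snd (\<omega> n)" and Y1: "fst (\<omega> 1) \<noteq> x"
    and ret: "avoids x n \<omega> = 0"
  shows "return_time x \<omega> \<le> (\<Sum>n. avoids x n \<omega> * ennreal (snd (\<omega> n)))"
proof -
  define m where "m = (LEAST n. avoids x n \<omega> = 0)"
  have m0: "avoids x m \<omega> = 0" unfolding m_def using ret by (rule LeastI)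
  have mk: "avoids x k \<omega> = 1" if "k < m" for k
    using not_less_Least[of k "\<lambda>n. avoids x n \<omega> = 0"] that avoids_cases[of x k \<omega>] by (auto simp: m_def)
  have "m \<noteq> 0" using m0 by (cases m) auto
  moreover have "m \<noteq> 1" using m0 Y1 by auto
  ultimately have m2: "2 \<le> m" by simp
  then obtain k where k: "m = Suc k" by (cases m) auto
  have Ym: "fst (\<omega> m) = x"
    using m0 mk[of k] by (auto simp: k split: split_indicator_asm)
  have J1: "jump_time \<omega> 1 < jump_time \<omega> 2"
    using pos by (simp add: numeral_2_eq_2 jump_time_Suc)
  have Jm: "jump_time \<omega> 2 \<le> jump_time \<omega> m"
    using m2 by (rule jump_time_mono[OF pos])
  have "state_at \<omega> (jump_time \<omega> m) = Some x"
    using state_at_between_jumps[OF pos, of m "jump_time \<omega> m"] pos Ym by (simp add: jump_time_Suc)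
  moreover have "state_at \<omega> (jump_time \<omega> 1) \<noteq> Some x"
    using state_at_between_jumps[OF pos, of 1 "jump_time \<omega> 1"] J1 Y1 by (simp add: numeral_2_eq_2)
  moreover have "0 \<le> jump_time \<omega> 1" "0 \<le> jump_time \<omega> m"
    using jump_time_nonneg[OF pos] by auto
  ultimately have "0 \<le> jump_time \<omega> m \<and> state_at \<omega> (jump_time \<omega> m) = Some x \<and>
      (\<exists>s. 0 \<le> s \<and> s < jump_time \<omega> m \<and> state_at \<omega> s \<noteq> Some x)"
    using J1 Jm by (intro conjI exI[of _ "jump_time \<omega> 1"]) auto
  then have "return_time x \<omega> \<le> ennreal (jump_time \<omega> m)"
    unfolding return_time_def by (intro Inf_lower CollectI exI[of _ "jump_time \<omega> m"]) simp
  also have "\<dots> = (\<Sum>k<m. avoids x k \<omega> * ennreal (snd (\<omega> k)))"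
    unfolding jump_time_def using pos mk by (subst sum_ennreal[symmetric]) (auto intro: less_imp_le)
  also have "\<dots> \<le> (\<Sum>n. avoids x n \<omega> * ennreal (snd (\<omega> n)))"
    by (rule sum_le_suminf) auto
  finally show ?thesis .
qed

text \<open>Foster's criterion with exceptional set \<open>{x}\<close>. From visit 1 on, each visit
  before the return lowers \<open>V\<close> by \<open>\<delta> * L\<close> times its mean sojourn,
  so these sojourns have a finite sum. The departure from \<open>x\<close> itself costs only the
  finite value \<open>V 1\<close>.\<close>

lemma positive_recurrentI:
  fixes v :: "'s \<Rightarrow> real"
  assumes x: "x \<in> S" and v: "\<And>z. z \<in> S \<Longrightarrow> 0 \<le> v z" and \<delta>: "0 < \<delta>"
    and drift: "\<And>z. z \<in> S \<Longrightarrow> z \<noteq> x \<Longrightarrow> measure_pmf.expectation (Q z) v \<le> v z - \<delta>"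
  shows "positive_recurrent q x"
proof -
  define M where "M = ctmc_law q x"
  define V where "V = (\<lambda>n. \<integral>\<^sup>+\<omega>. avoids x n \<omega> * ennreal (v (fst (\<omega> n))) \<partial>M)"
  define D where "D = (\<lambda>n. \<integral>\<^sup>+\<omega>. avoids x n \<omega> * ennreal (1 / exit_rate q (fst (\<omega> n))) \<partial>M)"
  \<comment> \<open>The chain is killed on its return, so the value of \<open>v\<close> at
    \<open>x\<close> is discarded. Since \<open>v x\<close> is nonnegative, this only improves the
    drift at the other states.\<close>
  define f where "f = (\<lambda>z. if z = x then 0 else v z)"
  have Jf: "(\<integral>\<^sup>+z'. indicator (- {x}) z' * ennreal (v z') \<partial>jump_pmf q z)
     = ennreal (L * (measure_pmf.expectation (Q z) f - pmf (Q z) z * f z) / exit_rate q z)" if "z \<in> S" for z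
    unfolding nn_integral_jump_pmf[OF that, of f, symmetric, unfolded f_def] f_def
    using v nn_integral_jump_pmf[OF that, of f]
    by (subst nn_integral_jump_pmf[OF that, symmetric]) (auto intro!: nn_integral_cong split: split_indicator)
  have local_drift: "(\<integral>\<^sup>+z'. indicator (- {x}) z' * ennreal (v z') \<partial>jump_pmf q z)
     + ennreal (\<delta> * L) * ennreal (1 / exit_rate q z) \<le> ennreal (v z)" if z: "z \<in> S" "z \<noteq> x" for z
  proof -
    have f_nonneg: "0 \<le> L * (measure_pmf.expectation (Q z) f - pmf (Q z) z * f z) / exit_rate q z"
      unfolding sum_off_diagonal[OF z(1), symmetric] using exit_rate_pos[OF z(1)] L_pos closed[OF z(1)] v
      by (intro divide_nonneg_pos mult_nonneg_nonneg sum_nonneg) (auto simp: f_def)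
    have "measure_pmf.expectation (Q z) f \<le> measure_pmf.expectation (Q z) v"
      unfolding expectation_Q[OF z(1)] using closed[OF z(1)] v
      by (intro sum_mono mult_left_mono) (auto simp: f_def)
    also have "\<dots> \<le> v z - \<delta>" by (rule drift[OF z])
    finally have "L * (measure_pmf.expectation (Q z) f + \<delta>) \<le> L * v z"
      using L_pos by (intro mult_left_mono) auto
    then have "L * (measure_pmf.expectation (Q z) f - pmf (Q z) z * f z) + \<delta> * L \<le> L * (1 - pmf (Q z) z) * v z"
      using z(2) by (simp add: f_def algebra_simps)
    then have "(L * (measure_pmf.expectation (Q z) f - pmf (Q z) z * f z) + \<delta> * L) / exit_rate q z \<le> v z"
      unfolding pos_divide_le_eq[OF exit_rate_pos[OF z(1)]] by (simp add: exit_rate_eq[OF z(1)] mult.commute)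
    then have "L * (measure_pmf.expectation (Q z) f - pmf (Q z) z * f z) / exit_rate q z + \<delta> * L * (1 / exit_rate q z) \<le> v z"
      by (simp add: add_divide_distrib)
    then show ?thesis
      unfolding Jf[OF z(1)] using f_nonneg exit_rate_pos[OF z(1)] L_pos \<delta>
      by (simp add: ennreal_mult'[symmetric] ennreal_plus[symmetric] ennreal_leI del: ennreal_plus)
  qed
  have m1: "(\<lambda>\<omega>. avoids x n \<omega> * h (fst (\<omega> n))) \<in> borel_measurable M" for n h
    by (simp add: M_def)
  have V_Suc: "V (Suc n) = (\<integral>\<^sup>+\<omega>. avoids x n \<omega> *
      (\<integral>\<^sup>+z'. indicator (- {x}) z' * ennreal (v z') \<partial>jump_pmf q (fst (\<omega> n))) \<partial>M)" for n
    unfolding V_def M_def by (rule nn_integral_avoids_jump)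
  have step: "V (Suc n) + ennreal (\<delta> * L) * D n \<le> V n" if n: "n \<noteq> 0" for n
  proof -
    have "V (Suc n) + ennreal (\<delta> * L) * D n
      = (\<integral>\<^sup>+\<omega>. avoids x n \<omega> * ((\<integral>\<^sup>+z'. indicator (- {x}) z' * ennreal (v z') \<partial>jump_pmf q (fst (\<omega> n)))
         + ennreal (\<delta> * L) * ennreal (1 / exit_rate q (fst (\<omega> n)))) \<partial>M)"
      unfolding V_Suc D_def M_def
      by (subst nn_integral_cmult[symmetric], simp, subst nn_integral_add[symmetric])
         (auto simp: algebra_simps)
    also have "\<dots> \<le> V n"
      unfolding V_def M_def
    proof (rule nn_integral_mono_AE, use AE_in_S[OF x] in eventually_elim)
      case (elim \<omega>)
      show ?case
      proof (cases "fst (\<omega> n) = x")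
        case True
        then have "avoids x n \<omega> = 0" using n by (cases n) auto
        then show ?thesis by simp
      next
        case False
        then show ?thesis using elim by (intro mult_left_mono local_drift) auto
      qed
    qed
    finally show ?thesis .
  qed
  have partial: "V (Suc n) + ennreal (\<delta> * L) * (\<Sum>k<n. D (Suc k)) \<le> V 1" for n
  proof (induction n)
    case (Suc n)
    have "V (Suc (Suc n)) + ennreal (\<delta> * L) * (\<Sum>k<Suc n. D (Suc k))
       = (V (Suc (Suc n)) + ennreal (\<delta> * L) * D (Suc n)) + ennreal (\<delta> * L) * (\<Sum>k<n. D (Suc k))"
      by (simp add: algebra_simps)
    also have "\<dots> \<le> V (Suc n) + ennreal (\<delta> * L) * (\<Sum>k<n. D (Suc k))"
      by (intro add_right_mono step) simp
    also have "\<dots> \<le> V 1" by (rule Suc)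
    finally show ?case .
  qed simp
  have "V 1 < \<infinity>"
  proof -
    have "V 1 = (\<integral>\<^sup>+\<omega>. (\<integral>\<^sup>+z'. indicator (- {x}) z' * ennreal (v z') \<partial>jump_pmf q (fst (\<omega> 0))) \<partial>M)"
      unfolding One_nat_def V_Suc by simp
    also have "\<dots> = (\<integral>\<^sup>+z'. indicator (- {x}) z' * ennreal (v z') \<partial>jump_pmf q x)"
      unfolding M_def by (rule nn_integral_initial)
    finally show ?thesis unfolding Jf[OF x] by simp
  qed
  have D_sum: "(\<Sum>n. D n) < \<infinity>"
  proof -
    have \<delta>L: "ennreal (\<delta> * L) \<noteq> 0" "ennreal (\<delta> * L) < \<infinity>" using \<delta> L_pos by auto
    have "(\<Sum>k<n. D (Suc k)) \<le> V 1 / ennreal (\<delta> * L)" for n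
    proof -
      have "ennreal (\<delta> * L) * (\<Sum>k<n. D (Suc k)) \<le> V 1"
        using partial[of n] by (rule order_trans[rotated]) simp
      then show ?thesis using \<delta>L by (intro ennreal_le_divideI)
    qed
    then have "(\<Sum>n. D (Suc n)) \<le> V 1 / ennreal (\<delta> * L)"
      by (intro suminf_le_const summableI)
    also have "\<dots> < \<infinity>"
      using \<open>V 1 < \<infinity>\<close> \<delta> L_pos by (intro ennreal_divide_finite) auto
    finally have "(\<Sum>n. D (Suc n)) < \<infinity>" .
    moreover have "D 0 < \<infinity>"
      unfolding D_def M_def by (simp add: nn_integral_initial[where h="\<lambda>z. ennreal (1 / exit_rate q z)"])
    ultimately show ?thesis
      using suminf_offset[of D 1] by (simp add: less_top)
  qed
  \<comment> \<open>\<open>return_time_le\<close> presupposes a return. Sojourns have mean at least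
    \<open>1 / L\<close>, so finite mean time before the return means a finite mean number of visits
    before it.\<close>
  have ret: "AE \<omega> in M. \<exists>n. avoids x n \<omega> = 0"
  proof -
    have "(\<integral>\<^sup>+\<omega>. avoids x n \<omega> \<partial>M) \<le> ennreal L * D n" for n
    proof -
      have "(\<integral>\<^sup>+\<omega>. avoids x n \<omega> \<partial>M) \<le> (\<integral>\<^sup>+\<omega>. ennreal L * (avoids x n \<omega> * ennreal (1 / exit_rate q (fst (\<omega> n)))) \<partial>M)"
        unfolding M_def
      proof (rule nn_integral_mono_AE, use AE_in_S[OF x] in eventually_elim)
        case (elim \<omega>)
        have "1 \<le> L * (1 / exit_rate q (fst (\<omega> n)))"
          using exit_rate_pos[of "fst (\<omega> n)"] exit_rate_le[of "fst (\<omega> n)"] elim by simp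
        then have "1 \<le> ennreal L * ennreal (1 / exit_rate q (fst (\<omega> n)))"
          using L_pos by (simp add: ennreal_mult'[symmetric])
        from mult_left_mono[OF this, of "avoids x n \<omega>"] show ?case by (simp add: mult_ac)
      qed
      then show ?thesis
        using m1[of n "\<lambda>z. ennreal (1 / exit_rate q z)"] by (simp add: D_def nn_integral_cmult)
    qed
    then have "(\<Sum>n. \<integral>\<^sup>+\<omega>. avoids x n \<omega> \<partial>M) \<le> (\<Sum>n. ennreal L * D n)"
      by (intro suminf_le) auto
    also have "\<dots> < \<infinity>" using D_sum by (simp add: ennreal_mult_less_top)
    finally have "(\<integral>\<^sup>+\<omega>. (\<Sum>n. avoids x n \<omega>) \<partial>M) < \<infinity>"
      by (subst nn_integral_suminf) (auto simp: M_def)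
    then have "AE \<omega> in M. (\<Sum>n. avoids x n \<omega>) \<noteq> \<infinity>"
      by (intro nn_integral_noteq_infinite) (auto simp: M_def)
    then show ?thesis
    proof eventually_elim
      case (elim \<omega>)
      show ?case
      proof (rule ccontr)
        assume "\<nexists>n. avoids x n \<omega> = 0"
        then have "avoids x n \<omega> = 1" for n using avoids_cases[of x n \<omega>] by auto
        then have "(\<Sum>n. avoids x n \<omega>) = (\<Sum>n::nat. 1::ennreal)" by simp
        also have "\<dots> = \<infinity>"
        proof (rule ccontr)
          assume "(\<Sum>n::nat. 1::ennreal) \<noteq> \<infinity>"
          then obtain r where "(\<Sum>n::nat. 1::ennreal) = ennreal r" "0 \<le> r"
            by (cases "\<Sum>n::nat. 1::ennreal") auto
          moreover obtain N :: nat where "r < real N" using reals_Archimedean2 by blast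
          moreover have "(\<Sum>n<N. 1::ennreal) \<le> (\<Sum>n::nat. 1::ennreal)"
            by (rule sum_le_suminf) auto
          ultimately have "ennreal (real N) \<le> ennreal r"
            by (simp add: ennreal_of_nat_eq_real_of_nat)
          with \<open>r < real N\<close> \<open>0 \<le> r\<close> show False by simp
        qed
        finally show False using elim by simp
      qed
    qed
  qed
  have "(\<integral>\<^sup>+\<omega>. return_time x \<omega> \<partial>M) \<le> (\<integral>\<^sup>+\<omega>. (\<Sum>n. avoids x n \<omega> * ennreal (snd (\<omega> n))) \<partial>M)"
  proof (rule nn_integral_mono_AE)
    show "AE \<omega> in M. return_time x \<omega> \<le> (\<Sum>n. avoids x n \<omega> * ennreal (snd (\<omega> n)))"
      using ret AE_sojourn_pos[of q x, folded M_def] AE_first_jump[OF x, folded M_def]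
      by eventually_elim (auto intro: return_time_le)
  qed
  also have "\<dots> = (\<Sum>n. D n)"
    unfolding D_def M_def by (subst nn_integral_suminf) (auto simp: nn_integral_avoids_sojourn[OF x])
  finally show ?thesis
    unfolding positive_recurrent_def using D_sum by (auto simp: M_def intro: le_less_trans)
qed

section \<open>Uniqueness and existence of invariant laws\<close>

lemma nn_integral_pmf_eq_count_space:
  "(\<integral>\<^sup>+y. ennreal (pmf p y) * f y \<partial>count_space UNIV) = (\<integral>\<^sup>+y. f y \<partial>measure_pmf p)"
  by (simp add: nn_integral_measure_pmf)

lemma nn_integral_count_space_swap:
  fixes f :: "'b \<Rightarrow> 'c \<Rightarrow> ennreal"
  shows "(\<integral>\<^sup>+x. \<integral>\<^sup>+y. f x y \<partial>count_space UNIV \<partial>count_space UNIV)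
     = (\<integral>\<^sup>+y. \<integral>\<^sup>+x. f x y \<partial>count_space UNIV \<partial>count_space UNIV)"
  using nn_integral_fst_count_space[of "\<lambda>(x, y). f x y"] nn_integral_snd_count_space[of "\<lambda>(x, y). f x y"]
  by simp

lemma ennreal_pmf_bind_count_space:
  "ennreal (pmf (bind_pmf \<pi> K) y) = (\<integral>\<^sup>+x. ennreal (pmf \<pi> x) * ennreal (pmf (K x) y) \<partial>count_space UNIV)"
  by (simp add: ennreal_pmf_bind nn_integral_measure_pmf)

text \<open>
  The minimum of two invariant distributions is subinvariant, hence invariant because it has finite
  mass. So the excess of an invariant distribution over the minimum is also invariant, and it
  spreads to every state that can be reached.
\<close>

lemma min_invariant_spread:
  fixes K :: "'s \<Rightarrow> 's pmf"
  assumes 1: "bind_pmf \<pi>1 K = \<pi>1" and 2: "bind_pmf \<pi>2 K = \<pi>2"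
    and less: "pmf \<pi>2 x < pmf \<pi>1 x" and K: "0 < pmf (K x) y"
  shows "pmf \<pi>2 y < pmf \<pi>1 y"
proof -
  define m where "m = (\<lambda>x. ennreal (min (pmf \<pi>1 x) (pmf \<pi>2 x)))"
  define mK where "mK = (\<lambda>y. \<integral>\<^sup>+x. m x * ennreal (pmf (K x) y) \<partial>count_space UNIV)"
  have inv1: "ennreal (pmf \<pi>1 y) = (\<integral>\<^sup>+z. ennreal (pmf \<pi>1 z) * ennreal (pmf (K z) y) \<partial>count_space UNIV)" for y
    using ennreal_pmf_bind_count_space[of \<pi>1 K y] by (simp only: 1)
  have inv2: "ennreal (pmf \<pi>2 y) = (\<integral>\<^sup>+z. ennreal (pmf \<pi>2 z) * ennreal (pmf (K z) y) \<partial>count_space UNIV)" for y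
    using ennreal_pmf_bind_count_space[of \<pi>2 K y] by (simp only: 2)
  have mK_le: "mK y \<le> m y" for y
  proof -
    have "mK y \<le> ennreal (pmf \<pi>1 y)"
      unfolding mK_def m_def
      by (subst inv1, intro nn_integral_mono mult_right_mono ennreal_leI) auto
    moreover have "mK y \<le> ennreal (pmf \<pi>2 y)"
      unfolding mK_def m_def
      by (subst inv2, intro nn_integral_mono mult_right_mono ennreal_leI) auto
    ultimately show ?thesis by (cases "pmf \<pi>1 y \<le> pmf \<pi>2 y") (auto simp: m_def)
  qed
  have mass: "(\<integral>\<^sup>+y. mK y \<partial>count_space UNIV) = (\<integral>\<^sup>+x. m x \<partial>count_space UNIV)"
  proof -
    have "(\<integral>\<^sup>+y. mK y \<partial>count_space UNIV)
        = (\<integral>\<^sup>+x. \<integral>\<^sup>+y. m x * ennreal (pmf (K x) y) \<partial>count_space UNIV \<partial>count_space UNIV)"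
      unfolding mK_def by (rule nn_integral_count_space_swap)
    also have "\<dots> = (\<integral>\<^sup>+x. m x \<partial>count_space UNIV)"
      by (simp add: nn_integral_cmult nn_integral_pmf)
    finally show ?thesis .
  qed
  have fin: "(\<integral>\<^sup>+x. m x \<partial>count_space UNIV) \<le> 1"
  proof -
    have "(\<integral>\<^sup>+x. m x \<partial>count_space UNIV) \<le> (\<integral>\<^sup>+x. ennreal (pmf \<pi>1 x) \<partial>count_space UNIV)"
      unfolding m_def by (intro nn_integral_mono ennreal_leI) auto
    then show ?thesis by (simp add: nn_integral_pmf)
  qed
  have m_fin: "(\<integral>\<^sup>+x. m x \<partial>count_space UNIV) \<noteq> \<infinity>"
    using fin by (auto simp: top_unique)
  have "(\<integral>\<^sup>+y. m y - mK y \<partial>count_space UNIV)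
     = (\<integral>\<^sup>+y. m y \<partial>count_space UNIV) - (\<integral>\<^sup>+y. mK y \<partial>count_space UNIV)"
    by (rule nn_integral_diff) (use m_fin mK_le in \<open>simp_all only: mass, simp_all\<close>)
  also have "\<dots> = 0"
    unfolding mass using m_fin by (simp add: ennreal_diff_self)
  finally have "AE y in count_space UNIV. m y - mK y = 0"
    by (subst (asm) nn_integral_0_iff_AE) auto
  then have "m y - mK y = 0" by (simp add: AE_count_space)
  then have m_inv: "m y \<le> mK y"
    by (simp add: diff_eq_0_iff_ennreal m_def)
  \<comment> \<open>At \<open>x\<close> the minimum equals \<open>pmf \<pi>2 x\<close>; the surplus
    of \<open>\<pi>1\<close> there carries the mass \<open>e\<close> to \<open>y\<close>, on top of
    what the invariant minimum delivers.\<close>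
  define e where "e = (pmf \<pi>1 x - pmf \<pi>2 x) * pmf (K x) y"
  have e: "0 < e" using less K by (simp add: e_def)
  have "ennreal (pmf \<pi>1 y) = (\<integral>\<^sup>+z. ennreal (pmf \<pi>1 z) * ennreal (pmf (K z) y) \<partial>count_space UNIV)"
    by (rule inv1)
  also have "\<dots> \<ge> (\<integral>\<^sup>+z. m z * ennreal (pmf (K z) y) + ennreal e * indicator {x} z \<partial>count_space UNIV)"
  proof (intro nn_integral_mono)
    fix z
    show "m z * ennreal (pmf (K z) y) + ennreal e * indicator {x} z \<le> ennreal (pmf \<pi>1 z) * ennreal (pmf (K z) y)"
    proof (cases "z = x")
      case True
      have "m x * ennreal (pmf (K x) y) + ennreal e = ennreal (pmf \<pi>2 x * pmf (K x) y) + ennreal e"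
        using less by (simp add: m_def ennreal_mult')
      also have "\<dots> = ennreal (pmf \<pi>2 x * pmf (K x) y + e)"
        using e by (intro ennreal_plus[symmetric]) auto
      also have "pmf \<pi>2 x * pmf (K x) y + e = pmf \<pi>1 x * pmf (K x) y"
        by (simp add: e_def left_diff_distrib)
      finally show ?thesis using True by (simp add: ennreal_mult')
    next
      case False
      then show ?thesis by (auto simp: m_def intro!: mult_right_mono ennreal_leI)
    qed
  qed
  also have "(\<integral>\<^sup>+z. m z * ennreal (pmf (K z) y) + ennreal e * indicator {x} z \<partial>count_space UNIV) = mK y + ennreal e"
    unfolding mK_def by (subst nn_integral_add) auto
  finally have "m y + ennreal e \<le> ennreal (pmf \<pi>1 y)"
    by (rule order_trans[OF add_right_mono[OF m_inv]])
  then have "ennreal (min (pmf \<pi>1 y) (pmf \<pi>2 y) + e) \<le> ennreal (pmf \<pi>1 y)"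
    using e by (subst ennreal_plus) (simp_all add: m_def)
  then have "min (pmf \<pi>1 y) (pmf \<pi>2 y) + e \<le> pmf \<pi>1 y"
    by simp
  then show ?thesis using e by linarith
qed

text \<open>Different laws of mass one exceed each other somewhere, in both directions, and by
  \<open>min_invariant_spread\<close> both excesses would spread to the same state
  \<open>y\<close>.\<close>

lemma invariant_unique:
  assumes 1: "set_pmf \<pi>1 \<subseteq> S" "bind_pmf \<pi>1 Q = \<pi>1" and 2: "set_pmf \<pi>2 \<subseteq> S" "bind_pmf \<pi>2 Q = \<pi>2"
    and reach: "\<And>x. x \<in> S \<Longrightarrow> \<exists>n. 0 < pmf (pmf_iterate Q n x) y"
  shows "\<pi>1 = \<pi>2"
proof (rule ccontr)
  assume ne: "\<pi>1 \<noteq> \<pi>2"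
  then obtain x1 where x1: "pmf \<pi>2 x1 < pmf \<pi>1 x1"
    using pmf_neq_exists_less[of \<pi>2 \<pi>1] by metis
  obtain x2 where x2: "pmf \<pi>1 x2 < pmf \<pi>2 x2"
    using pmf_neq_exists_less[of \<pi>1 \<pi>2] ne by metis
  have "x1 \<in> S" "x2 \<in> S"
    using x1 x2 1(1) 2(1) pmf_nonneg by (metis pmf_positive_iff subsetD le_less_trans)+
  with reach obtain n1 n2 where "0 < pmf (pmf_iterate Q n1 x1) y" "0 < pmf (pmf_iterate Q n2 x2) y"
    by meson
  then have "pmf \<pi>2 y < pmf \<pi>1 y" "pmf \<pi>1 y < pmf \<pi>2 y"
    using min_invariant_spread[OF bind_pmf_iterate[OF 1(2)] bind_pmf_iterate[OF 2(2)] x1]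
      min_invariant_spread[OF bind_pmf_iterate[OF 2(2)] bind_pmf_iterate[OF 1(2)] x2] by blast+
  then show False by simp
qed

text \<open>Mass at \<open>y\<close> after \<open>n\<close> steps of \<open>Q\<close> from
  \<open>a\<close> without a return to \<open>a\<close>. Summed over \<open>n\<close> this is the
  expected number of visits to \<open>y\<close> during an excursion.\<close>

primrec taboo :: "'s \<Rightarrow> nat \<Rightarrow> 's \<Rightarrow> ennreal" where
  "taboo a 0 y = indicator {a} y"
| "taboo a (Suc n) y = indicator (- {a}) y * (\<integral>\<^sup>+z. taboo a n z * ennreal (pmf (Q z) y) \<partial>count_space UNIV)"

lemma taboo_outside: "a \<in> S \<Longrightarrow> y \<notin> S \<Longrightarrow> taboo a n y = 0"
proof (induction n arbitrary: y)
  case (Suc n)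
  have "taboo a n z * ennreal (pmf (Q z) y) = 0" for z
    using Suc closed[of z] by (cases "z \<in> S") (auto simp: pmf_eq_0_set_pmf)
  then have "(\<integral>\<^sup>+z. taboo a n z * ennreal (pmf (Q z) y) \<partial>count_space UNIV) = (\<integral>\<^sup>+z. 0 \<partial>count_space (UNIV :: 's set))"
    by (intro nn_integral_cong) simp
  then show ?case by simp
qed (auto split: split_indicator)

text \<open>The occupation measure \<open>G\<close> of an excursion from \<open>a\<close> is
  invariant. The drift condition bounds the mean length \<open>Z\<close> of the excursion, so
  \<open>G\<close> can be normalized.\<close>

lemma invariant_exists:
  fixes v :: "'s \<Rightarrow> real"
  assumes a: "a \<in> S" and v: "\<And>z. z \<in> S \<Longrightarrow> 0 \<le> v z" and \<delta>: "0 < \<delta>"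
    and drift: "\<And>z. z \<in> S \<Longrightarrow> z \<noteq> a \<Longrightarrow> measure_pmf.expectation (Q z) v \<le> v z - \<delta>"
  shows "\<exists>\<pi>. set_pmf \<pi> \<subseteq> S \<and> bind_pmf \<pi> Q = \<pi>"
proof -
  let ?c = "count_space (UNIV :: 's set)"
  define M where "M = (\<lambda>n. \<integral>\<^sup>+y. taboo a n y \<partial>?c)"
  define R where "R = (\<lambda>n y. \<integral>\<^sup>+z. taboo a n z * ennreal (pmf (Q z) y) \<partial>?c)"
  define V where "V = (\<lambda>n. \<integral>\<^sup>+y. taboo a n y * ennreal (v y) \<partial>?c)"
  have R_mass: "(\<integral>\<^sup>+y. R n y * f y \<partial>?c) = (\<integral>\<^sup>+z. taboo a n z * (\<integral>\<^sup>+y. f y \<partial>Q z) \<partial>?c)" for n f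
  proof -
    have "(\<integral>\<^sup>+y. R n y * f y \<partial>?c) = (\<integral>\<^sup>+y. \<integral>\<^sup>+z. taboo a n z * (ennreal (pmf (Q z) y) * f y) \<partial>?c \<partial>?c)"
      unfolding R_def by (subst nn_integral_multc[symmetric]) (auto simp: mult.assoc)
    also have "\<dots> = (\<integral>\<^sup>+z. \<integral>\<^sup>+y. taboo a n z * (ennreal (pmf (Q z) y) * f y) \<partial>?c \<partial>?c)"
      by (rule nn_integral_count_space_swap)
    also have "\<dots> = (\<integral>\<^sup>+z. taboo a n z * (\<integral>\<^sup>+y. f y \<partial>Q z) \<partial>?c)"
      by (simp add: nn_integral_cmult nn_integral_pmf_eq_count_space)
    finally show ?thesis .
  qed
  have M0: "M 0 = 1"
  proof -
    have "M 0 = (\<integral>\<^sup>+y. indicator {a} y \<partial>?c)" unfolding M_def by (intro nn_integral_cong) simp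
    then show ?thesis by simp
  qed
  have M_Suc: "M (Suc n) + R n a = M n" for n
  proof -
    have "M (Suc n) + R n a = (\<integral>\<^sup>+y. taboo a (Suc n) y + R n a * indicator {a} y \<partial>?c)"
      unfolding M_def by (subst nn_integral_add) auto
    also have "\<dots> = (\<integral>\<^sup>+y. R n y * 1 \<partial>?c)"
      by (intro nn_integral_cong) (auto simp: R_def split: split_indicator)
    also have "\<dots> = M n"
      unfolding R_mass by (simp add: M_def)
    finally show ?thesis .
  qed
  have V_Suc: "V (Suc n) \<le> (\<integral>\<^sup>+z. taboo a n z * (\<integral>\<^sup>+y. ennreal (v y) \<partial>Q z) \<partial>?c)" for n
    unfolding V_def R_mass[symmetric]
    by (intro nn_integral_mono mult_right_mono) (auto simp: R_def split: split_indicator)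
  have Qv: "(\<integral>\<^sup>+y. ennreal (v y) \<partial>Q z) = ennreal (measure_pmf.expectation (Q z) v)" if "z \<in> S" for z
    using closed[OF that] v
    by (intro nn_integral_eq_integral integrable_measure_pmf_finite finite_Q[OF that]) (auto simp: AE_measure_pmf_iff)
  have Qv_nonneg: "0 \<le> measure_pmf.expectation (Q z) v" if "z \<in> S" for z
    using closed[OF that] v by (intro integral_nonneg_AE) (auto simp: AE_measure_pmf_iff)
  have step: "V (Suc n) + ennreal \<delta> * M n \<le> V n" if n: "n \<noteq> 0" for n
  proof -
    have "V (Suc n) + ennreal \<delta> * M n
        \<le> (\<integral>\<^sup>+z. taboo a n z * (\<integral>\<^sup>+y. ennreal (v y) \<partial>Q z) + ennreal \<delta> * taboo a n z \<partial>?c)"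
      unfolding M_def by (subst nn_integral_add) (auto simp: nn_integral_cmult intro!: add_right_mono V_Suc)
    also have "\<dots> \<le> V n"
      unfolding V_def
    proof (intro nn_integral_mono)
      fix z
      show "taboo a n z * (\<integral>\<^sup>+y. ennreal (v y) \<partial>Q z) + ennreal \<delta> * taboo a n z \<le> taboo a n z * ennreal (v z)"
      proof (cases "z \<in> S \<and> z \<noteq> a")
        case True
        then have "ennreal (measure_pmf.expectation (Q z) v) + ennreal \<delta> \<le> ennreal (v z)"
          using drift[of z] Qv_nonneg[of z] \<delta> by (simp add: ennreal_plus[symmetric] ennreal_leI del: ennreal_plus)
        then have "taboo a n z * (ennreal (measure_pmf.expectation (Q z) v) + ennreal \<delta>) \<le> taboo a n z * ennreal (v z)"
          by (intro mult_left_mono) auto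
        then show ?thesis using True by (simp add: Qv distrib_left mult.commute)
      next
        case False
        then have "taboo a n z = 0" using n taboo_outside[OF a, of z n] by (cases n) auto
        then show ?thesis by simp
      qed
    qed
    finally show ?thesis .
  qed
  have partial: "V (Suc n) + ennreal \<delta> * (\<Sum>k<n. M (Suc k)) \<le> V 1" for n
  proof (induction n)
    case (Suc n)
    have "V (Suc (Suc n)) + ennreal \<delta> * (\<Sum>k<Suc n. M (Suc k))
       = (V (Suc (Suc n)) + ennreal \<delta> * M (Suc n)) + ennreal \<delta> * (\<Sum>k<n. M (Suc k))"
      by (simp add: algebra_simps)
    also have "\<dots> \<le> V (Suc n) + ennreal \<delta> * (\<Sum>k<n. M (Suc k))"
      by (intro add_right_mono step) simp
    also have "\<dots> \<le> V 1" by (rule Suc)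
    finally show ?case .
  qed simp
  have "V 1 \<le> (\<integral>\<^sup>+z. indicator {a} z * (\<integral>\<^sup>+y. ennreal (v y) \<partial>Q z) \<partial>?c)"
    using V_Suc[of 0] by simp
  also have "\<dots> = (\<integral>\<^sup>+z. (\<integral>\<^sup>+y. ennreal (v y) \<partial>Q a) * indicator {a} z \<partial>?c)"
    by (intro nn_integral_cong) (auto split: split_indicator)
  also have "\<dots> = (\<integral>\<^sup>+y. ennreal (v y) \<partial>Q a)"
    by (subst nn_integral_cmult_indicator) auto
  finally have V1: "V 1 < \<infinity>" unfolding Qv[OF a] by (rule le_less_trans) simp
  define Z where "Z = (\<Sum>n. M n)"
  have \<delta>': "ennreal \<delta> \<noteq> 0" "ennreal \<delta> < \<infinity>" using \<delta> by auto
  have Z_fin: "Z < \<infinity>"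
  proof -
    have "(\<Sum>k<n. M (Suc k)) \<le> V 1 / ennreal \<delta>" for n
    proof -
      have "ennreal \<delta> * (\<Sum>k<n. M (Suc k)) \<le> V 1"
        using partial[of n] by (rule order_trans[rotated]) simp
      then show ?thesis using \<delta>' by (intro ennreal_le_divideI)
    qed
    then have "(\<Sum>n. M (Suc n)) \<le> V 1 / ennreal \<delta>"
      by (intro suminf_le_const summableI)
    also have "\<dots> < \<infinity>"
      using V1 \<delta> by (rule ennreal_divide_finite)
    finally have "(\<Sum>n. M (Suc n)) < \<infinity>" .
    then show ?thesis
      unfolding Z_def using suminf_offset[of M 1] M0 by (simp add: less_top)
  qed
  define G where "G = (\<lambda>y. \<Sum>n. taboo a n y)"
  have G_mass: "(\<integral>\<^sup>+y. G y \<partial>?c) = Z"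
    unfolding G_def Z_def M_def by (rule nn_integral_suminf) simp
  have GQ: "(\<integral>\<^sup>+z. G z * ennreal (pmf (Q z) y) \<partial>?c) = G y" for y
  proof -
    have "(\<integral>\<^sup>+z. G z * ennreal (pmf (Q z) y) \<partial>?c) = (\<Sum>n. R n y)"
      unfolding G_def R_def by (subst nn_integral_suminf[symmetric]) auto
    also have "\<dots> = G y"
    proof (cases "y = a")
      case False
      have "G y = (\<Sum>n. taboo a (Suc n) y) + (\<Sum>n<1. taboo a n y)"
        unfolding G_def using suminf_offset[of "\<lambda>n. taboo a n y" 1] by simp
      then show ?thesis using False by (simp add: R_def)
    next
      case True
      \<comment> \<open>Mass returned to \<open>a\<close> before step \<open>n + 1\<close> plus mass
        still away is one. The masses \<open>M n\<close> are summable and so vanish; hence a return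
        is certain, and \<open>a\<close> recovers its initial mass \<open>G a = 1\<close>.\<close>
      have tele: "(\<Sum>k<n. R k a) + M n = 1" for n
      proof (induction n)
        case (Suc n)
        have "(\<Sum>k<Suc n. R k a) + M (Suc n) = (\<Sum>k<n. R k a) + (M (Suc n) + R n a)"
          by (simp only: sum.lessThan_Suc add_ac)
        then show ?case using Suc by (simp only: M_Suc)
      qed (simp add: M0)
      have "M \<longlonglongrightarrow> 0"
      proof -
        have M_le: "M n \<le> Z" for n
          unfolding Z_def using sum_le_suminf[of M "{n}"] by simp
        have M_real: "M n = ennreal (enn2real (M n))" for n
          using M_le[of n] Z_fin by (simp add: less_top top_unique)
        have "(\<Sum>n. ennreal (enn2real (M n))) \<noteq> top"
          using Z_fin M_real unfolding Z_def by simp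
        then have "summable (\<lambda>n. enn2real (M n))"
          by (intro summable_suminf_not_top) auto
        then have "(\<lambda>n. ennreal (enn2real (M n))) \<longlonglongrightarrow> ennreal 0"
          by (intro tendsto_ennrealI summable_LIMSEQ_zero)
        then show ?thesis using M_real by simp
      qed
      moreover have "(\<lambda>n. \<Sum>k<n. R k a) \<longlonglongrightarrow> (\<Sum>k. R k a)"
        by (rule summable_LIMSEQ) simp
      ultimately have "(\<lambda>n. (\<Sum>k<n. R k a) + M n) \<longlonglongrightarrow> (\<Sum>k. R k a) + 0"
        by (intro tendsto_add)
      then have "(\<Sum>k. R k a) = 1"
        unfolding tele by (simp add: LIMSEQ_const_iff)
      moreover have "G a = 1"
      proof -
        have "G a = (\<Sum>n. taboo a (n + 1) a) + (\<Sum>n<1. taboo a n a)"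
          unfolding G_def using suminf_offset[of "\<lambda>n. taboo a n a" 1] by simp
        then show ?thesis by simp
      qed
      ultimately show ?thesis using True by simp
    qed
    finally show ?thesis .
  qed
  have Z1: "1 \<le> Z"
    unfolding Z_def using sum_le_suminf[of M "{..<1}"] M0 by simp
  obtain r where r: "Z = ennreal r" "0 < r"
    using Z_fin Z1 by (cases Z) (auto simp: ennreal_1[symmetric] simp del: ennreal_1)
  have G_le: "G y \<le> Z" for y
  proof -
    have "G y = (\<integral>\<^sup>+z. G y * indicator {y} z \<partial>?c)" by (subst nn_integral_cmult_indicator) auto
    also have "\<dots> \<le> (\<integral>\<^sup>+z. G z \<partial>?c)" by (intro nn_integral_mono) (auto split: split_indicator)
    finally show ?thesis by (simp add: G_mass)
  qed
  define g where "g = (\<lambda>y. enn2real (G y) / r)"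
  have g: "ennreal (g y) = G y / ennreal r" for y
  proof -
    have "G y < \<top>" using le_less_trans[OF G_le[of y]] Z_fin by simp
    then show ?thesis using r(2) by (simp add: g_def divide_ennreal[symmetric])
  qed
  have g_nonneg: "0 \<le> g y" for y using r by (simp add: g_def)
  have g_mass: "(\<integral>\<^sup>+y. ennreal (g y) \<partial>?c) = 1"
    unfolding g using r by (simp add: nn_integral_divide G_mass ennreal_divide_self)
  define \<pi> where "\<pi> = embed_pmf g"
  have \<pi>: "pmf \<pi> y = g y" for y
    unfolding \<pi>_def by (rule pmf_embed_pmf[OF g_nonneg g_mass])
  have "bind_pmf \<pi> Q = \<pi>"
  proof (rule pmf_eqI)
    fix y
    have "ennreal (pmf (bind_pmf \<pi> Q) y) = (\<integral>\<^sup>+z. G z / ennreal r * ennreal (pmf (Q z) y) \<partial>?c)"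
      unfolding ennreal_pmf_bind_count_space \<pi> g ..
    also have "\<dots> = (\<integral>\<^sup>+z. G z * ennreal (pmf (Q z) y) / ennreal r \<partial>?c)"
      by (intro nn_integral_cong) (simp add: divide_ennreal_def mult_ac)
    also have "\<dots> = G y / ennreal r"
      by (subst nn_integral_divide) (auto simp: GQ)
    also have "\<dots> = ennreal (pmf \<pi> y)" by (simp add: \<pi> g)
    finally show "pmf (bind_pmf \<pi> Q) y = pmf \<pi> y" by simp
  qed
  moreover have "set_pmf \<pi> \<subseteq> S"
  proof
    fix y assume "y \<in> set_pmf \<pi>"
    then have "g y \<noteq> 0" by (simp add: set_pmf_iff \<pi>)
    then have "G y \<noteq> 0" by (auto simp: g_def)
    then show "y \<in> S" unfolding G_def using taboo_outside[OF a, of y] by (cases "y \<in> S") auto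
  qed
  ultimately show ?thesis by blast
qed

text \<open>Positive recurrence concerns each state separately, so a drift function is asked for
  every target \<open>x\<close>, failing at \<open>x\<close> only. The state \<open>y\<close> then
  gives existence and, being reachable from everywhere, uniqueness.\<close>

theorem ergodic_onI:
  assumes Lyapunov: "\<And>x. x \<in> S \<Longrightarrow> \<exists>v :: 's \<Rightarrow> real. \<exists>\<delta>>0. (\<forall>z\<in>S. 0 \<le> v z) \<and>
      (\<forall>z\<in>S. z \<noteq> x \<longrightarrow> measure_pmf.expectation (Q z) v \<le> v z - \<delta>)"
    and y: "y \<in> S" and reach: "\<And>x. x \<in> S \<Longrightarrow> \<exists>n. 0 < pmf (pmf_iterate Q n x) y"
  shows "ergodic_on S q"
  unfolding ergodic_on_def
proof (intro conjI ballI)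
  fix x assume "x \<in> S"
  moreover from Lyapunov[OF this] obtain v :: "'s \<Rightarrow> real" and \<delta> where "0 < \<delta>" "\<forall>z\<in>S. 0 \<le> v z"
    "\<forall>z\<in>S. z \<noteq> x \<longrightarrow> measure_pmf.expectation (Q z) v \<le> v z - \<delta>" by blast
  ultimately show "positive_recurrent q x"
    by (intro positive_recurrentI[of x v \<delta>]) auto
next
  from Lyapunov[OF y] obtain v :: "'s \<Rightarrow> real" and \<delta> where "0 < \<delta>" "\<forall>z\<in>S. 0 \<le> v z"
    "\<forall>z\<in>S. z \<noteq> y \<longrightarrow> measure_pmf.expectation (Q z) v \<le> v z - \<delta>" by blast
  then obtain \<pi> where \<pi>: "set_pmf \<pi> \<subseteq> S" "bind_pmf \<pi> Q = \<pi>"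
    using invariant_exists[OF y, of v \<delta>] by auto
  show "\<exists>!\<pi>. stationary_on S q \<pi>"
  proof (rule ex1I[of _ \<pi>])
    show "stationary_on S q \<pi>" using \<pi> by (rule stationary_onI)
    fix \<pi>' assume "stationary_on S q \<pi>'"
    then have "set_pmf \<pi>' \<subseteq> S" "bind_pmf \<pi>' Q = \<pi>'"
      by (simp add: stationary_on_def, rule stationary_onD)
    then show "\<pi>' = \<pi>" using \<pi> reach by (rule invariant_unique)
  qed
qed

end

section \<open>Couplings of discrete laws\<close>

lemma expectation_bind_finite:
  fixes h :: "'b \<Rightarrow> real"
  assumes "finite (set_pmf p)" "\<And>x. x \<in> set_pmf p \<Longrightarrow> finite (set_pmf (f x))"
  shows "measure_pmf.expectation (bind_pmf p f) h
     = measure_pmf.expectation p (\<lambda>x. measure_pmf.expectation (f x) h)"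
  using assms
  by (subst pmf_expectation_bind[OF assms(1,2) order_refl])
     (auto simp: integral_measure_pmf_real[of "set_pmf p"] mult.commute)

lemma expectation_bind_bounded:
  fixes h :: "'b \<Rightarrow> real"
  assumes h: "\<And>x. \<bar>h x\<bar> \<le> B"
  shows "measure_pmf.expectation (bind_pmf p f) h
     = measure_pmf.expectation p (\<lambda>x. measure_pmf.expectation (f x) h)"
proof -
  \<comment> \<open>The shift by the bound makes the function nonnegative, where integrals over
    \<open>bind_pmf\<close> can be iterated without integrability conditions.\<close>
  define h' where "h' = (\<lambda>x. h x + B)"
  have h': "0 \<le> h' x" "h' x \<le> 2 * B" for x
    using h[of x] by (auto simp: h'_def)
  have int: "integrable (measure_pmf q) h" for q
    by (rule measure_pmf.integrable_const_bound[where B=B]) (auto simp: h)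
  have int': "integrable (measure_pmf q) h'" for q
    using int by (simp add: h'_def)
  have E: "measure_pmf.expectation q h' = measure_pmf.expectation q h + B" for q
    using int by (simp add: h'_def)
  have bounds: "0 \<le> measure_pmf.expectation q h'" "measure_pmf.expectation q h' \<le> 2 * B" for q
    using h' int' by (auto intro!: integral_nonneg measure_pmf.integral_le_const)
  have int2: "integrable (measure_pmf p) (\<lambda>x. measure_pmf.expectation (f x) h')"
    by (rule measure_pmf.integrable_const_bound[where B="2 * B"]) (use bounds in auto)
  have "ennreal (measure_pmf.expectation (bind_pmf p f) h') = (\<integral>\<^sup>+x. \<integral>\<^sup>+y. ennreal (h' y) \<partial>f x \<partial>p)"
    using h' int' by (subst nn_integral_eq_integral[symmetric]) auto
  also have "\<dots> = (\<integral>\<^sup>+x. ennreal (measure_pmf.expectation (f x) h') \<partial>p)"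
    using h' int' by (subst nn_integral_eq_integral) auto
  also have "\<dots> = ennreal (measure_pmf.expectation p (\<lambda>x. measure_pmf.expectation (f x) h'))"
    using bounds int2 by (intro nn_integral_eq_integral) auto
  finally have "measure_pmf.expectation (bind_pmf p f) h'
     = measure_pmf.expectation p (\<lambda>x. measure_pmf.expectation (f x) h')"
    using bounds int2 by (subst (asm) ennreal_inj) (auto intro!: integral_nonneg)
  moreover have "integrable (measure_pmf p) (\<lambda>x. measure_pmf.expectation (f x) h)"
  proof (rule measure_pmf.integrable_const_bound[where B=B])
    have "\<bar>measure_pmf.expectation (f x) h\<bar> \<le> B" for x
      using bounds[of "f x"] E[of "f x"] by auto
    then show "AE x in p. norm (measure_pmf.expectation (f x) h) \<le> B" by simp
  qed simp
  ultimately show ?thesis unfolding E by simp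
qed

lemma map_hd_replicate_pmf: "0 < n \<Longrightarrow> map_pmf hd (replicate_pmf n p) = p"
  by (cases n) (simp_all add: map_bind_pmf bind_return_pmf')

lemma map_replicate_pmf: "map_pmf (map f) (replicate_pmf n p) = replicate_pmf n (map_pmf f p)"
proof (induction n)
  case (Suc n)
  have "map_pmf (map f) (replicate_pmf (Suc n) p)
     = bind_pmf p (\<lambda>x. bind_pmf (map_pmf (map f) (replicate_pmf n p)) (\<lambda>xs. return_pmf (f x # xs)))"
    by (simp add: map_bind_pmf bind_map_pmf)
  then show ?case by (simp add: Suc bind_map_pmf)
qed simp

lemma finite_set_replicate_pmf: "finite (set_pmf p) \<Longrightarrow> finite (set_pmf (replicate_pmf n p))"
  unfolding set_replicate_pmf using finite_lists_length_eq[of "set_pmf p" n]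
  by (simp add: lists_eq_set)

lemma nn_integral_replicate_pmf_Suc:
  "(\<integral>\<^sup>+xs. f xs \<partial>replicate_pmf (Suc n) p) = (\<integral>\<^sup>+x. \<integral>\<^sup>+xs. f (x # xs) \<partial>replicate_pmf n p \<partial>p)"
  by simp

lemma emeasure_replicate_pmf_subset:
  "emeasure (measure_pmf (replicate_pmf n p)) {xs. set xs \<subseteq> B} = emeasure (measure_pmf p) B ^ n"
proof (induction n)
  case (Suc n)
  have "emeasure (measure_pmf (replicate_pmf (Suc n) p)) {xs. set xs \<subseteq> B}
     = (\<integral>\<^sup>+xs. indicator {xs. set xs \<subseteq> B} xs \<partial>replicate_pmf (Suc n) p)"
    by (rule nn_integral_indicator[symmetric]) simp
  also have "\<dots> = (\<integral>\<^sup>+x. \<integral>\<^sup>+xs. indicator B x * indicator {xs. set xs \<subseteq> B} xs \<partial>replicate_pmf n p \<partial>p)"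
    unfolding nn_integral_replicate_pmf_Suc
    by (intro nn_integral_cong) (auto split: split_indicator)
  also have "\<dots> = (\<integral>\<^sup>+x. indicator B x * emeasure (measure_pmf p) B ^ n \<partial>p)"
    using Suc by (simp add: nn_integral_cmult)
  also have "\<dots> = emeasure (measure_pmf p) B ^ Suc n"
    by (simp add: nn_integral_multc)
  finally show ?case .
qed simp

lemma prob_replicate_pmf_subset:
  "measure_pmf.prob (replicate_pmf n p) {xs. set xs \<subseteq> B} = measure_pmf.prob p B ^ n"
  using emeasure_replicate_pmf_subset[of n p B]
  by (simp add: measure_pmf.emeasure_eq_measure ennreal_power)

lemma emeasure_replicate_pmf_meets:
  "emeasure (measure_pmf (replicate_pmf n p)) {xs. set xs \<inter> B \<noteq> {}} \<le> of_nat n * emeasure (measure_pmf p) B"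
proof (induction n)
  case (Suc n)
  have "emeasure (measure_pmf (replicate_pmf (Suc n) p)) {xs. set xs \<inter> B \<noteq> {}}
     = (\<integral>\<^sup>+xs. indicator {xs. set xs \<inter> B \<noteq> {}} xs \<partial>replicate_pmf (Suc n) p)"
    by (rule nn_integral_indicator[symmetric]) simp
  also have "\<dots> \<le> (\<integral>\<^sup>+x. \<integral>\<^sup>+xs. indicator B x + indicator {xs. set xs \<inter> B \<noteq> {}} xs \<partial>replicate_pmf n p \<partial>p)"
    unfolding nn_integral_replicate_pmf_Suc
    by (intro nn_integral_mono) (auto split: split_indicator)
  also have "\<dots> = emeasure (measure_pmf p) B + emeasure (measure_pmf (replicate_pmf n p)) {xs. set xs \<inter> B \<noteq> {}}"
    by (simp add: nn_integral_add)
  also have "\<dots> \<le> emeasure (measure_pmf p) B + of_nat n * emeasure (measure_pmf p) B"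
    by (intro add_left_mono Suc)
  finally show ?case by (simp add: algebra_simps)
qed simp

text \<open>Keep the common mass on the diagonal and couple the two excesses independently. Off the
  diagonal, \<open>u\<close> then carries a surplus of \<open>p\<close> and \<open>v\<close> a
  surplus of \<open>q\<close>; this description of the support matters later as much as the
  marginals.\<close>

lemma maximal_coupling_exists:
  fixes p q :: "'a pmf"
  assumes A: "finite A" "set_pmf p \<subseteq> A" "set_pmf q \<subseteq> A"
  shows "\<exists>J. map_pmf fst J = p \<and> map_pmf snd J = q \<and>
    (\<forall>(u, v)\<in>set_pmf J. u = v \<or> pmf q u < pmf p u \<and> pmf p v < pmf q v)"
proof (cases "p = q")
  case True
  then show ?thesis
    by (intro exI[of _ "map_pmf (\<lambda>u. (u, u)) p"]) (auto simp: map_pmf_comp)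
next
  case False
  define a where "a = (\<lambda>u. max 0 (pmf p u - pmf q u))"
  define b where "b = (\<lambda>u. max 0 (pmf q u - pmf p u))"
  define m where "m = (\<lambda>u. min (pmf p u) (pmf q u))"
  define t where "t = sum a A"
  have pa: "pmf p u = m u + a u" and qb: "pmf q u = m u + b u" for u
    by (auto simp: a_def b_def m_def)
  have sum1: "sum (pmf p) A = 1" "sum (pmf q) A = 1"
    using A by (auto intro!: sum_pmf_eq_1)
  then have tb: "sum b A = t" and mt: "sum m A + t = 1"
    unfolding t_def pa qb sum.distrib by auto
  have nn: "0 \<le> a u" "0 \<le> b u" "0 \<le> m u" for u by (auto simp: a_def b_def m_def)
  have t: "0 < t"
  proof (rule ccontr)
    assume "\<not> 0 < t"
    then have "t = 0" using nn sum_nonneg[of A a] by (simp add: t_def)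
    then have "\<forall>u\<in>A. a u = 0" "\<forall>u\<in>A. b u = 0"
      using nn A(1) tb by (auto simp: t_def sum_nonneg_eq_0_iff)
    then have "pmf p u = pmf q u" for u
    proof (cases "u \<in> A")
      case False
      then have "u \<notin> set_pmf p" "u \<notin> set_pmf q" using A by auto
      then show ?thesis by (simp add: set_pmf_iff)
    qed (use pa[of u] qb[of u] \<open>\<forall>u\<in>A. a u = 0\<close> \<open>\<forall>u\<in>A. b u = 0\<close> in simp)
    then show False using False by (auto intro: pmf_eqI)
  qed
  \<comment> \<open>\<open>t\<close> is the total mass of each of the two excesses, so their product
    divided by \<open>t\<close> has the excesses as marginals.\<close>
  define c where "c = (\<lambda>(u, v). (if u = v then m u else 0) + a u * b v / t)"
  have c_nn: "0 \<le> c r" for r using nn t by (auto simp: c_def split: prod.split)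
  have out: "a u = 0" "b u = 0" "m u = 0" if "u \<notin> A" for u
  proof -
    have "pmf p u = 0" "pmf q u = 0" using that A by (meson pmf_eq_0_set_pmf subsetD)+
    then show "a u = 0" "b u = 0" "m u = 0" by (auto simp: a_def b_def m_def)
  qed
  have row: "(\<Sum>v\<in>A. c (u, v)) = pmf p u" for u
  proof -
    have "(\<Sum>v\<in>A. c (u, v)) = (\<Sum>v\<in>A. if u = v then m u else 0) + a u / t * sum b A"
      by (simp add: c_def sum.distrib sum_distrib_left)
    also have "\<dots> = m u + a u"
      using t A(1) out by (cases "u \<in> A") (auto simp: tb)
    finally show ?thesis by (simp add: pa)
  qed
  have col: "(\<Sum>u\<in>A. c (u, v)) = pmf q v" for v
  proof -
    have "(\<Sum>u\<in>A. c (u, v)) = (\<Sum>u\<in>A. if u = v then m u else 0) + b v / t * sum a A"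
      by (simp add: c_def sum.distrib sum_distrib_left sum_divide_distrib mult.commute)
    also have "\<dots> = m v + b v"
      using t A(1) out by (cases "v \<in> A") (auto simp: t_def[symmetric])
    finally show ?thesis by (simp add: qb)
  qed
  have J_out: "c (u, v) = 0" if "u \<notin> A \<or> v \<notin> A" for u v
    using that out by (auto simp: c_def)
  have supp: "r \<in> A \<times> A" if "c r \<noteq> 0" for r
    using that J_out[of "fst r" "snd r"] by (cases "fst r \<in> A \<and> snd r \<in> A") (auto simp: mem_Times_iff)
  have "(\<integral>\<^sup>+r. ennreal (c r) \<partial>count_space UNIV) = (\<Sum>r\<in>A \<times> A. ennreal (c r))"
  proof (rule nn_integral_count_space')
    fix r assume "r \<notin> A \<times> A"
    then show "ennreal (c r) = 0" using supp[of r] by (cases "c r = 0") auto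
  qed (use A(1) in simp_all)
  also have "\<dots> = ennreal (\<Sum>r\<in>A \<times> A. c r)"
    using c_nn by simp
  also have "(\<Sum>r\<in>A \<times> A. c r) = (\<Sum>u\<in>A. \<Sum>v\<in>A. c (u, v))"
    by (simp add: sum.cartesian_product)
  also have "\<dots> = 1" by (simp add: row sum1)
  finally have c1: "(\<integral>\<^sup>+r. ennreal (c r) \<partial>count_space UNIV) = 1" by simp
  define J where "J = embed_pmf c"
  have J: "pmf J r = c r" for r
    unfolding J_def by (rule pmf_embed_pmf[OF c_nn c1])
  have J_set: "set_pmf J \<subseteq> A \<times> A"
    using supp by (force simp: set_pmf_iff J)
  have "map_pmf fst J = p"
  proof (rule pmf_eqI)
    fix u
    have "pmf (map_pmf fst J) u = measure J ({u} \<times> A)"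
      unfolding pmf_map using J_set by (intro measure_prob_cong_0) (auto simp: J dest!: supp)
    also have "\<dots> = (\<Sum>r\<in>{u} \<times> A. c r)"
      using A(1) by (simp add: measure_measure_pmf_finite J)
    also have "\<dots> = pmf p u"
    proof -
      have "{u} \<times> A = (\<lambda>v. (u, v)) ` A" by auto
      then show ?thesis using row[of u] by (simp add: sum.reindex inj_on_def)
    qed
    finally show "pmf (map_pmf fst J) u = pmf p u" .
  qed
  moreover have "map_pmf snd J = q"
  proof (rule pmf_eqI)
    fix v
    have "pmf (map_pmf snd J) v = measure J (A \<times> {v})"
      unfolding pmf_map using J_set by (intro measure_prob_cong_0) (auto simp: J dest!: supp)
    also have "\<dots> = (\<Sum>r\<in>A \<times> {v}. c r)"
      using A(1) by (simp add: measure_measure_pmf_finite J)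
    also have "\<dots> = pmf q v"
    proof -
      have "A \<times> {v} = (\<lambda>u. (u, v)) ` A" by auto
      then show ?thesis using col[of v] by (simp add: sum.reindex inj_on_def)
    qed
    finally show "pmf (map_pmf snd J) v = pmf q v" .
  qed
  moreover have "u = v \<or> pmf q u < pmf p u \<and> pmf p v < pmf q v" if "(u, v) \<in> set_pmf J" for u v
  proof (rule ccontr)
    assume neg: "\<not> (u = v \<or> pmf q u < pmf p u \<and> pmf p v < pmf q v)"
    then have "a u = 0 \<or> b v = 0" by (auto simp: a_def b_def)
    then have "c (u, v) = 0" using neg by (auto simp: c_def)
    then show False using that by (simp add: set_pmf_iff J)
  qed
  ultimately show ?thesis by blast
qed

definition maximal_coupling :: "'a pmf \<Rightarrow> 'a pmf \<Rightarrow> ('a \<times> 'a) pmf" where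
  "maximal_coupling p q = (SOME J. map_pmf fst J = p \<and> map_pmf snd J = q \<and>
    (\<forall>(u, v)\<in>set_pmf J. u = v \<or> pmf q u < pmf p u \<and> pmf p v < pmf q v))"

lemma maximal_coupling:
  assumes "finite (set_pmf p)" "finite (set_pmf q)"
  shows "map_pmf fst (maximal_coupling p q) = p" "map_pmf snd (maximal_coupling p q) = q"
    "(u, v) \<in> set_pmf (maximal_coupling p q) \<Longrightarrow> u = v \<or> pmf q u < pmf p u \<and> pmf p v < pmf q v"
  using someI_ex[OF maximal_coupling_exists[of "set_pmf p \<union> set_pmf q" p q]] assms
  unfolding maximal_coupling_def[symmetric] by auto

text \<open>With \<open>P\<close> the set where \<open>p\<close> exceeds \<open>q\<close>, the
  components differ with probability \<open>p P - q P\<close>. One point \<open>z\<close> may be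
  left out of the sum: if it lies in \<open>P\<close>, one passes to the complement, both laws
  having mass one. It will be the outcome \<open>None\<close>.\<close>

lemma prob_maximal_coupling_neq:
  assumes A: "finite A" "set_pmf p \<subseteq> A" "set_pmf q \<subseteq> A"
  shows "measure_pmf.prob (maximal_coupling p q) {r. fst r \<noteq> snd r} \<le> (\<Sum>u\<in>A - {z}. \<bar>pmf p u - pmf q u\<bar>)"
proof -
  have fin: "finite (set_pmf p)" "finite (set_pmf q)" using A finite_subset by auto
  define J where "J = maximal_coupling p q"
  define P where "P = {u. pmf q u < pmf p u}"
  have J: "u = v \<or> u \<in> P \<and> v \<notin> P" if "(u, v) \<in> set_pmf J" for u v
    using maximal_coupling(3)[OF fin, of u v] that by (auto simp: J_def P_def)
  have fstJ: "measure_pmf.prob J (fst -` B) = measure_pmf.prob p B" for B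
    using maximal_coupling(1)[OF fin] by (metis J_def measure_map_pmf)
  have sndJ: "measure_pmf.prob J (snd -` B) = measure_pmf.prob q B" for B
    using maximal_coupling(2)[OF fin] by (metis J_def measure_map_pmf)
  have sum_P: "measure_pmf.prob r B = (\<Sum>u\<in>A \<inter> B. pmf r u)" if "set_pmf r \<subseteq> A" for r B
  proof -
    have "measure_pmf.prob r B = measure_pmf.prob r (A \<inter> B)"
      using that by (intro measure_prob_cong_0) (auto simp: set_pmf_eq)
    then show ?thesis using A(1) by (simp add: measure_measure_pmf_finite)
  qed
  have "measure_pmf.prob J {r. fst r \<noteq> snd r} = measure_pmf.prob J (fst -` P - snd -` P)"
    by (intro measure_prob_cong_0) (auto simp: pmf_eq_0_set_pmf dest: J)
  also have "measure_pmf.prob J (snd -` P - fst -` P) = 0"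
    by (auto simp: measure_pmf_zero_iff dest: J)
  then have "measure_pmf.prob J (fst -` P - snd -` P)
     = measure_pmf.prob J (fst -` P) - measure_pmf.prob J (snd -` P)"
  proof -
    have D: "measure_pmf.prob J (B - C) = measure_pmf.prob J B - measure_pmf.prob J (B \<inter> C)" for B C
      by (rule measure_pmf.finite_measure_Diff') auto
    show ?thesis
      using D[of "fst -` P" "snd -` P"] D[of "snd -` P" "fst -` P"] \<open>measure_pmf.prob J (snd -` P - fst -` P) = 0\<close>
      by (simp add: Int_commute)
  qed
  finally have eq: "measure_pmf.prob J {r. fst r \<noteq> snd r} = measure_pmf.prob p P - measure_pmf.prob q P"
    by (simp add: fstJ sndJ)
  show ?thesis
  proof (cases "z \<in> P")
    case False
    have "measure_pmf.prob p P - measure_pmf.prob q P = (\<Sum>u\<in>A \<inter> P. pmf p u - pmf q u)"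
      using A by (simp add: sum_P sum_subtractf)
    also have "\<dots> \<le> (\<Sum>u\<in>A \<inter> P. \<bar>pmf p u - pmf q u\<bar>)" by (intro sum_mono) auto
    also have "\<dots> \<le> (\<Sum>u\<in>A - {z}. \<bar>pmf p u - pmf q u\<bar>)"
      using A(1) False by (intro sum_mono2) auto
    finally show ?thesis using eq by (simp add: J_def)
  next
    case True
    have "measure_pmf.prob p P = 1 - measure_pmf.prob p (- P)" "measure_pmf.prob q P = 1 - measure_pmf.prob q (- P)"
      using measure_pmf.prob_compl[of P p] measure_pmf.prob_compl[of P q] by (auto simp: Compl_eq_Diff_UNIV)
    then have "measure_pmf.prob p P - measure_pmf.prob q P = (\<Sum>u\<in>A \<inter> (- P). pmf q u - pmf p u)"
      using A by (simp add: sum_P sum_subtractf)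
    also have "\<dots> \<le> (\<Sum>u\<in>A \<inter> (- P). \<bar>pmf p u - pmf q u\<bar>)" by (intro sum_mono) auto
    also have "\<dots> \<le> (\<Sum>u\<in>A - {z}. \<bar>pmf p u - pmf q u\<bar>)"
      using A(1) True by (intro sum_mono2) auto
    finally show ?thesis using eq by (simp add: J_def)
  qed
qed

text \<open>Given the middle coordinate \<open>b\<close>, draw the third one from \<open>J2\<close>
  conditioned on \<open>b\<close>, independently of the first.\<close>

lemma glue_pmf:
  fixes J1 :: "('a \<times> 'b) pmf" and J2 :: "('b \<times> 'c) pmf"
  assumes eq: "map_pmf snd J1 = map_pmf fst J2"
  shows "\<exists>J. map_pmf (\<lambda>(a, b, c). (a, b)) J = J1 \<and> map_pmf (\<lambda>(a, b, c). (b, c)) J = J2"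
proof -
  define J where "J = bind_pmf J1 (\<lambda>(a, b). map_pmf (\<lambda>r. (a, b, snd r)) (cond_pmf J2 {r. b = fst r}))"
  have "map_pmf (\<lambda>(a, b, c). (a, b)) J = J1"
    unfolding J_def map_bind_pmf by (simp add: split_beta' map_pmf_comp bind_return_pmf')
  moreover have "map_pmf (\<lambda>(a, b, c). (b, c)) J = J2"
  proof -
    have ne: "set_pmf J2 \<inter> {r. b = fst r} \<noteq> {}" if "b \<in> set_pmf (map_pmf fst J2)" for b
      using that by auto
    have "map_pmf (\<lambda>(a, b, c). (b, c)) J = bind_pmf J1 (\<lambda>(a, b). map_pmf (\<lambda>r. (b, snd r)) (cond_pmf J2 {r. b = fst r}))"
      unfolding J_def map_bind_pmf by (simp add: split_beta' map_pmf_comp)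
    also have "\<dots> = bind_pmf (map_pmf snd J1) (\<lambda>b. map_pmf (\<lambda>r. (b, snd r)) (cond_pmf J2 {r. b = fst r}))"
      by (simp add: bind_map_pmf split_beta')
    also have "\<dots> = bind_pmf (map_pmf fst J2) (\<lambda>b. cond_pmf J2 {r. b = fst r})"
      unfolding eq
    proof (rule bind_pmf_cong[OF refl])
      fix b assume b: "b \<in> set_pmf (map_pmf fst J2)"
      show "map_pmf (\<lambda>r. (b, snd r)) (cond_pmf J2 {r. b = fst r}) = cond_pmf J2 {r. b = fst r}"
        by (rule map_pmf_idI) (use set_cond_pmf[OF ne[OF b]] in auto)
    qed
    also have "\<dots> = J2"
    proof (rule bind_cond_pmf_cancel)
      fix b and r :: "'b \<times> 'c" assume "b = fst r"
      then show "measure (measure_pmf J2) {r. b = fst r} = measure (measure_pmf (map_pmf fst J2)) {b. b = fst r}"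
        by (simp add: vimage_def eq_commute)
    qed (use ne in auto)
    finally show ?thesis .
  qed
  ultimately show ?thesis by blast
qed

section \<open>Regular networks\<close>

definition shortest :: "('v \<Rightarrow> nat) \<Rightarrow> 'v set \<Rightarrow> 'v set" where
  "shortest x A = {v \<in> A. \<forall>u\<in>A. x v \<le> x u}"

lemma shortest_subset: "shortest x A \<subseteq> A"
  by (auto simp: shortest_def)

lemma shortest_nonempty: "finite A \<Longrightarrow> A \<noteq> {} \<Longrightarrow> shortest x A \<noteq> {}"
  using ex_min_if_finite[of "x ` A"] by (auto simp: shortest_def not_less)

lemma finite_shortest: "finite A \<Longrightarrow> finite (shortest x A)"
  by (rule finite_subset[OF shortest_subset])

lemma shortest_ge_iff:
  assumes "v \<in> shortest x A"
  shows "k \<le> x v \<longleftrightarrow> (\<forall>u\<in>A. k \<le> x u)"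
  using assms by (auto simp: shortest_def intro: order_trans)

lemma shortest_image:
  assumes "\<And>v. x (f v) = x v"
  shows "shortest x (f ` A) = f ` shortest x A"
  using assms by (auto simp: shortest_def)

lemma dispatch_pmf_shortest:
  "dispatch_pmf d G x w = bind_pmf (replicate_pmf d (pmf_of_set (compatible_servers G w)))
     (\<lambda>s. pmf_of_set (shortest x (set s)))"
  by (simp add: dispatch_pmf_def shortest_def)

fun depart :: "('v \<Rightarrow> nat) \<Rightarrow> 'v \<Rightarrow> ('v \<Rightarrow> nat)" where
  "depart x v = x(v := x v - 1)"

fun arrive :: "('v \<Rightarrow> nat) \<Rightarrow> 'v option \<Rightarrow> ('v \<Rightarrow> nat)" where
  "arrive x None = x"
| "arrive x (Some u) = x(u := x u + 1)"

locale queue_network =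
  fixes lam :: real and d :: nat and G :: "('v, 'w) bigraph"
  assumes lam: "0 < lam" "lam < 1" and d: "2 \<le> d" and regular: "regular_bipartite_graph G"
begin

abbreviation "V \<equiv> servers G"
abbreviation "W \<equiv> task_types G"
abbreviation "nbh \<equiv> compatible_servers G"
abbreviation "N \<equiv> real (card V)"
abbreviation "M \<equiv> real (card W)"
abbreviation "deg w \<equiv> real (task_degree G w)"

lemma V: "finite V" "V \<noteq> {}" and W: "finite W" "W \<noteq> {}"
  using regular by (auto simp: regular_bipartite_graph_def bipartite_graph_def)

lemma N_pos: "0 < N" and M_pos: "0 < M"
  using V W by (auto simp: card_gt_0_iff)

lemma nbh_subset: "nbh w \<subseteq> V"
  by (auto simp: compatible_servers_def)

lemma finite_nbh: "finite (nbh w)"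
  using V(1) nbh_subset finite_subset by blast

lemma card_nbh: "real (card (nbh w)) = deg w"
  by (simp add: task_degree_def)

lemma deg_pos: "w \<in> W \<Longrightarrow> 1 \<le> deg w"
  using regular by (auto simp: regular_bipartite_graph_def bipartite_graph_def)

lemma nbh_nonempty: "w \<in> W \<Longrightarrow> nbh w \<noteq> {}"
  using deg_pos[of w] card_nbh[of w] by auto

definition types_of :: "'v \<Rightarrow> 'w set" where
  "types_of v = {w \<in> W. (v, w) \<in> edges G}"

lemma finite_types_of: "finite (types_of v)"
  using W by (simp add: types_of_def)

lemma types_of_iff: "w \<in> W \<Longrightarrow> v \<in> V \<Longrightarrow> w \<in> types_of v \<longleftrightarrow> v \<in> nbh w"
  by (auto simp: types_of_def compatible_servers_def)

lemma sum_types_of: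
  "(\<Sum>w\<in>W. \<Sum>v\<in>nbh w. f v w) = (\<Sum>v\<in>V. \<Sum>w\<in>types_of v. f v w)"
proof -
  have "(\<Sum>w\<in>W. \<Sum>v\<in>nbh w. f v w) = (\<Sum>w\<in>W. \<Sum>v\<in>V. if (v, w) \<in> edges G then f v w else 0)"
    using V(1) by (intro sum.cong[OF refl, where A=W]) (simp add: compatible_servers_def sum.inter_filter)
  also have "\<dots> = (\<Sum>v\<in>V. \<Sum>w\<in>W. if (v, w) \<in> edges G then f v w else 0)"
    by (rule sum.swap)
  also have "\<dots> = (\<Sum>v\<in>V. \<Sum>w\<in>types_of v. f v w)"
    using W(1) by (intro sum.cong[OF refl, where A=V]) (simp add: types_of_def sum.inter_filter)
  finally show ?thesis .
qed

text \<open>By regularity all types of \<open>v\<close> have the same degree, \<open>N / M\<close>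
  times the degree of \<open>v\<close>, so the degree of \<open>v\<close> cancels from the
  sum.\<close>

lemma sum_inverse_deg_cases:
  assumes "v \<in> V"
  shows "(\<Sum>w\<in>types_of v. 1 / deg w) = (if types_of v = {} then 0 else M / N)"
proof (cases "types_of v = {}")
  case False
  have "1 / deg w = M / (N * real (server_degree G v))" if "w \<in> types_of v" for w
  proof -
    have "card V * server_degree G v = card W * task_degree G w"
      using that regular by (auto simp: types_of_def regular_bipartite_graph_def)
    then have "N * real (server_degree G v) = M * deg w"
      by (metis of_nat_mult)
    moreover have "1 \<le> deg w" using that deg_pos by (auto simp: types_of_def)
    ultimately show ?thesis using M_pos by (simp add: field_simps)
  qed
  then have "(\<Sum>w\<in>types_of v. 1 / deg w) = real (server_degree G v) * (M / (N * real (server_degree G v)))"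
    by (simp add: server_degree_def types_of_def)
  moreover have "server_degree G v \<noteq> 0"
    using False finite_types_of[of v] by (simp add: server_degree_def types_of_def)
  ultimately show ?thesis using False by simp
qed simp

text \<open>
  A server without compatible types would get no arrivals, and by regularity the remaining
  servers could not absorb all of them.
\<close>

lemma types_of_nonempty:
  assumes "v \<in> V"
  shows "types_of v \<noteq> {}"
proof
  assume v: "types_of v = {}"
  have "M = (\<Sum>w\<in>W. 1)" by simp
  also have "\<dots> = (\<Sum>w\<in>W. \<Sum>v\<in>nbh w. 1 / deg w)"
  proof -
    have "(\<Sum>v\<in>nbh w. 1 / deg w) = 1" if "w \<in> W" for w
      using deg_pos[OF that] by (simp add: card_nbh)
    then show ?thesis by (intro sum.cong[OF refl]) (simp only:)
  qed
  also have "\<dots> = (\<Sum>v\<in>V. \<Sum>w\<in>types_of v. 1 / deg w)"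
    by (rule sum_types_of)
  also have "\<dots> = (\<Sum>v\<in>V. if types_of v = {} then 0 else M / N)"
    by (intro sum.cong refl sum_inverse_deg_cases)
  also have "\<dots> < (\<Sum>v\<in>V. M / N)"
    using assms v V N_pos M_pos by (intro sum_strict_mono_ex1) auto
  also have "\<dots> = M" using N_pos by simp
  finally show False by simp
qed

lemma sum_inverse_deg: "v \<in> V \<Longrightarrow> (\<Sum>w\<in>types_of v. 1 / deg w) = M / N"
  using sum_inverse_deg_cases types_of_nonempty by simp

text \<open>A uniform neighbour of a uniform type is a uniform server. This is how quantities local
  to neighbourhoods add up to global ones.\<close>

lemma average_over_types:
  "(\<Sum>w\<in>W. (\<Sum>v\<in>nbh w. f v) / deg w) / M = (\<Sum>v\<in>V. f v) / N"
proof -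
  have "(\<Sum>w\<in>W. (\<Sum>v\<in>nbh w. f v) / deg w) = (\<Sum>w\<in>W. \<Sum>v\<in>nbh w. f v * (1 / deg w))"
    by (simp add: sum_divide_distrib)
  also have "\<dots> = (\<Sum>v\<in>V. \<Sum>w\<in>types_of v. f v * (1 / deg w))"
    by (rule sum_types_of)
  also have "\<dots> = (\<Sum>v\<in>V. f v * (M / N))"
    by (intro sum.cong refl) (simp only: sum_distrib_left[symmetric] sum_inverse_deg)
  also have "\<dots> = (\<Sum>v\<in>V. f v) * (M / N)"
    by (rule sum_distrib_right[symmetric])
  finally show ?thesis using M_pos by simp
qed

section \<open>The dispatching rule\<close>

abbreviation "sample w \<equiv> replicate_pmf d (pmf_of_set (nbh w))"

lemma set_sample: "w \<in> W \<Longrightarrow> s \<in> set_pmf (sample w) \<Longrightarrow> set s \<subseteq> nbh w \<and> set s \<noteq> {} \<and> length s = d"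
  using nbh_nonempty[of w] finite_nbh[of w] d by (auto simp: set_replicate_pmf)

lemma finite_sample: "w \<in> W \<Longrightarrow> finite (set_pmf (sample w))"
  using nbh_nonempty[of w] finite_nbh[of w] by (intro finite_set_replicate_pmf) simp

lemma set_shortest_pmf: "w \<in> W \<Longrightarrow> s \<in> set_pmf (sample w) \<Longrightarrow> set_pmf (pmf_of_set (shortest x (set s))) = shortest x (set s)"
  using set_sample[of w s] by (intro set_pmf_of_set shortest_nonempty finite_shortest) auto

lemma set_dispatch: "w \<in> W \<Longrightarrow> set_pmf (dispatch_pmf d G x w) \<subseteq> nbh w"
  using set_sample[of w] set_shortest_pmf[of w] shortest_subset[of x]
  by (fastforce simp: dispatch_pmf_shortest)

lemma finite_dispatch: "w \<in> W \<Longrightarrow> finite (set_pmf (dispatch_pmf d G x w))"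
  using set_dispatch finite_nbh finite_subset by blast

lemma set_dispatch_eq: "w \<in> W \<Longrightarrow> set_pmf (dispatch_pmf d G x w) = nbh w"
proof
  assume w: "w \<in> W"
  show "set_pmf (dispatch_pmf d G x w) \<subseteq> nbh w" using w by (rule set_dispatch)
  show "nbh w \<subseteq> set_pmf (dispatch_pmf d G x w)"
  proof
    fix u assume u: "u \<in> nbh w"
    have s: "replicate d u \<in> set_pmf (sample w)"
      using u nbh_nonempty[OF w] finite_nbh[of w] by (auto simp: set_replicate_pmf)
    have "shortest x (set (replicate d u)) = {u}"
      using d by (auto simp: shortest_def)
    then have "u \<in> set_pmf (pmf_of_set (shortest x (set (replicate d u))))"
      by simp
    with s show "u \<in> set_pmf (dispatch_pmf d G x w)"
      unfolding dispatch_pmf_shortest by auto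
  qed
qed

definition local_occ :: "'w \<Rightarrow> nat \<Rightarrow> ('v \<Rightarrow> nat) \<Rightarrow> real" where
  "local_occ w k x = real (card {v \<in> nbh w. k \<le> x v}) / deg w"

lemma local_occ_sum: "local_occ w k x = (\<Sum>v\<in>nbh w. indicator {k..} (x v)) / deg w"
  using finite_nbh[of w] by (simp add: local_occ_def sum.inter_filter[symmetric] indicator_def Collect_conj_eq)

lemma local_occ_bounds: "0 \<le> local_occ w k x" "local_occ w k x \<le> 1"
  using card_mono[OF finite_nbh[of w], of "{v \<in> nbh w. k \<le> x v}"] card_nbh[of w]
  by (auto simp: local_occ_def divide_le_eq_1)

lemma average_local_occ: "(\<Sum>w\<in>W. local_occ w k x) / M = occupancy G k x"
  unfolding local_occ_sum average_over_types
  using V(1) by (simp add: occupancy_def sum.inter_filter[symmetric] indicator_def Collect_conj_eq)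

text \<open>The joined queue is a shortest one of the sample, hence has length at least
  \<open>k\<close> iff all \<open>d\<close> sampled queues have.\<close>

lemma prob_dispatch_ge:
  assumes w: "w \<in> W"
  shows "measure_pmf.prob (dispatch_pmf d G x w) {u. k \<le> x u} = local_occ w k x ^ d"
proof -
  have "ennreal (measure_pmf.prob (dispatch_pmf d G x w) {u. k \<le> x u})
     = (\<integral>\<^sup>+s. emeasure (measure_pmf (pmf_of_set (shortest x (set s)))) {u. k \<le> x u} \<partial>sample w)"
    unfolding dispatch_pmf_shortest measure_pmf.emeasure_eq_measure[symmetric] by simp
  also have "\<dots> = (\<integral>\<^sup>+s. indicator {s. set s \<subseteq> {u. k \<le> x u}} s \<partial>sample w)"
  proof (rule nn_integral_cong_AE, rule AE_pmfI)
    fix s assume s: "s \<in> set_pmf (sample w)"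
    let ?p = "pmf_of_set (shortest x (set s))"
    have "set_pmf ?p = shortest x (set s)" by (rule set_shortest_pmf[OF w s])
    then have all: "k \<le> x u \<longleftrightarrow> set s \<subseteq> {u. k \<le> x u}" if "u \<in> set_pmf ?p" for u
      using that shortest_ge_iff[of u x "set s" k] by auto
    have "emeasure (measure_pmf ?p) {u. k \<le> x u} = (\<integral>\<^sup>+u. indicator {u. k \<le> x u} u \<partial>?p)"
      by simp
    also have "\<dots> = (\<integral>\<^sup>+u. indicator {s. set s \<subseteq> {u. k \<le> x u}} s \<partial>?p)"
      by (rule nn_integral_cong_AE, rule AE_pmfI) (use all in \<open>auto split: split_indicator\<close>)
    finally show "emeasure (measure_pmf ?p) {u. k \<le> x u} = indicator {s. set s \<subseteq> {u. k \<le> x u}} s"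
      by simp
  qed
  also have "\<dots> = ennreal (measure_pmf.prob (pmf_of_set (nbh w)) {u. k \<le> x u} ^ d)"
    by (simp add: measure_pmf.emeasure_eq_measure prob_replicate_pmf_subset)
  also have "measure_pmf.prob (pmf_of_set (nbh w)) {u. k \<le> x u} = local_occ w k x"
    using nbh_nonempty[OF w] finite_nbh[of w]
    by (simp add: measure_pmf_of_set local_occ_def card_nbh Collect_conj_eq[symmetric] Int_def)
  finally show ?thesis by (simp add: local_occ_bounds)
qed

text \<open>Transposing two neighbours with equal queues preserves the law of the sample and
  commutes with selecting the shortest queues.\<close>

lemma pmf_dispatch_swap:
  assumes u: "u \<in> nbh w" "u' \<in> nbh w" and eq: "x u = x u'"
  shows "pmf (dispatch_pmf d G x w) u = pmf (dispatch_pmf d G x w) u'"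
proof -
  define \<sigma> where "\<sigma> = Fun.swap u u' id"
  have \<sigma>: "\<sigma> u = u'" "x (\<sigma> v) = x v" "inj \<sigma>" for v
    using eq by (auto simp: \<sigma>_def Fun.swap_def inj_def)
  have bij: "bij_betw \<sigma> (nbh w) (nbh w)"
    using u by (auto simp: \<sigma>_def Fun.swap_def bij_betw_def inj_on_def image_iff)
  have ne: "nbh w \<noteq> {}" using u by auto
  have "map_pmf \<sigma> (dispatch_pmf d G x w) = bind_pmf (sample w) (\<lambda>s. map_pmf \<sigma> (pmf_of_set (shortest x (set s))))"
    by (simp add: dispatch_pmf_shortest map_bind_pmf)
  also have "\<dots> = bind_pmf (sample w) (\<lambda>s. pmf_of_set (shortest x (set (map \<sigma> s))))"
  proof (rule bind_pmf_cong[OF refl])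
    fix s assume "s \<in> set_pmf (sample w)"
    then have "set s \<noteq> {}" using ne finite_nbh[of w] d by (auto simp: set_replicate_pmf)
    then show "map_pmf \<sigma> (pmf_of_set (shortest x (set s))) = pmf_of_set (shortest x (set (map \<sigma> s)))"
      using \<sigma> shortest_nonempty[of "set s" x] by (subst map_pmf_of_set_inj)
        (auto simp: shortest_image intro: inj_on_subset finite_shortest)
  qed
  also have "\<dots> = bind_pmf (map_pmf (map \<sigma>) (sample w)) (\<lambda>s. pmf_of_set (shortest x (set s)))"
    by (simp add: bind_map_pmf)
  also have "map_pmf (map \<sigma>) (sample w) = sample w"
    using bij ne finite_nbh[of w] by (simp add: map_replicate_pmf map_pmf_of_set_bij_betw)
  finally have "map_pmf \<sigma> (dispatch_pmf d G x w) = dispatch_pmf d G x w"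
    by (simp add: dispatch_pmf_shortest)
  then have "pmf (dispatch_pmf d G x w) (\<sigma> u) = pmf (dispatch_pmf d G x w) u"
    using pmf_map_inj'[OF \<sigma>(3), of "dispatch_pmf d G x w" u] by simp
  then show ?thesis by (simp add: \<sigma>)
qed

text \<open>The polynomial form of \<open>(a ^ d - b ^ d) / (a - b)\<close> also covers \<open>a = b\<close>.\<close>

definition power_quotient :: "real \<Rightarrow> real \<Rightarrow> real" where
  "power_quotient a b = (\<Sum>i<d. b ^ (d - Suc i) * a ^ i)"

lemma power_quotient: "a ^ d - b ^ d = (a - b) * power_quotient a b"
  unfolding power_quotient_def by (rule power_diff_sumr2)

text \<open>With \<open>a\<close> and \<open>b\<close> the two local occupancies, the neighbours of
  the same length as \<open>u\<close> receive \<open>a ^ d - b ^ d\<close> together. They are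
  \<open>(a - b) * deg w\<close> in number and share equally.\<close>

lemma pmf_dispatch:
  assumes w: "w \<in> W" and u: "u \<in> nbh w"
  shows "pmf (dispatch_pmf d G x w) u = power_quotient (local_occ w (x u) x) (local_occ w (Suc (x u)) x) / deg w"
proof -
  define k where "k = x u"
  define B where "B = {v \<in> nbh w. x v = k}"
  have B: "finite B" "u \<in> B" using u finite_nbh by (auto simp: B_def k_def)
  have split: "{v \<in> nbh w. k \<le> x v} = B \<union> {v \<in> nbh w. Suc k \<le> x v}" by (auto simp: B_def)
  have "card {v \<in> nbh w. k \<le> x v} = card B + card {v \<in> nbh w. Suc k \<le> x v}"
    unfolding split using finite_nbh[of w] by (intro card_Un_disjoint) (auto simp: B_def)
  then have diff: "local_occ w k x - local_occ w (Suc k) x = real (card B) / deg w"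
    by (simp add: local_occ_def add_divide_distrib)
  have "real (card B) * pmf (dispatch_pmf d G x w) u = (\<Sum>v\<in>B. pmf (dispatch_pmf d G x w) v)"
  proof -
    have "pmf (dispatch_pmf d G x w) v = pmf (dispatch_pmf d G x w) u" if "v \<in> B" for v
      using that u by (intro pmf_dispatch_swap) (auto simp: B_def k_def)
    then show ?thesis by simp
  qed
  also have "\<dots> = measure_pmf.prob (dispatch_pmf d G x w) B"
    using B by (simp add: measure_measure_pmf_finite)
  also have "\<dots> = measure_pmf.prob (dispatch_pmf d G x w) ({u. k \<le> x u} - {u. Suc k \<le> x u})"
    using set_dispatch[OF w, of x] by (intro measure_prob_cong_0) (auto simp: B_def pmf_eq_0_set_pmf)
  also have "\<dots> = local_occ w k x ^ d - local_occ w (Suc k) x ^ d"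
    by (subst measure_pmf.finite_measure_Diff) (auto simp: prob_dispatch_ge[OF w])
  also have "\<dots> = real (card B) * (power_quotient (local_occ w k x) (local_occ w (Suc k) x) / deg w)"
    unfolding power_quotient diff by simp
  finally have "real (card B) * pmf (dispatch_pmf d G x w) u
     = real (card B) * (power_quotient (local_occ w k x) (local_occ w (Suc k) x) / deg w)" .
  moreover have "real (card B) \<noteq> 0" using B by (auto simp: card_eq_0_iff)
  ultimately show ?thesis by (simp only: mult_cancel_left k_def) simp
qed

text \<open>The chosen queue is no longer than the first sampled one, and the first sampled server
  is uniform on the neighbourhood.\<close>

lemma nn_integral_dispatch_le:
  assumes w: "w \<in> W" and f: "\<And>u v. x u \<le> x v \<Longrightarrow> f u \<le> f v"
  shows "(\<integral>\<^sup>+u. f u \<partial>dispatch_pmf d G x w) \<le> (\<integral>\<^sup>+u. f u \<partial>pmf_of_set (nbh w))"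
proof -
  have "(\<integral>\<^sup>+u. f u \<partial>dispatch_pmf d G x w) = (\<integral>\<^sup>+s. \<integral>\<^sup>+u. f u \<partial>pmf_of_set (shortest x (set s)) \<partial>sample w)"
    unfolding dispatch_pmf_shortest by simp
  also have "\<dots> \<le> (\<integral>\<^sup>+s. f (hd s) \<partial>sample w)"
  proof (rule nn_integral_mono_AE, rule AE_pmfI)
    fix s assume s: "s \<in> set_pmf (sample w)"
    let ?p = "pmf_of_set (shortest x (set s))"
    have "(\<integral>\<^sup>+u. f u \<partial>?p) \<le> (\<integral>\<^sup>+u. f (hd s) \<partial>?p)"
    proof (rule nn_integral_mono_AE, rule AE_pmfI)
      fix u assume "u \<in> set_pmf ?p"
      then have "u \<in> shortest x (set s)" using set_shortest_pmf[OF w s] by simp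
      moreover have "hd s \<in> set s" using set_sample[OF w s] by (cases s) auto
      ultimately show "f u \<le> f (hd s)" by (intro f) (auto simp: shortest_def)
    qed
    then show "(\<integral>\<^sup>+u. f u \<partial>?p) \<le> f (hd s)" by simp
  qed
  also have "\<dots> = (\<integral>\<^sup>+u. f u \<partial>map_pmf hd (sample w))" by simp
  also have "map_pmf hd (sample w) = pmf_of_set (nbh w)"
    using d by (intro map_hd_replicate_pmf) simp
  finally show ?thesis .
qed

lemma expectation_dispatch_le:
  fixes f :: "'v \<Rightarrow> real"
  assumes w: "w \<in> W" and f: "\<And>u v. x u \<le> x v \<Longrightarrow> f u \<le> f v" "\<And>u. 0 \<le> f u"
  shows "measure_pmf.expectation (dispatch_pmf d G x w) f \<le> (\<Sum>u\<in>nbh w. f u) / deg w"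
proof -
  have ne: "nbh w \<noteq> {}" by (rule nbh_nonempty[OF w])
  have "ennreal (measure_pmf.expectation (dispatch_pmf d G x w) f) = (\<integral>\<^sup>+u. ennreal (f u) \<partial>dispatch_pmf d G x w)"
    using f(2) finite_dispatch[OF w, of x] by (intro nn_integral_eq_integral[symmetric] integrable_measure_pmf_finite) auto
  also have "\<dots> \<le> (\<integral>\<^sup>+u. ennreal (f u) \<partial>pmf_of_set (nbh w))"
    using f(1) by (intro nn_integral_dispatch_le[OF w] ennreal_leI) auto
  also have "\<dots> = ennreal (measure_pmf.expectation (pmf_of_set (nbh w)) f)"
    using f(2) ne finite_nbh by (intro nn_integral_eq_integral integrable_measure_pmf_finite) auto
  also have "measure_pmf.expectation (pmf_of_set (nbh w)) f = (\<Sum>u\<in>nbh w. f u) / deg w"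
    using ne finite_nbh by (simp add: integral_pmf_of_set card_nbh)
  finally show ?thesis
    using f(2) by (subst (asm) ennreal_le_iff) (auto intro!: divide_nonneg_nonneg sum_nonneg)
qed

text \<open>
  One step of the uniformized chain for a rule \<open>T\<close> that decides where an arrival goes; \<open>None\<close>
  means that there is no arrival.
\<close>

definition depart_prob :: real where
  "depart_prob = 1 / (1 + lam * d)"

definition step_pmf :: "(('v \<Rightarrow> nat) \<Rightarrow> 'v option pmf) \<Rightarrow> ('v \<Rightarrow> nat) \<Rightarrow> ('v \<Rightarrow> nat) pmf" where
  "step_pmf T x = bernoulli_pmf depart_prob \<bind>
     (\<lambda>b. if b then map_pmf (depart x) (pmf_of_set V) else map_pmf (arrive x) (T x))"

text \<open>Potential arrivals come at rate \<open>lam * d\<close> per server, leaving room for the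
  acceptance rates of the product chain. Thinning by \<open>1 / d\<close> recovers the true rate, by
  \<open>(1 - depart_prob) / d = lam * depart_prob\<close>.\<close>

definition jsq_target :: "('v \<Rightarrow> nat) \<Rightarrow> 'v option pmf" where
  "jsq_target x = bernoulli_pmf (1 / d) \<bind>
     (\<lambda>a. if a then pmf_of_set W \<bind> (\<lambda>w. map_pmf Some (dispatch_pmf d G x w)) else return_pmf None)"

abbreviation "queue_kernel \<equiv> step_pmf jsq_target"

lemma depart_prob: "0 < depart_prob" "depart_prob < 1" "(1 - depart_prob) / d = lam * depart_prob"
proof -
  have ld: "0 < lam * d" using lam d by simp
  then show "0 < depart_prob" "depart_prob < 1"
    by (auto simp: depart_prob_def field_simps)
  have "1 - depart_prob = d * (lam * depart_prob)"
    using ld by (simp add: depart_prob_def field_simps)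
  then show "(1 - depart_prob) / d = lam * depart_prob" using d by simp
qed

lemma set_step_pmf:
  "set_pmf (step_pmf T x) = depart x ` V \<union> arrive x ` set_pmf (T x)"
  unfolding step_pmf_def set_bind_pmf set_pmf_bernoulli[OF depart_prob(1,2)] UNIV_bool
  by (simp add: set_pmf_of_set[OF V(2,1)] Un_commute del: depart.simps)

lemma set_jsq_target: "set_pmf (jsq_target x) = insert None (Some ` V)"
proof -
  have d1: "0 < 1 / real d" "1 / real d < 1" using d by auto
  have "(\<Union>w\<in>W. nbh w) = V"
    using nbh_subset types_of_nonempty types_of_iff by (fastforce simp: types_of_def)
  moreover have "set_pmf (pmf_of_set W \<bind> (\<lambda>w. map_pmf Some (dispatch_pmf d G x w))) = Some ` (\<Union>w\<in>W. nbh w)"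
    using W by (auto simp: set_dispatch_eq)
  ultimately show ?thesis
    using d1 unfolding jsq_target_def by (auto simp: set_bind_pmf set_pmf_bernoulli UNIV_bool)
qed

lemma finite_jsq_target: "finite (set_pmf (jsq_target x))"
  using V by (simp add: set_jsq_target)

lemma expectation_step_pmf:
  fixes f :: "('v \<Rightarrow> nat) \<Rightarrow> real"
  assumes "finite (set_pmf (T x))"
  shows "measure_pmf.expectation (step_pmf T x) f = depart_prob * ((\<Sum>v\<in>V. f (depart x v)) / N)
     + (1 - depart_prob) * measure_pmf.expectation (T x) (\<lambda>r. f (arrive x r))"
  unfolding step_pmf_def
  by (subst expectation_bind_finite) (use assms depart_prob V in \<open>auto simp: integral_pmf_of_set\<close>)

lemma expectation_jsq_target:
  fixes f :: "'v option \<Rightarrow> real"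
  shows "measure_pmf.expectation (jsq_target x) f
    = (\<Sum>w\<in>W. measure_pmf.expectation (dispatch_pmf d G x w) (\<lambda>u. f (Some u))) / M / d + (1 - 1 / d) * f None"
proof -
  have fin: "finite (set_pmf (map_pmf Some (dispatch_pmf d G x w)))" if "w \<in> set_pmf (pmf_of_set W)" for w
    using that finite_dispatch W by simp
  have W': "finite (set_pmf (pmf_of_set W))" using W by simp
  have fin2: "finite (set_pmf (pmf_of_set W \<bind> (\<lambda>w. map_pmf Some (dispatch_pmf d G x w))))"
    using fin W' by simp
  have "measure_pmf.expectation (pmf_of_set W \<bind> (\<lambda>w. map_pmf Some (dispatch_pmf d G x w))) f
    = (\<Sum>w\<in>W. measure_pmf.expectation (dispatch_pmf d G x w) (\<lambda>u. f (Some u))) / M"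
    using W by (subst expectation_bind_finite[OF W' fin]) (auto simp: integral_pmf_of_set)
  then show ?thesis
    unfolding jsq_target_def
    by (subst expectation_bind_finite) (use d fin2 in auto)
qed

lemma expectation_queue_kernel:
  fixes f :: "('v \<Rightarrow> nat) \<Rightarrow> real"
  shows "measure_pmf.expectation (queue_kernel x) f - f x = depart_prob *
    ((\<Sum>v\<in>V. f (depart x v) - f x) / N
     + lam * ((\<Sum>w\<in>W. measure_pmf.expectation (dispatch_pmf d G x w) (\<lambda>u. f (x(u := x u + 1)) - f x)) / M))"
proof -
  have "(\<Sum>w\<in>W. measure_pmf.expectation (dispatch_pmf d G x w) (\<lambda>u. f (x(u := x u + 1)) - f x))
     = (\<Sum>w\<in>W. measure_pmf.expectation (dispatch_pmf d G x w) (\<lambda>u. f (x(u := x u + 1))) - f x)"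
    using finite_dispatch by (intro sum.cong refl) (simp add: integrable_measure_pmf_finite)
  also have "\<dots> = (\<Sum>w\<in>W. measure_pmf.expectation (dispatch_pmf d G x w) (\<lambda>u. f (x(u := x u + 1)))) - M * f x"
    by (simp add: sum_subtractf)
  finally have arr: "(\<Sum>w\<in>W. measure_pmf.expectation (dispatch_pmf d G x w) (\<lambda>u. f (x(u := x u + 1)) - f x)) / M
    = (\<Sum>w\<in>W. measure_pmf.expectation (dispatch_pmf d G x w) (\<lambda>u. f (x(u := x u + 1)))) / M - f x"
    using M_pos by (simp add: diff_divide_distrib)
  have dep: "(\<Sum>v\<in>V. f (depart x v) - f x) / N = (\<Sum>v\<in>V. f (depart x v)) / N - f x"
    using N_pos by (simp add: sum_subtractf diff_divide_distrib)
  define a where "a = (\<Sum>w\<in>W. measure_pmf.expectation (dispatch_pmf d G x w) (\<lambda>u. f (x(u := x u + 1)))) / M"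
  define b where "b = (\<Sum>v\<in>V. f (depart x v)) / N"
  have "measure_pmf.expectation (queue_kernel x) f = depart_prob * b + (1 - depart_prob) * (a / d + (1 - 1 / d) * f x)"
    unfolding expectation_step_pmf[where T=jsq_target, OF finite_jsq_target] expectation_jsq_target by (simp add: a_def b_def)
  also have "\<dots> = depart_prob * b + (1 - depart_prob) / d * (a - f x) + (1 - depart_prob) * f x"
    using d by (simp add: field_simps)
  finally show ?thesis
    unfolding arr dep a_def[symmetric] b_def[symmetric] depart_prob(3) by (simp add: algebra_simps)
qed

lemma pmf_eq_expectation: "pmf p y = measure_pmf.expectation p (indicator {y})"
  by (simp add: measure_pmf_single)

definition uniform_rate :: real where
  "uniform_rate = N / depart_prob"

text \<open>Read off from \<open>expectation_queue_kernel\<close> with the indicator of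
  \<open>y\<close> as test function. Thinned arrivals and departures from empty queues are
  self-loops and do not contribute when \<open>y \<noteq> x\<close>.\<close>

lemma queue_rates_eq:
  "queue_rates lam d G x y = (if y = x then 0 else uniform_rate * pmf (queue_kernel x) y)"
proof (cases "y = x")
  case True
  have "pmf (map_pmf (\<lambda>v. x(v := x v + 1)) (dispatch_pmf d G x w)) x = 0" for w
  proof -
    have "x \<noteq> x(v := x v + 1)" for v by (metis Suc_eq_plus1 fun_upd_same n_not_Suc_n)
    then show ?thesis by (auto simp: pmf_eq_0_set_pmf)
  qed
  moreover have "\<not> (0 < x v \<and> x = x(v := x v - 1))" for v
    by (metis diff_Suc_less fun_upd_same less_irrefl One_nat_def)
  then have "(\<Sum>v\<in>V. if 0 < x v \<and> x = x(v := x v - 1) then 1 else 0) = (0 :: real)"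
    by (intro sum.neutral) auto
  ultimately show ?thesis using True by (simp add: queue_rates_def)
next
  case False
  have e: "measure_pmf.expectation (dispatch_pmf d G x w) (\<lambda>u. indicator {y} (x(u := x u + 1)) - indicator {y} x :: real)
     = pmf (map_pmf (\<lambda>v. x(v := x v + 1)) (dispatch_pmf d G x w)) y" for w
  proof -
    have "(\<lambda>u. indicator {y} (x(u := x u + 1)) - indicator {y} x :: real)
       = indicator ((\<lambda>v. x(v := x v + 1)) -` {y})"
      using False by (intro ext) (simp add: indicator_def)
    then show ?thesis by (simp add: pmf_map)
  qed
  have dd: "(indicator {y} (depart x v) - indicator {y} x :: real) = (if 0 < x v \<and> y = x(v := x v - 1) then 1 else 0)" for v
    using False by (cases "x v = 0") (auto simp: fun_upd_idem)
  have "uniform_rate * pmf (queue_kernel x) y = uniform_rate * (measure_pmf.expectation (queue_kernel x) (indicator {y}) - indicator {y} x)"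
    unfolding pmf_eq_expectation using False by simp
  also have "\<dots> = N * ((\<Sum>v\<in>V. if 0 < x v \<and> y = x(v := x v - 1) then 1 else 0) / N
     + lam * ((\<Sum>w\<in>W. pmf (map_pmf (\<lambda>v. x(v := x v + 1)) (dispatch_pmf d G x w)) y) / M))"
    unfolding expectation_queue_kernel e dd using depart_prob by (simp add: uniform_rate_def)
  also have "\<dots> = queue_rates lam d G x y"
    unfolding queue_rates_def using N_pos
    by (simp add: distrib_left sum_distrib_left sum_divide_distrib mult_ac)
  finally show ?thesis using False by simp
qed

lemma countable_queue_states: "countable (queue_states G)"
proof (rule countable_subset)
  show "queue_states G \<subseteq> (\<lambda>f v. if v \<in> V then f v else 0) ` (\<Pi>\<^sub>E v\<in>V. UNIV)"
  proof
    fix x assume "x \<in> queue_states G"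
    then have "x = (\<lambda>v. if v \<in> V then restrict x V v else 0)"
      by (auto simp: queue_states_def)
    then show "x \<in> (\<lambda>f v. if v \<in> V then f v else 0) ` (\<Pi>\<^sub>E v\<in>V. UNIV)"
      by (rule image_eqI[of _ _ "restrict x V"]) auto
  qed
  show "countable ((\<lambda>f v. if v \<in> V then f v else 0) ` (\<Pi>\<^sub>E v\<in>V. (UNIV :: nat set)))"
    using V by (intro countable_image countable_PiE) auto
qed

lemma arrive_in_kernel: "u \<in> V \<Longrightarrow> x(u := x u + 1) \<in> set_pmf (queue_kernel x)"
  unfolding set_step_pmf set_jsq_target by (auto intro!: image_eqI[of _ _ "Some u"])

lemma depart_in_kernel: "v \<in> V \<Longrightarrow> x(v := x v - 1) \<in> set_pmf (queue_kernel x)"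
  unfolding set_step_pmf by auto

lemma uniformized_queue: "uniformized (queue_rates lam d G) queue_kernel uniform_rate (queue_states G)"
proof
  show "0 < uniform_rate" using N_pos depart_prob by (simp add: uniform_rate_def)
  show "countable (queue_states G)" by (rule countable_queue_states)
  fix x y assume "x \<in> queue_states G"
  then show "set_pmf (queue_kernel x) \<subseteq> queue_states G"
    unfolding set_step_pmf set_jsq_target by (auto simp: queue_states_def)
  show "finite (set_pmf (queue_kernel x))"
    using V by (simp add: set_step_pmf finite_jsq_target)
  show "queue_rates lam d G x y = (if y = x then 0 else uniform_rate * pmf (queue_kernel x) y)"
    by (rule queue_rates_eq)
  obtain u where u: "u \<in> V" using V by blast
  show "pmf (queue_kernel x) x < 1"
  proof (rule ccontr)
    assume "\<not> pmf (queue_kernel x) x < 1"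
    then have "pmf (queue_kernel x) x = 1" using pmf_le_1[of "queue_kernel x" x] by linarith
    then have "set_pmf (queue_kernel x) \<subseteq> {x}"
      by (metis set_pmf_subset_singleton measure_pmf_single measure_pmf.prob_eq_1 AE_measure_pmf_iff
          subsetI sets_measure_pmf UNIV_I)
    then have "x(u := x u + 1) = x" using arrive_in_kernel[OF u] by blast
    then show False by (metis Suc_eq_plus1 fun_upd_same n_not_Suc_n)
  qed
qed

end

sublocale queue_network \<subseteq> uniformized "queue_rates lam d G" queue_kernel uniform_rate "queue_states G"
  by (rule uniformized_queue)

context queue_network
begin

section \<open>Ergodicity of the queue length process\<close>

definition total :: "('v \<Rightarrow> nat) \<Rightarrow> nat" where
  "total x = (\<Sum>v\<in>V. x v)"

lemma total_arrive: "u \<in> V \<Longrightarrow> total (x(u := x u + 1)) = Suc (total x)"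
  using V(1) by (simp add: total_def sum.remove[of V u])

lemma total_depart: "u \<in> V \<Longrightarrow> 0 < x u \<Longrightarrow> Suc (total (x(u := x u - 1))) = total x"
  using V(1) by (simp add: total_def sum.remove[of V u])

lemma total_eq_0: "x \<in> queue_states G \<Longrightarrow> total x = 0 \<longleftrightarrow> x = (\<lambda>_. 0)"
  using V(1) by (auto simp: total_def queue_states_def fun_eq_iff)

lemma total_pos: "0 < total x \<Longrightarrow> \<exists>u\<in>V. 0 < x u"
  by (rule ccontr) (simp add: total_def)

lemma zero_in_states: "(\<lambda>_. 0) \<in> queue_states G"
  by (simp add: queue_states_def)

lemma zero_reachable: "x \<in> queue_states G \<Longrightarrow> \<exists>n. 0 < pmf (pmf_iterate queue_kernel n x) (\<lambda>_. 0)"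
proof (induction "total x" arbitrary: x)
  case 0
  then have "x = (\<lambda>_. 0)" using total_eq_0 by simp
  then show ?case by (intro exI[of _ 0]) simp
next
  case (Suc k)
  then obtain u where u: "u \<in> V" "0 < x u" using total_pos[of x] by auto
  let ?y = "x(u := x u - 1)"
  have "k = total ?y" "?y \<in> queue_states G"
    using total_depart[where x=x, OF u] Suc u by (auto simp: queue_states_def)
  then obtain n where "0 < pmf (pmf_iterate queue_kernel n ?y) (\<lambda>_. 0)" using Suc.hyps(1) by blast
  then have "(\<lambda>_. 0) \<in> set_pmf (pmf_iterate queue_kernel (Suc n) x)"
    using depart_in_kernel[OF u(1), of x] by (auto simp: pmf_positive_iff)
  then show ?case by (intro exI[of _ "Suc n"]) (simp only: pmf_positive_iff)
qed

definition has_Lyapunov :: "('v \<Rightarrow> nat) \<Rightarrow> bool" where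
  "has_Lyapunov x \<longleftrightarrow> (\<exists>f :: ('v \<Rightarrow> nat) \<Rightarrow> real. \<exists>\<delta>>0. (\<forall>z\<in>queue_states G. 0 \<le> f z) \<and>
     (\<forall>z\<in>queue_states G. z \<noteq> x \<longrightarrow> measure_pmf.expectation (queue_kernel z) f \<le> f z - \<delta>))"

text \<open>An arrival raises the sum of squares by an amount monotone in the queue it joins, so
  joining the shortest sampled queue is no worse than joining a uniform neighbour. By
  \<open>average_over_types\<close> the latter loads every server at rate
  \<open>lam < 1\<close>.\<close>

lemma drift_squares:
  "measure_pmf.expectation (queue_kernel x) (\<lambda>x. \<Sum>v\<in>V. (real (x v))\<^sup>2) - (\<Sum>v\<in>V. (real (x v))\<^sup>2)
    \<le> depart_prob * (1 + lam - 2 * (1 - lam) * total x / N)"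
proof -
  let ?f = "\<lambda>x. \<Sum>v\<in>V. (real (x v))\<^sup>2"
  have dep: "?f (depart x v) - ?f x \<le> 1 - 2 * real (x v)" if "v \<in> V" for v
    using that V(1) by (cases "x v") (auto simp: sum.remove[of V v] power2_eq_square algebra_simps)
  have arr: "?f (x(u := x u + 1)) - ?f x = 2 * real (x u) + 1" if "u \<in> V" for u
    using that V(1) by (simp add: sum.remove[of V u] power2_eq_square algebra_simps)
  have "(\<Sum>v\<in>V. ?f (depart x v) - ?f x) \<le> (\<Sum>v\<in>V. 1 - 2 * real (x v))"
    by (intro sum_mono dep)
  also have "\<dots> = N - 2 * total x"
    by (simp add: sum_subtractf total_def sum_distrib_left)
  finally have dep': "(\<Sum>v\<in>V. ?f (depart x v) - ?f x) / N \<le> (N - 2 * total x) / N"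
    using N_pos by (intro divide_right_mono) auto
  have "measure_pmf.expectation (dispatch_pmf d G x w) (\<lambda>u. ?f (x(u := x u + 1)) - ?f x)
     \<le> (\<Sum>u\<in>nbh w. 2 * real (x u) + 1) / deg w" if w: "w \<in> W" for w
  proof -
    have "measure_pmf.expectation (dispatch_pmf d G x w) (\<lambda>u. ?f (x(u := x u + 1)) - ?f x)
       = measure_pmf.expectation (dispatch_pmf d G x w) (\<lambda>u. 2 * real (x u) + 1)"
    proof (intro integral_cong_AE AE_pmfI)
      fix u assume "u \<in> set_pmf (dispatch_pmf d G x w)"
      then show "?f (x(u := x u + 1)) - ?f x = 2 * real (x u) + 1"
        using set_dispatch[OF w, of x] nbh_subset[of w] by (intro arr) blast
    qed auto
    also have "\<dots> \<le> (\<Sum>u\<in>nbh w. 2 * real (x u) + 1) / deg w"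
      by (rule expectation_dispatch_le[OF w]) auto
    finally show ?thesis .
  qed
  then have "(\<Sum>w\<in>W. measure_pmf.expectation (dispatch_pmf d G x w) (\<lambda>u. ?f (x(u := x u + 1)) - ?f x)) / M
     \<le> (\<Sum>w\<in>W. (\<Sum>u\<in>nbh w. 2 * real (x u) + 1) / deg w) / M"
    using M_pos by (intro divide_right_mono sum_mono) auto
  also have "\<dots> = (2 * total x + N) / N"
    unfolding average_over_types by (simp add: sum.distrib total_def sum_distrib_left)
  finally have arr': "(\<Sum>w\<in>W. measure_pmf.expectation (dispatch_pmf d G x w) (\<lambda>u. ?f (x(u := x u + 1)) - ?f x)) / M
     \<le> (2 * total x + N) / N" .
  have "measure_pmf.expectation (queue_kernel x) ?f - ?f x = depart_prob * ((\<Sum>v\<in>V. ?f (depart x v) - ?f x) / N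
      + lam * ((\<Sum>w\<in>W. measure_pmf.expectation (dispatch_pmf d G x w) (\<lambda>u. ?f (x(u := x u + 1)) - ?f x)) / M))"
    by (rule expectation_queue_kernel)
  also have "\<dots> \<le> depart_prob * ((N - 2 * total x) / N + lam * ((2 * total x + N) / N))"
    using depart_prob lam dep' arr'
    by (intro mult_left_mono add_mono) auto
  also have "(N - 2 * total x) / N + lam * ((2 * total x + N) / N) = 1 + lam - 2 * (1 - lam) * total x / N"
    using N_pos by (simp add: field_simps)
  finally show ?thesis .
qed

text \<open>The squares decrease only when many tasks are present; this bounded function decreases
  at every nonempty state. A departure from one nonempty queue has weight \<open>1 / N\<close> but
  gains \<open>2 * N\<close> times what an arrival costs, hence twice as much on average.\<close>

lemma drift_power:
  assumes x: "0 < total x"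
  shows "measure_pmf.expectation (queue_kernel x) (\<lambda>x. 1 - (1 / (2 * N)) ^ total x) - (1 - (1 / (2 * N)) ^ total x)
     \<le> - (depart_prob * (1 / (2 * N)) ^ total x / 2)"
proof -
  define e where "e = 1 / (2 * N)"
  let ?f = "\<lambda>x. 1 - e ^ total x"
  have "1 \<le> N" using N_pos by simp
  then have e: "0 < e" "e \<le> 1 / 2" "2 * N * e = 1" by (auto simp: e_def field_simps)
  obtain m where m: "total x = Suc m" using x by (cases "total x") auto
  obtain u where u: "u \<in> V" "0 < x u" using total_pos[OF x] by blast
  have dep: "?f (depart x v) - ?f x \<le> (if v = u then - (e ^ m * (1 - e)) else 0)" if "v \<in> V" for v
  proof (cases "x v = 0")
    case True
    then have "depart x v = x" by (simp add: fun_upd_idem)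
    then show ?thesis using True u by auto
  next
    case False
    then have "Suc (total (depart x v)) = total x" using total_depart[OF that, of x] by simp
    then have "total (depart x v) = m" using m by simp
    then show ?thesis using e m by (simp add: algebra_simps)
  qed
  have "(\<Sum>v\<in>V. ?f (depart x v) - ?f x) \<le> (\<Sum>v\<in>V. if v = u then - (e ^ m * (1 - e)) else 0)"
    by (intro sum_mono dep)
  also have "\<dots> = - (e ^ m * (1 - e))" using u V by simp
  finally have "(\<Sum>v\<in>V. ?f (depart x v) - ?f x) / N \<le> - (e ^ m * (1 - e)) / N"
    using N_pos by (intro divide_right_mono) auto
  also have "\<dots> = - (e ^ m * (1 - e)) * (2 * e)" using N_pos by (simp add: e_def)
  finally have dep': "(\<Sum>v\<in>V. ?f (depart x v) - ?f x) / N \<le> - (2 * e ^ Suc m * (1 - e))"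
    by (simp add: algebra_simps)
  have "measure_pmf.expectation (dispatch_pmf d G x w) (\<lambda>u. ?f (x(u := x u + 1)) - ?f x) = e ^ Suc m * (1 - e)"
    if w: "w \<in> W" for w
  proof -
    have "measure_pmf.expectation (dispatch_pmf d G x w) (\<lambda>u. ?f (x(u := x u + 1)) - ?f x)
       = measure_pmf.expectation (dispatch_pmf d G x w) (\<lambda>u. e ^ Suc m * (1 - e))"
      using set_dispatch[OF w, of x] nbh_subset[of w] total_arrive[of _ x]
      by (intro integral_cong_AE) (auto simp: AE_measure_pmf_iff m algebra_simps)
    then show ?thesis by simp
  qed
  then have arr': "(\<Sum>w\<in>W. measure_pmf.expectation (dispatch_pmf d G x w) (\<lambda>u. ?f (x(u := x u + 1)) - ?f x)) / M
     = e ^ Suc m * (1 - e)"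
    using M_pos by simp
  have "measure_pmf.expectation (queue_kernel x) ?f - ?f x
     = depart_prob * ((\<Sum>v\<in>V. ?f (depart x v) - ?f x) / N + lam * (e ^ Suc m * (1 - e)))"
    unfolding arr'[symmetric] by (rule expectation_queue_kernel)
  also have "\<dots> \<le> depart_prob * (- (2 * e ^ Suc m * (1 - e)) + lam * (e ^ Suc m * (1 - e)))"
    using depart_prob dep' by (intro mult_left_mono add_right_mono) auto
  also have "- (2 * e ^ Suc m * (1 - e)) + lam * (e ^ Suc m * (1 - e)) \<le> - (e ^ Suc m / 2)"
  proof -
    have "(1 / 2) * 1 \<le> (1 - e) * (2 - lam)" using e lam by (intro mult_mono) auto
    then have "e ^ Suc m * (1 / 2) \<le> e ^ Suc m * ((1 - e) * (2 - lam))"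
      using e by (intro mult_left_mono) auto
    then show ?thesis by (simp add: algebra_simps)
  qed
  then have "depart_prob * (- (2 * e ^ Suc m * (1 - e)) + lam * (e ^ Suc m * (1 - e))) \<le> depart_prob * - (e ^ Suc m / 2)"
    using depart_prob by (intro mult_left_mono) auto
  finally show ?thesis unfolding e_def[symmetric] m by simp
qed

lemma has_Lyapunov_zero: "has_Lyapunov (\<lambda>_. 0)"
proof -
  define e where "e = 1 / (2 * N)"
  have "1 \<le> N" using N_pos by simp
  then have e: "0 < e" "e \<le> 1" by (auto simp: e_def field_simps)
  \<comment> \<open>From total \<open>K\<close> on, the squares have drift at most
    \<open>- depart_prob\<close>. Below \<open>K\<close> their drift is at most
    \<open>2 * depart_prob\<close>, and \<open>A = 6 / e ^ K\<close> makes the bounded function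
    contribute at most \<open>- 3 * depart_prob\<close>.\<close>
  obtain K :: nat where K: "3 * N / (2 * (1 - lam)) \<le> real K" using real_arch_simple by blast
  define A where "A = 6 / e ^ K"
  have A: "0 < A" using e by (simp add: A_def)
  let ?F = "\<lambda>x. \<Sum>v\<in>V. (real (x v))\<^sup>2" and ?h = "\<lambda>x. 1 - e ^ total x"
  define f where "f = (\<lambda>x. ?F x + A * ?h x)"
  have nonneg: "0 \<le> f x" for x
    using e A by (auto simp: f_def power_le_one intro!: add_nonneg_nonneg sum_nonneg mult_nonneg_nonneg)
  have "measure_pmf.expectation (queue_kernel x) f \<le> f x - depart_prob" if x: "x \<in> queue_states G" "x \<noteq> (\<lambda>_. 0)" for x
  proof -
    have t: "0 < total x" using total_eq_0 x by auto
    have lin: "measure_pmf.expectation (queue_kernel x) f - f x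
       = (measure_pmf.expectation (queue_kernel x) ?F - ?F x) + A * (measure_pmf.expectation (queue_kernel x) ?h - ?h x)"
      unfolding f_def expectation_Q[OF x(1)]
      by (simp add: algebra_simps sum.distrib sum_distrib_left sum_subtractf)
    have h: "measure_pmf.expectation (queue_kernel x) ?h - ?h x \<le> - (depart_prob * e ^ total x / 2)"
      using drift_power[OF t] by (simp add: e_def)
    have Ah: "A * (measure_pmf.expectation (queue_kernel x) ?h - ?h x) \<le> A * - (depart_prob * e ^ total x / 2)"
      using h A by (intro mult_left_mono) auto
    have F: "measure_pmf.expectation (queue_kernel x) ?F - ?F x \<le> depart_prob * (1 + lam - 2 * (1 - lam) * total x / N)"
      by (rule drift_squares)
    show ?thesis
    proof (cases "K \<le> total x")
      case True
      have "3 * N / (2 * (1 - lam)) \<le> real (total x)" using K True by linarith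
      then have "3 \<le> 2 * (1 - lam) * total x / N" using lam N_pos by (simp add: field_simps)
      then have "depart_prob * (1 + lam - 2 * (1 - lam) * total x / N) \<le> depart_prob * (- 1)"
        using depart_prob lam by (intro mult_left_mono) auto
      moreover have "A * - (depart_prob * e ^ total x / 2) \<le> 0" using A depart_prob e by simp
      ultimately show ?thesis using lin F Ah by linarith
    next
      case False
      have "e ^ K \<le> e ^ total x" using False e by (intro power_decreasing) auto
      then have "6 \<le> A * e ^ total x" using e by (simp add: A_def field_simps)
      then have "depart_prob * 6 \<le> depart_prob * (A * e ^ total x)"
        using depart_prob by (intro mult_left_mono) auto
      then have "A * - (depart_prob * e ^ total x / 2) \<le> - 3 * depart_prob" by (simp add: algebra_simps)
      moreover have "1 + lam - 2 * (1 - lam) * total x / N \<le> 2"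
      proof -
        have "0 \<le> 2 * (1 - lam) * total x / N" using lam N_pos by simp
        then show ?thesis using lam by linarith
      qed
      then have "depart_prob * (1 + lam - 2 * (1 - lam) * total x / N) \<le> depart_prob * 2"
        using depart_prob by (intro mult_left_mono) auto
      ultimately show ?thesis using lin F Ah by linarith
    qed
  qed
  then show ?thesis
    unfolding has_Lyapunov_def using nonneg depart_prob by blast
qed

text \<open>
  A Lyapunov function for the target \<open>a\<close> becomes one for a successor \<open>b\<close> of \<open>a\<close> by adding a large
  multiple of the indicator of the complement of \<open>b\<close>.
\<close>

lemma has_Lyapunov_successor:
  assumes L: "has_Lyapunov a" and a: "a \<in> queue_states G" and b: "b \<in> set_pmf (queue_kernel a)"
  shows "has_Lyapunov b"
proof -
  from L obtain f :: "('v \<Rightarrow> nat) \<Rightarrow> real" and \<delta> where \<delta>: "0 < \<delta>" and f: "\<forall>z\<in>queue_states G. 0 \<le> f z"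
    and drift: "\<And>z. z \<in> queue_states G \<Longrightarrow> z \<noteq> a \<Longrightarrow> measure_pmf.expectation (queue_kernel z) f \<le> f z - \<delta>"
    unfolding has_Lyapunov_def by blast
  define p where "p = pmf (queue_kernel a) b"
  have p: "0 < p" using b by (simp add: p_def pmf_positive)
  \<comment> \<open>From \<open>a\<close> one step reaches \<open>b\<close> with probability
    \<open>p\<close>, which saves \<open>A * p\<close> of the penalty on average; this outweighs the
    uncontrolled drift of \<open>f\<close> at \<open>a\<close>.\<close>
  define A where "A = max 0 ((measure_pmf.expectation (queue_kernel a) f - f a + \<delta>) / p)"
  define g where "g = (\<lambda>z. f z + A * indicator (- {b}) z)"
  have lin: "measure_pmf.expectation (queue_kernel z) g
      = measure_pmf.expectation (queue_kernel z) f + A * (1 - pmf (queue_kernel z) b)" if z: "z \<in> queue_states G" for z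
  proof -
    have "measure_pmf.expectation (queue_kernel z) (indicator (- {b}) :: _ \<Rightarrow> real) = 1 - pmf (queue_kernel z) b"
      using measure_pmf.prob_compl[of "{b}" "queue_kernel z"] by (simp add: measure_pmf_single Compl_eq_Diff_UNIV)
    moreover have "measure_pmf.expectation (queue_kernel z) g
      = measure_pmf.expectation (queue_kernel z) f + A * measure_pmf.expectation (queue_kernel z) (indicator (- {b}) :: _ \<Rightarrow> real)"
      unfolding g_def expectation_Q[OF z] by (simp add: algebra_simps sum.distrib sum_distrib_left)
    ultimately show ?thesis by simp
  qed
  have "measure_pmf.expectation (queue_kernel z) g \<le> g z - \<delta>" if z: "z \<in> queue_states G" "z \<noteq> b" for z
  proof (cases "z = a")
    case True
    have "(measure_pmf.expectation (queue_kernel a) f - f a + \<delta>) / p \<le> A" by (simp add: A_def)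
    then have "measure_pmf.expectation (queue_kernel a) f - f a + \<delta> \<le> A * p" using p by (simp add: field_simps)
    then show ?thesis using True z lin[OF a] by (simp add: g_def p_def algebra_simps)
  next
    case False
    have "A * (1 - pmf (queue_kernel z) b) \<le> A * 1" by (intro mult_left_mono) (auto simp: A_def)
    then show ?thesis using drift[OF z(1) False] lin[OF z(1)] z(2) by (simp add: g_def)
  qed
  moreover have "0 \<le> g z" if "z \<in> queue_states G" for z
    using f that by (auto simp: g_def A_def)
  ultimately show ?thesis unfolding has_Lyapunov_def using \<delta> by blast
qed

text \<open>Every state arises from the empty one by finitely many arrivals, each of which is a
  possible step of the kernel.\<close>

lemma has_Lyapunov_all: "x \<in> queue_states G \<Longrightarrow> has_Lyapunov x"
proof (induction "total x" arbitrary: x)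
  case 0
  then show ?case using total_eq_0 has_Lyapunov_zero by simp
next
  case (Suc k)
  then obtain u where u: "u \<in> V" "0 < x u" using total_pos[of x] by auto
  define y where "y = x(u := x u - 1)"
  have y: "k = total y" "y \<in> queue_states G" "x = y(u := y u + 1)"
    using total_depart[where x=x, OF u] Suc u by (auto simp: queue_states_def y_def)
  have "has_Lyapunov y" using Suc.hyps(1) y by blast
  then show ?case
    using y has_Lyapunov_successor[of y x] arrive_in_kernel[OF u(1), of y] by simp
qed

theorem ergodic_queue: "ergodic_on (queue_states G) (queue_rates lam d G)"
  using has_Lyapunov_all zero_in_states zero_reachable
  unfolding has_Lyapunov_def by (intro ergodic_onI) auto

section \<open>Flow balance\<close>

lemma occupancy_sum: "occupancy G i x = (\<Sum>v\<in>V. indicator {i..} (x v)) / N"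
  using V(1) by (simp add: occupancy_def sum.inter_filter[symmetric] indicator_def Collect_conj_eq)

lemma sum_fun_upd_pair:
  fixes h :: "nat \<Rightarrow> nat \<Rightarrow> real"
  assumes "v \<in> V"
  shows "(\<Sum>u\<in>V. h ((x(v := a)) u) ((y(v := b)) u)) = (\<Sum>u\<in>V. h (x u) (y u)) + (h a b - h (x v) (y v))"
proof -
  have "(\<Sum>u\<in>V - {v}. h ((x(v := a)) u) ((y(v := b)) u)) = (\<Sum>u\<in>V - {v}. h (x u) (y u))"
    by (intro sum.cong) auto
  then show ?thesis
    using sum.remove[OF V(1) assms, of "\<lambda>u. h ((x(v := a)) u) ((y(v := b)) u)"]
      sum.remove[OF V(1) assms, of "\<lambda>u. h (x u) (y u)"]
    by simp
qed

lemma sum_fun_upd: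
  fixes h :: "nat \<Rightarrow> real"
  assumes "v \<in> V"
  shows "(\<Sum>u\<in>V. h ((x(v := k)) u)) = (\<Sum>u\<in>V. h (x u)) + (h k - h (x v))"
  using sum_fun_upd_pair[OF assms, of "\<lambda>a _. h a" x k x k] .

lemma occupancy_fun_upd:
  "v \<in> V \<Longrightarrow> occupancy G i (x(v := k)) - occupancy G i x = (indicator {i..} k - indicator {i..} (x v)) / N"
  unfolding occupancy_sum by (subst sum_fun_upd) (simp_all add: add_divide_distrib)

lemma occupancy_bounds: "0 \<le> occupancy G i x" "occupancy G i x \<le> 1"
  using card_mono[OF V(1), of "{v \<in> V. i \<le> x v}"] N_pos
  by (auto simp: occupancy_def divide_le_eq_1)

lemma occupancy_0: "occupancy G 0 x = 1"
  using N_pos by (simp add: occupancy_def)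

lemma integrable_occupancy: "integrable (measure_pmf p) (occupancy G i)"
  using occupancy_bounds by (intro integrable_pmf_bounded[of _ 1]) (simp add: abs_le_iff)

text \<open>By \<open>prob_dispatch_ge\<close>, the probability that an arriving task joins a queue
  of length at least \<open>j\<close>.\<close>

definition dispatch_mass :: "nat \<Rightarrow> ('v \<Rightarrow> nat) \<Rightarrow> real" where
  "dispatch_mass j x = (\<Sum>w\<in>W. local_occ w j x ^ d) / M"

lemma dispatch_mass_bounds: "0 \<le> dispatch_mass j x" "dispatch_mass j x \<le> occupancy G j x"
proof -
  show "0 \<le> dispatch_mass j x"
    unfolding dispatch_mass_def by (intro divide_nonneg_nonneg sum_nonneg zero_le_power local_occ_bounds) auto
  have "local_occ w j x ^ d \<le> local_occ w j x" for w
    using power_decreasing[of 1 d "local_occ w j x"] local_occ_bounds[of w j x] d by simp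
  then show "dispatch_mass j x \<le> occupancy G j x"
    unfolding dispatch_mass_def average_local_occ[symmetric]
    using M_pos by (intro divide_right_mono sum_mono) auto
qed

lemma integrable_dispatch_mass: "integrable (measure_pmf p) (dispatch_mass i)"
  using dispatch_mass_bounds(1) order_trans[OF dispatch_mass_bounds(2) occupancy_bounds(2)]
  by (intro integrable_pmf_bounded[of _ 1]) simp

lemma drift_occupancy:
  "measure_pmf.expectation (queue_kernel x) (occupancy G (Suc j)) - occupancy G (Suc j) x
    = depart_prob / N * (lam * (dispatch_mass j x - dispatch_mass (Suc j) x)
        - (occupancy G (Suc j) x - occupancy G (Suc (Suc j)) x))"
proof -
  let ?f = "occupancy G (Suc j)"
  have dep: "?f (depart x v) - ?f x = - (indicator {Suc j..} (x v) - indicator {Suc (Suc j)..} (x v)) / N" if "v \<in> V" for v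
    using occupancy_fun_upd[OF that, of "Suc j" x "x v - 1"] by (auto simp: indicator_def)
  have "(\<Sum>v\<in>V. ?f (depart x v) - ?f x) = (\<Sum>v\<in>V. - (indicator {Suc j..} (x v) - indicator {Suc (Suc j)..} (x v)) / N)"
    by (intro sum.cong refl dep)
  also have "\<dots> = - (?f x - occupancy G (Suc (Suc j)) x)"
    unfolding occupancy_sum by (simp add: sum_subtractf sum_divide_distrib diff_divide_distrib sum_negf)
  finally have dep': "(\<Sum>v\<in>V. ?f (depart x v) - ?f x) = - (?f x - occupancy G (Suc (Suc j)) x)" .
  have arr: "?f (x(u := x u + 1)) - ?f x = (indicator {u. j \<le> x u} u - indicator {u. Suc j \<le> x u} u) / N" if "u \<in> V" for u
    using occupancy_fun_upd[OF that, of "Suc j" x "x u + 1"] by (auto simp: indicator_def)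
  have "measure_pmf.expectation (dispatch_pmf d G x w) (\<lambda>u. ?f (x(u := x u + 1)) - ?f x)
     = (local_occ w j x ^ d - local_occ w (Suc j) x ^ d) / N" if w: "w \<in> W" for w
  proof -
    have "measure_pmf.expectation (dispatch_pmf d G x w) (\<lambda>u. ?f (x(u := x u + 1)) - ?f x)
       = measure_pmf.expectation (dispatch_pmf d G x w) (\<lambda>u. (indicator {u. j \<le> x u} u - indicator {u. Suc j \<le> x u} u) / N)"
    proof (intro integral_cong_AE AE_pmfI)
      fix u assume "u \<in> set_pmf (dispatch_pmf d G x w)"
      then show "?f (x(u := x u + 1)) - ?f x = (indicator {u. j \<le> x u} u - indicator {u. Suc j \<le> x u} u) / N"
        using set_dispatch[OF w, of x] nbh_subset[of w] by (intro arr) blast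
    qed auto
    moreover have "measure_pmf.expectation (dispatch_pmf d G x w) (\<lambda>u. indicator {u. j \<le> x u} u - indicator {u. Suc j \<le> x u} u)
      = local_occ w j x ^ d - local_occ w (Suc j) x ^ d"
      by (subst Bochner_Integration.integral_diff) (simp_all add: prob_dispatch_ge[OF w] integrable_measure_pmf_finite[OF finite_dispatch[OF w]])
    ultimately show ?thesis by simp
  qed
  then have arr': "(\<Sum>w\<in>W. measure_pmf.expectation (dispatch_pmf d G x w) (\<lambda>u. ?f (x(u := x u + 1)) - ?f x)) / M
     = (dispatch_mass j x - dispatch_mass (Suc j) x) / N"
    by (simp add: dispatch_mass_def sum_subtractf sum_divide_distrib[symmetric] diff_divide_distrib mult.commute)
  have "measure_pmf.expectation (queue_kernel x) ?f - ?f x = depart_prob *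
     (- (?f x - occupancy G (Suc (Suc j)) x) / N + lam * ((dispatch_mass j x - dispatch_mass (Suc j) x) / N))"
    unfolding arr'[symmetric] dep'[symmetric] by (rule expectation_queue_kernel)
  then show ?thesis by (simp add: diff_divide_distrib add_divide_distrib algebra_simps)
qed

lemma occupancy_tendsto_0: "(\<lambda>i. occupancy G i x) \<longlonglongrightarrow> 0"
proof (rule tendsto_eventually)
  have "occupancy G i x = 0" if "total x < i" for i
  proof -
    have "x v \<le> total x" if "v \<in> V" for v
      unfolding total_def using that V(1) by (intro member_le_sum) auto
    then have e: "{v \<in> V. i \<le> x v} = {}" using that by force
    show ?thesis unfolding occupancy_def e by simp
  qed
  then show "\<forall>\<^sub>F i in sequentially. occupancy G i x = 0"
    by (intro eventually_mono[OF eventually_gt_at_top[of "total x"]])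
qed

lemma expectation_occupancy_tendsto_0:
  "(\<lambda>i. measure_pmf.expectation \<pi> (occupancy G i)) \<longlonglongrightarrow> 0"
proof -
  have "(\<lambda>i. measure_pmf.expectation \<pi> (occupancy G i)) \<longlonglongrightarrow> measure_pmf.expectation \<pi> (\<lambda>_. 0 :: real)"
    by (rule integral_dominated_convergence[where w="\<lambda>_. 1"])
       (use occupancy_bounds occupancy_tendsto_0 in auto)
  then show ?thesis by simp
qed

text \<open>
  The difference of the two sides does not depend on \<open>j\<close> by stationarity, and it vanishes as
  \<open>j\<close> grows.
\<close>

lemma expectation_occupancy_Suc:
  assumes inv: "bind_pmf \<pi> queue_kernel = \<pi>"
  shows "measure_pmf.expectation \<pi> (occupancy G (Suc j)) = lam * measure_pmf.expectation \<pi> (dispatch_mass j)"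
proof -
  let ?E = "measure_pmf.expectation \<pi>"
  define c where "c = (\<lambda>j. lam * ?E (dispatch_mass j) - ?E (occupancy G (Suc j)))"
  have c_Suc: "c (Suc j) = c j" for j
  proof -
    have i2: "integrable (measure_pmf \<pi>) (\<lambda>x. measure_pmf.expectation (queue_kernel x) (occupancy G (Suc j)))"
    proof (rule integrable_pmf_bounded[of _ 1])
      fix x
      have "0 \<le> measure_pmf.expectation (queue_kernel x) (occupancy G (Suc j))"
        using occupancy_bounds by (intro Bochner_Integration.integral_nonneg) auto
      moreover have "measure_pmf.expectation (queue_kernel x) (occupancy G (Suc j)) \<le> 1"
        using occupancy_bounds integrable_occupancy by (intro measure_pmf.integral_le_const) auto
      ultimately show "\<bar>measure_pmf.expectation (queue_kernel x) (occupancy G (Suc j))\<bar> \<le> 1" by simp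
    qed
    have "?E (occupancy G (Suc j)) = ?E (\<lambda>x. measure_pmf.expectation (queue_kernel x) (occupancy G (Suc j)))"
      by (subst inv[symmetric], rule expectation_bind_bounded[of _ 1])
         (use occupancy_bounds in \<open>auto simp: abs_le_iff intro: order_trans\<close>)
    then have "0 = ?E (\<lambda>x. measure_pmf.expectation (queue_kernel x) (occupancy G (Suc j)) - occupancy G (Suc j) x)"
      using i2 integrable_occupancy by simp
    also have "\<dots> = depart_prob / N * (lam * (?E (dispatch_mass j) - ?E (dispatch_mass (Suc j)))
        - (?E (occupancy G (Suc j)) - ?E (occupancy G (Suc (Suc j)))))"
      unfolding drift_occupancy using integrable_occupancy integrable_dispatch_mass by simp
    finally have "lam * (?E (dispatch_mass j) - ?E (dispatch_mass (Suc j)))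
        - (?E (occupancy G (Suc j)) - ?E (occupancy G (Suc (Suc j)))) = 0"
      using depart_prob N_pos by simp
    then show ?thesis by (simp add: c_def algebra_simps)
  qed
  have c_const: "c j = c 0" for j by (induction j) (simp_all add: c_Suc)
  have d0: "(\<lambda>j. ?E (dispatch_mass j)) \<longlonglongrightarrow> 0"
  proof (rule tendsto_sandwich[OF _ _ tendsto_const expectation_occupancy_tendsto_0])
    show "\<forall>\<^sub>F j in sequentially. 0 \<le> ?E (dispatch_mass j)"
      using dispatch_mass_bounds by (intro always_eventually allI Bochner_Integration.integral_nonneg) auto
    show "\<forall>\<^sub>F j in sequentially. ?E (dispatch_mass j) \<le> ?E (occupancy G j)"
      using dispatch_mass_bounds integrable_dispatch_mass integrable_occupancy
      by (intro always_eventually allI integral_mono) auto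
  qed
  have "c \<longlonglongrightarrow> lam * 0 - 0"
    unfolding c_def using LIMSEQ_Suc[OF expectation_occupancy_tendsto_0]
    by (intro tendsto_intros d0)
  moreover have "c \<longlonglongrightarrow> c 0"
    by (rule tendsto_eventually, rule always_eventually, rule allI, rule c_const)
  ultimately have "c 0 = 0" using LIMSEQ_unique by fastforce
  then show ?thesis using c_const[of j] by (simp add: c_def)
qed

text \<open>Since \<open>dispatch_mass\<close> is at most the occupancy, flow balance loses a factor
  \<open>lam\<close> per level. The bound is uniform in the graph.\<close>

lemma expectation_occupancy_le:
  assumes inv: "bind_pmf \<pi> queue_kernel = \<pi>"
  shows "measure_pmf.expectation \<pi> (occupancy G i) \<le> lam ^ i"
proof (induction i)
  case 0
  show ?case by (simp add: occupancy_0)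
next
  case (Suc i)
  have "measure_pmf.expectation \<pi> (dispatch_mass i) \<le> measure_pmf.expectation \<pi> (occupancy G i)"
    using dispatch_mass_bounds integrable_dispatch_mass integrable_occupancy by (intro integral_mono) auto
  also have "\<dots> \<le> lam ^ i" by (rule Suc)
  finally show ?case using lam by (simp add: expectation_occupancy_Suc[OF inv])
qed

text \<open>Applies to the stationary law and to the product law alike; the finite means make the
  cost of a coupling finite.\<close>

lemma nn_integral_total:
  assumes "\<And>i. measure_pmf.expectation \<pi> (occupancy G i) \<le> lam ^ i"
  shows "(\<integral>\<^sup>+x. of_nat (total x) \<partial>measure_pmf \<pi>) < \<infinity>"
proof -
  have tot: "of_nat (total x) = (\<Sum>i. ennreal (N * occupancy G (Suc i) x))" for x
  proof -
    have "real (total x) = (\<Sum>v\<in>V. \<Sum>i<total x. indicator {Suc i..} (x v))"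
    proof -
      have "real (x v) = (\<Sum>i<total x. indicator {Suc i..} (x v))" if "v \<in> V" for v
      proof -
        have "x v \<le> total x" unfolding total_def using that V(1) by (intro member_le_sum) auto
        then have "{..<total x} \<inter> {i. Suc i \<le> x v} = {..<x v}" by auto
        then show ?thesis by (simp add: indicator_def)
      qed
      then show ?thesis by (simp add: total_def)
    qed
    also have "\<dots> = (\<Sum>i<total x. N * occupancy G (Suc i) x)"
      unfolding occupancy_sum using N_pos by (subst sum.swap) simp
    finally have "ennreal (real (total x)) = (\<Sum>i<total x. ennreal (N * occupancy G (Suc i) x))"
      using N_pos occupancy_bounds by (subst sum_ennreal) auto
    also have "\<dots> = (\<Sum>i. ennreal (N * occupancy G (Suc i) x))"
    proof (rule suminf_finite[symmetric])
      fix i assume "i \<notin> {..<total x}"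
      have "x v \<le> total x" if "v \<in> V" for v
        unfolding total_def using that V(1) by (intro member_le_sum) auto
      then have e: "{v \<in> V. Suc i \<le> x v} = {}" using \<open>i \<notin> {..<total x}\<close> by force
      show "ennreal (N * occupancy G (Suc i) x) = 0" unfolding occupancy_def e by simp
    qed simp
    finally show ?thesis by (simp add: ennreal_of_nat_eq_real_of_nat)
  qed
  have "(\<integral>\<^sup>+x. of_nat (total x) \<partial>measure_pmf \<pi>) = (\<Sum>i. \<integral>\<^sup>+x. ennreal (N * occupancy G (Suc i) x) \<partial>measure_pmf \<pi>)"
    unfolding tot by (rule nn_integral_suminf) simp
  also have "\<dots> = (\<Sum>i. ennreal (N * measure_pmf.expectation \<pi> (occupancy G (Suc i))))"
    using N_pos occupancy_bounds integrable_occupancy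
    by (intro suminf_cong) (subst nn_integral_eq_integral, auto)
  also have "\<dots> \<le> (\<Sum>i. ennreal (N * lam ^ Suc i))"
    using N_pos by (intro suminf_le ennreal_leI mult_left_mono assms) auto
  also have "\<dots> = ennreal (\<Sum>i. N * lam ^ Suc i)"
    using lam N_pos by (intro suminf_ennreal2 summable_mult) (auto intro!: summable_mult summable_geometric)
  finally show ?thesis by (rule le_less_trans) simp
qed

section \<open>The product chain\<close>

abbreviation "qs \<equiv> qstar lam d"

lemma qs_0: "qs 0 = 1"
  using lam by (simp add: qstar_def)

text \<open>The flow balance \<open>expectation_occupancy_Suc\<close> for occupancies that are
  deterministic and equal in all neighbourhoods.\<close>

lemma qs_Suc: "qs (Suc i) = lam * qs i ^ d"
proof -
  define e where "e = (real d ^ i - 1) / (real d - 1)"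
  have "(real d ^ Suc i - 1) / (real d - 1) = real d * e + 1"
    using d by (simp add: e_def field_simps)
  moreover have "(lam powr e) ^ d = lam powr (real d * e)"
    using lam by (simp add: powr_powr powr_realpow[symmetric] mult.commute)
  ultimately show ?thesis
    using lam by (simp add: qstar_def e_def[symmetric] powr_add mult.commute)
qed

lemma qs_pos: "0 < qs i"
  using lam by (simp add: qstar_def)

lemma qs_le_1: "qs i \<le> 1"
proof (induction i)
  case (Suc i)
  have "lam * qs i ^ d \<le> 1 * 1" using lam Suc qs_pos[of i] by (intro mult_mono power_le_one) auto
  then show ?case by (simp add: qs_Suc)
qed (simp add: qs_0)

lemma qs_Suc_le: "qs (Suc i) \<le> lam * qs i"
proof -
  have "qs i ^ d \<le> qs i ^ 1" using d qs_le_1[of i] qs_pos[of i] by (intro power_decreasing) auto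
  then show ?thesis using lam by (simp add: qs_Suc)
qed

lemma qs_le_power: "qs i \<le> lam ^ i"
proof (induction i)
  case (Suc i)
  have "qs (Suc i) \<le> lam * qs i" by (rule qs_Suc_le)
  also have "\<dots> \<le> lam * lam ^ i" using lam Suc by (intro mult_left_mono) auto
  finally show ?case by simp
qed (simp add: qs_0)

lemma qs_Suc_le': "qs (Suc i) \<le> qs i"
proof -
  have "qs (Suc i) \<le> lam * qs i" by (rule qs_Suc_le)
  also have "\<dots> \<le> 1 * qs i" using lam qs_pos[of i] by (intro mult_right_mono) auto
  finally show ?thesis by simp
qed

lemma qs_tendsto_0: "qs \<longlonglongrightarrow> 0"
  by (rule tendsto_sandwich[OF _ _ tendsto_const LIMSEQ_realpow_zero[of lam]])
     (use lam qs_le_power qs_pos in \<open>auto intro: less_imp_le always_eventually\<close>)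

definition queue_law :: "nat pmf" where
  "queue_law = embed_pmf (\<lambda>k. qs k - qs (Suc k))"

lemma pmf_queue_law: "pmf queue_law k = qs k - qs (Suc k)"
  unfolding queue_law_def
proof (rule pmf_embed_pmf)
  have "(\<lambda>k. qs k - qs (Suc k)) sums (qs 0 - 0)"
    by (rule telescope_sums'[OF qs_tendsto_0])
  then show "(\<integral>\<^sup>+k. ennreal (qs k - qs (Suc k)) \<partial>count_space UNIV) = 1"
    using qs_Suc_le' by (simp add: nn_integral_count_space_nat suminf_ennreal2 sums_iff qs_0)
qed (use qs_Suc_le' in auto)

lemma prob_queue_law_ge: "measure_pmf.prob queue_law {k..} = qs k"
proof -
  have "measure_pmf.prob queue_law {k..} = 1 - measure_pmf.prob queue_law {..<k}"
    using measure_pmf.prob_compl[of "{..<k}" queue_law] by (simp add: Compl_eq_Diff_UNIV[symmetric] Compl_lessThan)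
  also have "measure_pmf.prob queue_law {..<k} = (\<Sum>j<k. qs j - qs (Suc j))"
    by (simp add: measure_measure_pmf_finite pmf_queue_law)
  also have "\<dots> = 1 - qs k"
    by (simp add: sum_lessThan_telescope' qs_0)
  finally show ?thesis by simp
qed

text \<open>
  This makes \<open>queue_law\<close> reversible for \<open>server_kernel\<close>. In equilibrium, a server of queue length
  \<open>k\<close> gets arrivals at rate \<open>lam * (qs k ^ d - qs (Suc k) ^ d) / (qs k - qs (Suc k))\<close>.
\<close>

definition accept :: "nat \<Rightarrow> real" where
  "accept k = power_quotient (qs k) (qs (Suc k)) / d"

lemma power_quotient_bounds:
  assumes "0 \<le> a" "a \<le> 1" "0 \<le> b" "b \<le> 1"
  shows "0 \<le> power_quotient a b" "power_quotient a b \<le> d"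
proof -
  show "0 \<le> power_quotient a b"
    unfolding power_quotient_def using assms by (intro sum_nonneg mult_nonneg_nonneg) auto
  have "b ^ i * a ^ j \<le> 1" for i j
    using assms by (simp add: mult_le_one power_le_one)
  then have "power_quotient a b \<le> (\<Sum>i<d. 1)"
    unfolding power_quotient_def by (intro sum_mono)
  then show "power_quotient a b \<le> d" by simp
qed

lemma accept_bounds: "0 \<le> accept k" "accept k \<le> 1"
  using power_quotient_bounds[of "qs k" "qs (Suc k)"] qs_pos[of k] qs_pos[of "Suc k"] qs_le_1[of k] qs_le_1[of "Suc k"] d
  by (auto simp: accept_def divide_le_eq_1)

text \<open>Detailed balance between the lengths \<open>k\<close> and \<open>Suc k\<close>: by the
  choice of \<open>accept\<close> and by \<open>qs_Suc\<close>, both sides equal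
  \<open>depart_prob * lam * (qs k ^ d - qs (Suc k) ^ d)\<close>.\<close>

lemma queue_law_balance:
  "pmf queue_law k * ((1 - depart_prob) * accept k) = pmf queue_law (Suc k) * depart_prob"
proof -
  have "pmf queue_law k * ((1 - depart_prob) * accept k)
     = (1 - depart_prob) / d * ((qs k - qs (Suc k)) * power_quotient (qs k) (qs (Suc k)))"
    by (simp add: pmf_queue_law accept_def)
  also have "\<dots> = depart_prob * (lam * (qs k ^ d - qs (Suc k) ^ d))"
    unfolding depart_prob(3) power_quotient by simp
  also have "\<dots> = pmf queue_law (Suc k) * depart_prob"
    by (simp add: pmf_queue_law qs_Suc[of k] qs_Suc[of "Suc k"] algebra_simps)
  finally show ?thesis .
qed

definition server_kernel :: "nat \<Rightarrow> nat pmf" where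
  "server_kernel k = bernoulli_pmf depart_prob \<bind>
     (\<lambda>b. if b then return_pmf (k - 1) else map_pmf (\<lambda>a. if a then Suc k else k) (bernoulli_pmf (accept k)))"

lemma pmf_server_kernel:
  "pmf (server_kernel k) j = depart_prob * indicator {k - 1} j
     + (1 - depart_prob) * (accept k * indicator {Suc k} j + (1 - accept k) * indicator {k} j)"
  using depart_prob accept_bounds[of k]
  by (simp add: server_kernel_def pmf_bind map_pmf_def less_imp_le) (simp add: indicator_def)

lemma server_kernel_reversible:
  "pmf queue_law k * pmf (server_kernel k) j = pmf queue_law j * pmf (server_kernel j) k"
proof -
  consider "j = k" | "j = Suc k" | "k = Suc j" | "j \<noteq> k" "j \<noteq> Suc k" "k \<noteq> Suc j" by blast
  then show ?thesis
  proof cases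
    case 2
    then show ?thesis using queue_law_balance[of k] by (simp add: pmf_server_kernel)
  next
    case 3
    then show ?thesis using queue_law_balance[of j] by (simp add: pmf_server_kernel)
  next
    case 4
    have "j \<noteq> k - 1 \<or> k = 0 \<and> j = 0" "k \<noteq> j - 1 \<or> k = 0 \<and> j = 0" using 4 by auto
    then show ?thesis using 4 by (auto simp: pmf_server_kernel indicator_def)
  qed simp
qed

lemma bind_server_kernel: "bind_pmf queue_law server_kernel = queue_law"
proof (rule pmf_eqI)
  fix j
  have "ennreal (pmf (bind_pmf queue_law server_kernel) j)
     = (\<integral>\<^sup>+k. ennreal (pmf queue_law k * pmf (server_kernel k) j) \<partial>count_space UNIV)"
    by (simp add: ennreal_pmf_bind nn_integral_measure_pmf ennreal_mult')
  also have "\<dots> = (\<integral>\<^sup>+k. ennreal (pmf queue_law j) * ennreal (pmf (server_kernel j) k) \<partial>count_space UNIV)"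
    by (subst server_kernel_reversible) (simp add: ennreal_mult')
  also have "\<dots> = ennreal (pmf queue_law j)"
    by (simp add: nn_integral_cmult nn_integral_pmf)
  finally show "pmf (bind_pmf queue_law server_kernel) j = pmf queue_law j" by simp
qed

definition product_law :: "('v \<Rightarrow> nat) pmf" where
  "product_law = Pi_pmf V 0 (\<lambda>_. queue_law)"

definition indep_target :: "('v \<Rightarrow> nat) \<Rightarrow> 'v option pmf" where
  "indep_target y = pmf_of_set V \<bind> (\<lambda>v. map_pmf (\<lambda>a. if a then Some v else None) (bernoulli_pmf (accept (y v))))"

text \<open>Given the other coordinates, coordinate \<open>v\<close> has the law
  \<open>queue_law\<close>, which \<open>server_kernel\<close> preserves.\<close>

lemma bind_product_law_coordinate:
  assumes v: "v \<in> V"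
  shows "bind_pmf product_law (\<lambda>y. map_pmf (\<lambda>k. y(v := k)) (server_kernel (y v))) = product_law"
proof -
  define V' where "V' = V - {v}"
  have V': "V = insert v V'" "finite V'" "v \<notin> V'" using v V by (auto simp: V'_def)
  define P where "P = Pi_pmf V' 0 (\<lambda>_. queue_law)"
  have eq: "product_law = bind_pmf queue_law (\<lambda>k. bind_pmf P (\<lambda>f. return_pmf (f(v := k))))"
    unfolding product_law_def P_def V'(1) by (rule Pi_pmf_insert'[OF V'(2,3)])
  have "bind_pmf product_law (\<lambda>y. map_pmf (\<lambda>k. y(v := k)) (server_kernel (y v)))
    = bind_pmf queue_law (\<lambda>k0. bind_pmf P (\<lambda>f. bind_pmf (server_kernel k0) (\<lambda>k. return_pmf (f(v := k)))))"
    unfolding eq by (simp add: bind_assoc_pmf bind_return_pmf map_pmf_def)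
  also have "\<dots> = bind_pmf queue_law (\<lambda>k0. bind_pmf (server_kernel k0) (\<lambda>k. bind_pmf P (\<lambda>f. return_pmf (f(v := k)))))"
    by (subst bind_commute_pmf) simp
  also have "\<dots> = bind_pmf (bind_pmf queue_law server_kernel) (\<lambda>k. bind_pmf P (\<lambda>f. return_pmf (f(v := k))))"
    by (simp add: bind_assoc_pmf)
  finally show ?thesis unfolding bind_server_kernel eq[symmetric] .
qed

text \<open>Departures and potential arrivals both choose their server uniformly, so this choice can
  be made first; what remains is \<open>server_kernel\<close> at that server.\<close>

lemma step_indep_target:
  "step_pmf indep_target y = pmf_of_set V \<bind> (\<lambda>v. map_pmf (\<lambda>k. y(v := k)) (server_kernel (y v)))"
proof -
  have "step_pmf indep_target y = bernoulli_pmf depart_prob \<bind> (\<lambda>b. pmf_of_set V \<bind> (\<lambda>v.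
      if b then return_pmf (depart y v)
      else map_pmf (\<lambda>a. if a then y(v := Suc (y v)) else y) (bernoulli_pmf (accept (y v)))))"
    unfolding step_pmf_def indep_target_def
    by (intro bind_pmf_cong refl)
       (auto simp: map_bind_pmf map_pmf_comp map_pmf_def[of "depart y"] if_distrib[of "arrive y"] cong: if_cong
         intro!: bind_pmf_cong map_pmf_cong)
  also have "\<dots> = pmf_of_set V \<bind> (\<lambda>v. bernoulli_pmf depart_prob \<bind> (\<lambda>b.
      if b then return_pmf (depart y v)
      else map_pmf (\<lambda>a. if a then y(v := Suc (y v)) else y) (bernoulli_pmf (accept (y v)))))"
    by (rule bind_commute_pmf)
  also have "\<dots> = pmf_of_set V \<bind> (\<lambda>v. map_pmf (\<lambda>k. y(v := k)) (server_kernel (y v)))"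
    unfolding server_kernel_def map_bind_pmf
    by (intro bind_pmf_cong refl) (auto simp: map_pmf_comp intro!: map_pmf_cong)
  finally show ?thesis .
qed

lemma bind_product_law: "bind_pmf product_law (step_pmf indep_target) = product_law"
proof -
  have "bind_pmf product_law (step_pmf indep_target)
    = pmf_of_set V \<bind> (\<lambda>v. bind_pmf product_law (\<lambda>y. map_pmf (\<lambda>k. y(v := k)) (server_kernel (y v))))"
    unfolding step_indep_target by (rule bind_commute_pmf)
  also have "\<dots> = pmf_of_set V \<bind> (\<lambda>v. product_law)"
    using V by (intro bind_pmf_cong refl bind_product_law_coordinate) simp
  finally show ?thesis by simp
qed

section \<open>Local occupancies under the product law\<close>

lemma prob_product_law_ge:
  assumes "A \<subseteq> V"
  shows "measure_pmf.prob product_law {y. \<forall>v\<in>A. k \<le> y v} = qs k ^ card A"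
proof -
  have "{y. \<forall>v\<in>A. k \<le> y v} = Pi V (\<lambda>v. if v \<in> A then {k..} else UNIV)"
    using assms by (auto simp: Pi_def)
  then have "measure_pmf.prob product_law {y. \<forall>v\<in>A. k \<le> y v}
    = (\<Prod>v\<in>V. measure_pmf.prob queue_law (if v \<in> A then {k..} else UNIV))"
    unfolding product_law_def using V(1) by (simp add: measure_Pi_pmf_Pi)
  also have "\<dots> = (\<Prod>v\<in>V. if v \<in> A then qs k else 1)"
    by (intro prod.cong refl) (simp add: prob_queue_law_ge)
  also have "\<dots> = (\<Prod>v\<in>V \<inter> A. qs k)"
    using V(1) by (simp add: prod.inter_restrict[symmetric])
  finally show ?thesis using assms by (simp add: Int_absorb1)
qed

lemma integrable_local_occ: "integrable (measure_pmf p) (local_occ w k)"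
  using local_occ_bounds by (intro integrable_pmf_bounded[of _ 1]) (simp add: abs_le_iff)

lemma expectation_local_occ:
  assumes w: "w \<in> W"
  shows "measure_pmf.expectation product_law (local_occ w k) = qs k"
proof -
  have "measure_pmf.expectation product_law (\<lambda>y. indicator {k..} (y v)) = qs k" if "v \<in> nbh w" for v
  proof -
    have "(\<lambda>y. indicator {k..} (y v) :: real) = indicator {y. \<forall>u\<in>{v}. k \<le> y u}"
      by (auto simp: indicator_def)
    then have "measure_pmf.expectation product_law (\<lambda>y. indicator {k..} (y v)) = measure_pmf.prob product_law {y. \<forall>u\<in>{v}. k \<le> y u}"
      by simp
    then show ?thesis using prob_product_law_ge[of "{v}" k] that nbh_subset[of w] by auto
  qed
  then have "measure_pmf.expectation product_law (local_occ w k) = (\<Sum>v\<in>nbh w. qs k) / deg w"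
    unfolding local_occ_sum[abs_def]
    by (subst integral_divide_zero, subst Bochner_Integration.integral_sum)
       (auto intro!: integrable_pmf_bounded[of _ 1])
  then show ?thesis using deg_pos[OF w] by (simp add: card_nbh)
qed

lemma variance_local_occ:
  assumes w: "w \<in> W"
  shows "measure_pmf.expectation product_law (\<lambda>y. (local_occ w k y - qs k)\<^sup>2) \<le> qs k / deg w"
proof -
  let ?E = "measure_pmf.expectation product_law"
  define I where "I = (\<lambda>v (y :: 'v \<Rightarrow> nat). indicator {k..} (y v) :: real)"
  have int: "integrable (measure_pmf product_law) (\<lambda>y. I u y * I v y)" for u v
    by (rule integrable_pmf_bounded[of _ 1]) (auto simp: I_def split: split_indicator)
  have EI: "?E (\<lambda>y. I u y * I v y) = (if u = v then qs k else (qs k)\<^sup>2)" if "u \<in> nbh w" "v \<in> nbh w" for u v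
  proof -
    have "(\<lambda>y. I u y * I v y) = indicator {y. \<forall>r\<in>{u, v}. k \<le> y r}"
      by (auto simp: I_def indicator_def)
    then have "?E (\<lambda>y. I u y * I v y) = measure_pmf.prob product_law {y. \<forall>r\<in>{u, v}. k \<le> y r}"
      by simp
    also have "\<dots> = qs k ^ card {u, v}"
      using that nbh_subset[of w] by (intro prob_product_law_ge) auto
    finally show ?thesis by (auto simp: power2_eq_square)
  qed
  have sq: "(local_occ w k y)\<^sup>2 = (\<Sum>u\<in>nbh w. \<Sum>v\<in>nbh w. I u y * I v y) / (deg w)\<^sup>2" for y
    by (simp add: local_occ_sum I_def power_divide power2_eq_square sum_product)
  have "?E (\<lambda>y. (local_occ w k y)\<^sup>2) = (\<Sum>u\<in>nbh w. \<Sum>v\<in>nbh w. ?E (\<lambda>y. I u y * I v y)) / (deg w)\<^sup>2"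
    unfolding sq using int by (simp add: Bochner_Integration.integral_sum)
  also have "(\<Sum>u\<in>nbh w. \<Sum>v\<in>nbh w. ?E (\<lambda>y. I u y * I v y))
      = (\<Sum>u\<in>nbh w. \<Sum>v\<in>nbh w. (qs k)\<^sup>2 + (if u = v then qs k - (qs k)\<^sup>2 else 0))"
    by (intro sum.cong refl) (simp add: EI)
  also have "\<dots> = (deg w)\<^sup>2 * (qs k)\<^sup>2 + deg w * (qs k - (qs k)\<^sup>2)"
    using finite_nbh[of w] by (simp add: sum.distrib card_nbh power2_eq_square distrib_left)
  finally have E2: "?E (\<lambda>y. (local_occ w k y)\<^sup>2) = (qs k)\<^sup>2 + (qs k - (qs k)\<^sup>2) / deg w"
    using deg_pos[OF w] by (simp add: add_divide_distrib power2_eq_square)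
  have int2: "integrable (measure_pmf product_law) (\<lambda>y. (local_occ w k y)\<^sup>2)"
    using local_occ_bounds[of w k] by (intro integrable_pmf_bounded[of _ 1]) (simp add: power_le_one)
  have "?E (\<lambda>y. (local_occ w k y - qs k)\<^sup>2) = ?E (\<lambda>y. (local_occ w k y)\<^sup>2 - 2 * qs k * local_occ w k y + (qs k)\<^sup>2)"
    by (simp add: power2_diff algebra_simps)
  also have "\<dots> = ?E (\<lambda>y. (local_occ w k y)\<^sup>2) - 2 * qs k * qs k + (qs k)\<^sup>2"
    using int2 integrable_local_occ by (simp add: expectation_local_occ[OF w])
  also have "\<dots> = (qs k - (qs k)\<^sup>2) / deg w"
    unfolding E2 by (simp add: power2_eq_square)
  also have "\<dots> \<le> qs k / deg w"
    using deg_pos[OF w] by (intro divide_right_mono) auto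
  finally show ?thesis .
qed

text \<open>Both cases of the weighted AM-GM inequality \<open>a b \<le> (s a\<^sup>2 + b\<^sup>2 / s) / 2\<close> with \<open>s = deg w powr (-1/2)\<close>.\<close>

lemma expectation_local_occ_mult_le:
  assumes w: "w \<in> W" and jk: "j \<le> k"
  shows "measure_pmf.expectation product_law (\<lambda>y. local_occ w j y * \<bar>local_occ w k y - qs k\<bar>) \<le> qs j / sqrt (deg w)"
proof -
  let ?E = "measure_pmf.expectation product_law"
  define s where "s = 1 / sqrt (deg w)"
  have s: "0 < s" "s\<^sup>2 = 1 / deg w" using deg_pos[OF w] by (auto simp: s_def power_divide)
  have b: "\<bar>local_occ w k y - qs k\<bar> \<le> 1" for y
    using local_occ_bounds[of w k y] qs_pos[of k] qs_le_1[of k] by (auto simp: abs_le_iff)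
  have qjk: "qs k \<le> qs j"
    using jk qs_Suc_le' by (rule lift_Suc_antimono_le[rotated])
  have int: "integrable (measure_pmf product_law) (\<lambda>y. (local_occ w k y - qs k)\<^sup>2)"
    using b by (intro integrable_pmf_bounded[of _ 1]) (simp add: abs_square_le_1)
  have "?E (\<lambda>y. local_occ w j y * \<bar>local_occ w k y - qs k\<bar>) \<le> ?E (\<lambda>y. s / 2 * local_occ w j y + (local_occ w k y - qs k)\<^sup>2 / (2 * s))"
  proof (rule integral_mono)
    show "integrable (measure_pmf product_law) (\<lambda>y. local_occ w j y * \<bar>local_occ w k y - qs k\<bar>)"
      using b local_occ_bounds[of w j] by (intro integrable_pmf_bounded[of _ 1]) (simp add: abs_mult mult_le_one)
    show "integrable (measure_pmf product_law) (\<lambda>y. s / 2 * local_occ w j y + (local_occ w k y - qs k)\<^sup>2 / (2 * s))"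
      using int integrable_local_occ by simp
    fix y
    define a where "a = local_occ w j y"
    define c where "c = \<bar>local_occ w k y - qs k\<bar>"
    have a: "0 \<le> a" "a * a \<le> a * 1"
      using local_occ_bounds[of w j y] mult_left_mono[of a 1 a] by (auto simp: a_def)
    have "0 \<le> (s * a - c)\<^sup>2" by simp
    then have "2 * s * (a * c) \<le> s\<^sup>2 * (a * a) + c\<^sup>2" by (simp add: power2_eq_square algebra_simps)
    also have "\<dots> \<le> s\<^sup>2 * a + c\<^sup>2" using a s by (intro add_right_mono mult_left_mono) auto
    finally have "a * c \<le> s / 2 * a + c\<^sup>2 / (2 * s)" using s by (simp add: field_simps power2_eq_square)
    then show "local_occ w j y * \<bar>local_occ w k y - qs k\<bar> \<le> s / 2 * local_occ w j y + (local_occ w k y - qs k)\<^sup>2 / (2 * s)"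
      by (simp add: a_def c_def)
  qed
  also have "\<dots> = s / 2 * qs j + ?E (\<lambda>y. (local_occ w k y - qs k)\<^sup>2) / (2 * s)"
    using int integrable_local_occ by (simp add: expectation_local_occ[OF w])
  also have "\<dots> \<le> s / 2 * qs j + (qs j / deg w) / (2 * s)"
  proof -
    have "?E (\<lambda>y. (local_occ w k y - qs k)\<^sup>2) \<le> qs k / deg w" by (rule variance_local_occ[OF w])
    also have "\<dots> \<le> qs j / deg w" using qjk by (intro divide_right_mono) auto
    finally show ?thesis using s by (intro add_left_mono divide_right_mono) auto
  qed
  also have "qs j / deg w = qs j * s\<^sup>2" by (simp add: s)
  also have "s / 2 * qs j + qs j * s\<^sup>2 / (2 * s) = qs j * s"
    using s(1) by (simp add: power2_eq_square field_simps)
  also have "\<dots> = qs j / sqrt (deg w)"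
    by (simp add: s_def)
  finally show ?thesis .
qed

lemma expectation_local_occ_diff_le:
  assumes w: "w \<in> W"
  shows "measure_pmf.expectation product_law (\<lambda>y. \<bar>local_occ w k y - qs k\<bar>) \<le> 1 / sqrt (deg w)"
proof -
  have "local_occ w 0 y = 1" for y
    using deg_pos[OF w] card_nbh[of w] by (simp add: local_occ_def)
  then show ?thesis
    using expectation_local_occ_mult_le[OF w, of 0 k] by (simp add: qs_0)
qed

section \<open>Distance between the two arrival rules\<close>

lemma power_quotient_diff:
  assumes "0 \<le> a" "a \<le> 1" "0 \<le> b" "b \<le> 1" "0 \<le> a'" "a' \<le> 1" "0 \<le> b'" "b' \<le> 1"
  shows "\<bar>power_quotient a b - power_quotient a' b'\<bar> \<le> (real d)\<^sup>2 * (\<bar>a - a'\<bar> + \<bar>b - b'\<bar>)"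
proof -
  have pd: "\<bar>x ^ m - y ^ m\<bar> \<le> real d * \<bar>x - y\<bar>" if "0 \<le> x" "x \<le> 1" "0 \<le> y" "y \<le> 1" "m \<le> d" for x y :: real and m
  proof -
    have "\<bar>x ^ m - y ^ m\<bar> \<le> real m * \<bar>x - y\<bar>"
      using norm_power_diff[of x y m] that by simp
    also have "\<dots> \<le> real d * \<bar>x - y\<bar>" using that by (intro mult_right_mono) auto
    finally show ?thesis .
  qed
  have "\<bar>b ^ (d - Suc i) * a ^ i - b' ^ (d - Suc i) * a' ^ i\<bar> \<le> real d * (\<bar>a - a'\<bar> + \<bar>b - b'\<bar>)" if "i < d" for i
  proof -
    have "b ^ (d - Suc i) * a ^ i - b' ^ (d - Suc i) * a' ^ i
       = b ^ (d - Suc i) * (a ^ i - a' ^ i) + (b ^ (d - Suc i) - b' ^ (d - Suc i)) * a' ^ i"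
      by (simp add: algebra_simps)
    also have "\<bar>\<dots>\<bar> \<le> \<bar>b ^ (d - Suc i)\<bar> * \<bar>a ^ i - a' ^ i\<bar> + \<bar>b ^ (d - Suc i) - b' ^ (d - Suc i)\<bar> * \<bar>a' ^ i\<bar>"
      by (rule order_trans[OF abs_triangle_ineq]) (simp add: abs_mult)
    also have "\<dots> \<le> 1 * (real d * \<bar>a - a'\<bar>) + (real d * \<bar>b - b'\<bar>) * 1"
      using assms that by (intro add_mono mult_mono pd) (auto simp: power_le_one)
    finally show ?thesis by (simp add: algebra_simps)
  qed
  then have "\<bar>power_quotient a b - power_quotient a' b'\<bar> \<le> (\<Sum>i<d. real d * (\<bar>a - a'\<bar> + \<bar>b - b'\<bar>))"
    unfolding power_quotient_def sum_subtractf[symmetric]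
    by (intro order_trans[OF sum_abs] sum_mono) auto
  then show ?thesis by (simp add: power2_eq_square)
qed

text \<open>The outcome \<open>None\<close> is omitted because its mass is determined by the rest;
  \<open>prob_maximal_coupling_neq\<close> allows for this.\<close>

definition target_error :: "('v \<Rightarrow> nat) \<Rightarrow> real" where
  "target_error y = (\<Sum>u\<in>V. \<bar>pmf (jsq_target y) (Some u) - pmf (indep_target y) (Some u)\<bar>)"

lemma pmf_jsq_target_Some: "pmf (jsq_target y) (Some u) = (\<Sum>w\<in>W. pmf (dispatch_pmf d G y w) u) / M / d"
proof -
  have "measure_pmf.expectation (dispatch_pmf d G y w) (\<lambda>v. indicator {Some u} (Some v)) = pmf (dispatch_pmf d G y w) u" for w
  proof -
    have "(\<lambda>v. indicator {Some u} (Some v) :: real) = indicator {u}" by (auto simp: indicator_def)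
    then show ?thesis by (simp add: measure_pmf_single)
  qed
  then show ?thesis
    unfolding pmf_eq_expectation expectation_jsq_target by simp
qed

lemma pmf_indep_target_Some:
  assumes "u \<in> V"
  shows "pmf (indep_target y) (Some u) = accept (y u) / N"
proof -
  have "pmf (map_pmf (\<lambda>a. if a then Some v else None) (bernoulli_pmf (accept (y v)))) (Some u) = (if v = u then accept (y u) else 0)" for v
    using accept_bounds by (auto simp: map_pmf_def pmf_bind indicator_def)
  then show ?thesis
    unfolding indep_target_def using V assms by (simp add: pmf_bind_pmf_of_set)
qed

text \<open>By \<open>sum_inverse_deg\<close> both rules give \<open>u\<close> a sum over its types
  with the same weights, of power quotients taken at the local occupancies in one case and at
  \<open>qs\<close> in the other. The factor \<open>d\<close> is the Lipschitz constant
  \<open>d\<^sup>2\<close> over the thinning \<open>d\<close>.\<close>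

lemma target_error_le:
  "target_error y \<le> real d / M * (\<Sum>w\<in>W. (\<Sum>u\<in>nbh w. \<bar>local_occ w (y u) y - qs (y u)\<bar>
      + \<bar>local_occ w (Suc (y u)) y - qs (Suc (y u))\<bar>) / deg w)"
proof -
  define g where "g = (\<lambda>u. power_quotient (qs (y u)) (qs (Suc (y u))))"
  define h where "h = (\<lambda>w u. power_quotient (local_occ w (y u) y) (local_occ w (Suc (y u)) y))"
  have "\<bar>pmf (jsq_target y) (Some u) - pmf (indep_target y) (Some u)\<bar>
     \<le> (\<Sum>w\<in>types_of u. \<bar>h w u - g u\<bar> / deg w) / (M * d)" if u: "u \<in> V" for u
  proof -
    have "(\<Sum>w\<in>W. pmf (dispatch_pmf d G y w) u) = (\<Sum>w\<in>types_of u. pmf (dispatch_pmf d G y w) u)"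
    proof (rule sum.mono_neutral_right)
      show "\<forall>w\<in>W - types_of u. pmf (dispatch_pmf d G y w) u = 0"
      proof
        fix w assume w: "w \<in> W - types_of u"
        then have "u \<notin> nbh w" using types_of_iff u by blast
        then show "pmf (dispatch_pmf d G y w) u = 0"
          using w set_dispatch_eq[of w y] by (auto simp: pmf_eq_0_set_pmf)
      qed
    qed (use W in \<open>auto simp: types_of_def\<close>)
    also have "\<dots> = (\<Sum>w\<in>types_of u. h w u / deg w)"
      using u types_of_iff[of _ u] by (intro sum.cong refl) (auto simp: pmf_dispatch h_def types_of_def)
    finally have j: "pmf (jsq_target y) (Some u) = (\<Sum>w\<in>types_of u. h w u / deg w) / (M * d)"
      by (simp add: pmf_jsq_target_Some)
    have "pmf (indep_target y) (Some u) = g u * (1 / N) / d"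
      by (simp add: pmf_indep_target_Some[OF u] accept_def g_def)
    also have "1 / N = (\<Sum>w\<in>types_of u. 1 / deg w) / M"
      using sum_inverse_deg[OF u] M_pos by simp
    finally have i: "pmf (indep_target y) (Some u) = (\<Sum>w\<in>types_of u. g u / deg w) / (M * d)"
      by (simp add: sum_distrib_left)
    have "\<bar>pmf (jsq_target y) (Some u) - pmf (indep_target y) (Some u)\<bar>
       = \<bar>\<Sum>w\<in>types_of u. (h w u - g u) / deg w\<bar> / (M * d)"
      unfolding i j by (simp add: diff_divide_distrib[symmetric] sum_subtractf[symmetric] abs_mult)
    also have "\<dots> \<le> (\<Sum>w\<in>types_of u. \<bar>(h w u - g u) / deg w\<bar>) / (M * d)"
      by (intro divide_right_mono sum_abs) auto
    finally show ?thesis by simp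
  qed
  then have "target_error y \<le> (\<Sum>u\<in>V. (\<Sum>w\<in>types_of u. \<bar>h w u - g u\<bar> / deg w) / (M * d))"
    unfolding target_error_def by (intro sum_mono)
  also have "\<dots> = (\<Sum>w\<in>W. \<Sum>u\<in>nbh w. \<bar>h w u - g u\<bar> / deg w) / (M * d)"
    unfolding sum_types_of by (simp add: sum_divide_distrib)
  also have "\<dots> \<le> (\<Sum>w\<in>W. \<Sum>u\<in>nbh w. (real d)\<^sup>2 * (\<bar>local_occ w (y u) y - qs (y u)\<bar>
      + \<bar>local_occ w (Suc (y u)) y - qs (Suc (y u))\<bar>) / deg w) / (M * d)"
    unfolding g_def h_def
    by (intro divide_right_mono sum_mono power_quotient_diff local_occ_bounds qs_le_1 less_imp_le[OF qs_pos]) auto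
  also have "\<dots> = real d / M * (\<Sum>w\<in>W. (\<Sum>u\<in>nbh w. \<bar>local_occ w (y u) y - qs (y u)\<bar>
      + \<bar>local_occ w (Suc (y u)) y - qs (Suc (y u))\<bar>) / deg w)"
    using d by (simp add: sum_distrib_left sum_divide_distrib power2_eq_square mult.commute[of M])
  finally show ?thesis .
qed

text \<open>Sort the neighbours by their queue length \<open>k\<close>; those of length exactly
  \<open>k\<close> are among those of length at least \<open>k\<close>.\<close>

lemma level_sum_le:
  fixes f :: "nat \<Rightarrow> real"
  assumes f: "\<And>k. 0 \<le> f k"
  shows "(\<Sum>u\<in>nbh w. f (y u)) / deg w \<le> (\<Sum>k\<le>total y. local_occ w k y * f k)"
proof -
  have "(\<Sum>u\<in>nbh w. f (y u)) \<le> (\<Sum>u\<in>nbh w. \<Sum>k\<le>total y. indicator {k..} (y u) * f k)"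
  proof (intro sum_mono)
    fix u assume "u \<in> nbh w"
    then have "u \<in> V" using nbh_subset by blast
    then have "y u \<le> total y" unfolding total_def using V(1) by (intro member_le_sum) auto
    then have "f (y u) = (\<Sum>k\<in>{y u}. indicator {k..} (y u) * f k)" by simp
    also have "\<dots> \<le> (\<Sum>k\<le>total y. indicator {k..} (y u) * f k)"
      using \<open>y u \<le> total y\<close> f by (intro sum_mono2) auto
    finally show "f (y u) \<le> (\<Sum>k\<le>total y. indicator {k..} (y u) * f k)" .
  qed
  also have "\<dots> = (\<Sum>k\<le>total y. (\<Sum>u\<in>nbh w. indicator {k..} (y u)) * f k)"
    by (subst sum.swap) (simp add: sum_distrib_right)
  finally have "(\<Sum>u\<in>nbh w. f (y u)) / deg w \<le> (\<Sum>k\<le>total y. (\<Sum>u\<in>nbh w. indicator {k..} (y u)) * f k) / deg w"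
    by (rule divide_right_mono) simp
  also have "\<dots> = (\<Sum>k\<le>total y. local_occ w k y * f k)"
    unfolding sum_divide_distrib[of _ "{..total y}"] by (simp add: local_occ_sum)
  finally show ?thesis .
qed

text \<open>Sorting by levels puts the factor \<open>local_occ w k\<close>, of mean
  \<open>qs k \<le> lam ^ k\<close>, next to the deviations at \<open>k\<close> and
  \<open>Suc k\<close>. Keeping this factor makes the series over all levels converge, with sum
  \<open>1 / (1 - lam)\<close>.\<close>

lemma nn_integral_level_error:
  assumes w: "w \<in> W"
  shows "(\<integral>\<^sup>+y. ennreal ((\<Sum>u\<in>nbh w. \<bar>local_occ w (y u) y - qs (y u)\<bar>
      + \<bar>local_occ w (Suc (y u)) y - qs (Suc (y u))\<bar>) / deg w) \<partial>product_law) \<le> ennreal (2 / (1 - lam) / sqrt (deg w))"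
proof -
  define F where "F = (\<lambda>k y. local_occ w k y * (\<bar>local_occ w k y - qs k\<bar> + \<bar>local_occ w (Suc k) y - qs (Suc k)\<bar>))"
  have F_nonneg: "0 \<le> F k y" for k y using local_occ_bounds by (simp add: F_def)
  have b: "\<bar>local_occ w k y - qs k\<bar> \<le> 1" for k y
    using local_occ_bounds[of w k y] qs_pos[of k] qs_le_1[of k] by (auto simp: abs_le_iff)
  have int: "integrable (measure_pmf product_law) (\<lambda>y. local_occ w j y * \<bar>local_occ w k y - qs k\<bar>)" for j k
    using b local_occ_bounds[of w j] by (intro integrable_pmf_bounded[of _ 1]) (simp add: abs_mult mult_le_one)
  have F_int: "integrable (measure_pmf product_law) (F k)" for k
    unfolding F_def distrib_left using int by simp
  have EF: "measure_pmf.expectation product_law (F k) \<le> 2 * qs k / sqrt (deg w)" for k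
  proof -
    have "measure_pmf.expectation product_law (F k)
      = measure_pmf.expectation product_law (\<lambda>y. local_occ w k y * \<bar>local_occ w k y - qs k\<bar>)
      + measure_pmf.expectation product_law (\<lambda>y. local_occ w k y * \<bar>local_occ w (Suc k) y - qs (Suc k)\<bar>)"
      unfolding F_def distrib_left using int by (intro Bochner_Integration.integral_add) auto
    also have "\<dots> \<le> qs k / sqrt (deg w) + qs k / sqrt (deg w)"
      by (intro add_mono expectation_local_occ_mult_le[OF w]) auto
    finally show ?thesis by simp
  qed
  have "(\<integral>\<^sup>+y. ennreal ((\<Sum>u\<in>nbh w. \<bar>local_occ w (y u) y - qs (y u)\<bar>
      + \<bar>local_occ w (Suc (y u)) y - qs (Suc (y u))\<bar>) / deg w) \<partial>product_law)
     \<le> (\<integral>\<^sup>+y. (\<Sum>k. ennreal (F k y)) \<partial>product_law)"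
  proof (rule nn_integral_mono)
    fix y
    have "ennreal ((\<Sum>u\<in>nbh w. \<bar>local_occ w (y u) y - qs (y u)\<bar> + \<bar>local_occ w (Suc (y u)) y - qs (Suc (y u))\<bar>) / deg w)
       \<le> ennreal (\<Sum>k\<le>total y. F k y)"
      unfolding F_def
      using level_sum_le[where f="\<lambda>k. \<bar>local_occ w k y - qs k\<bar> + \<bar>local_occ w (Suc k) y - qs (Suc k)\<bar>" and w=w and y=y]
      by (intro ennreal_leI) auto
    also have "\<dots> = (\<Sum>k\<le>total y. ennreal (F k y))" using F_nonneg by simp
    also have "\<dots> \<le> (\<Sum>k. ennreal (F k y))" by (rule sum_le_suminf) auto
    finally show "ennreal ((\<Sum>u\<in>nbh w. \<bar>local_occ w (y u) y - qs (y u)\<bar> + \<bar>local_occ w (Suc (y u)) y - qs (Suc (y u))\<bar>) / deg w)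
       \<le> (\<Sum>k. ennreal (F k y))" .
  qed
  also have "\<dots> = (\<Sum>k. ennreal (measure_pmf.expectation product_law (F k)))"
    using F_int F_nonneg by (subst nn_integral_suminf) (auto simp: nn_integral_eq_integral)
  also have "\<dots> \<le> (\<Sum>k. ennreal (2 / sqrt (deg w) * lam ^ k))"
  proof (intro suminf_le ennreal_leI)
    fix k
    have "2 * qs k / sqrt (deg w) \<le> 2 * lam ^ k / sqrt (deg w)"
      using qs_le_power[of k] by (intro divide_right_mono) auto
    then show "measure_pmf.expectation product_law (F k) \<le> 2 / sqrt (deg w) * lam ^ k"
      using EF[of k] by simp
  qed auto
  also have "\<dots> = ennreal (2 / sqrt (deg w) * (1 / (1 - lam)))"
    using lam sums_mult[OF geometric_sums[of lam], of "2 / sqrt (deg w)"]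
    by (subst suminf_ennreal2) (auto simp: sums_iff)
  finally show ?thesis by (simp add: mult.commute)
qed

text \<open>By Cauchy-Schwarz, the fluctuation \<open>1 / sqrt (deg w)\<close> of single types turns
  into a function of \<open>graph_gamma\<close>.\<close>

lemma average_inverse_sqrt_deg: "(\<Sum>w\<in>W. 1 / sqrt (deg w)) / M \<le> sqrt (graph_gamma G)"
proof (rule real_le_rsqrt)
  have "(\<Sum>w\<in>W. 1 / sqrt (deg w))\<^sup>2 \<le> (\<Sum>w\<in>W. 1\<^sup>2) * (\<Sum>w\<in>W. (1 / sqrt (deg w))\<^sup>2)"
    using Cauchy_Schwarz_ineq_sum[of "\<lambda>_. 1" "\<lambda>w. 1 / sqrt (deg w)" W] by simp
  also have "\<dots> = M * (\<Sum>w\<in>W. 1 / deg w)"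
    by (simp add: power_divide)
  finally have "(\<Sum>w\<in>W. 1 / sqrt (deg w))\<^sup>2 / M\<^sup>2 \<le> M * (\<Sum>w\<in>W. 1 / deg w) / M\<^sup>2"
    by (rule divide_right_mono) simp
  then show "((\<Sum>w\<in>W. 1 / sqrt (deg w)) / M)\<^sup>2 \<le> graph_gamma G"
    using M_pos by (simp add: graph_gamma_def power_divide power2_eq_square)
qed

lemma nn_integral_target_error:
  "(\<integral>\<^sup>+y. ennreal (target_error y) \<partial>product_law) \<le> ennreal (2 * real d / (1 - lam) * sqrt (graph_gamma G))"
proof -
  define T where "T = (\<lambda>w y. (\<Sum>u\<in>nbh w. \<bar>local_occ w (y u) y - qs (y u)\<bar>
      + \<bar>local_occ w (Suc (y u)) y - qs (Suc (y u))\<bar>) / deg w)"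
  have T: "0 \<le> T w y" for w y
    unfolding T_def by (intro divide_nonneg_nonneg sum_nonneg) auto
  have "(\<integral>\<^sup>+y. ennreal (target_error y) \<partial>product_law) \<le> (\<integral>\<^sup>+y. (\<Sum>w\<in>W. ennreal (real d / M) * ennreal (T w y)) \<partial>product_law)"
  proof (rule nn_integral_mono)
    fix y
    have "ennreal (target_error y) \<le> ennreal (\<Sum>w\<in>W. real d / M * T w y)"
      using target_error_le[of y] by (intro ennreal_leI) (simp add: T_def sum_distrib_left)
    also have "\<dots> = (\<Sum>w\<in>W. ennreal (real d / M) * ennreal (T w y))"
    proof -
      have "ennreal (real d / M) * ennreal (T w y) = ennreal (real d / M * T w y)" for w
        using T by (intro ennreal_mult[symmetric]) auto
      then show ?thesis using T by (simp only:) (intro sum_ennreal[symmetric], simp)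
    qed
    finally show "ennreal (target_error y) \<le> (\<Sum>w\<in>W. ennreal (real d / M) * ennreal (T w y))" .
  qed
  also have "\<dots> = (\<Sum>w\<in>W. ennreal (real d / M) * (\<integral>\<^sup>+y. ennreal (T w y) \<partial>product_law))"
    by (simp add: nn_integral_sum nn_integral_cmult)
  also have "\<dots> \<le> (\<Sum>w\<in>W. ennreal (real d / M) * ennreal (2 / (1 - lam) / sqrt (deg w)))"
    unfolding T_def by (intro sum_mono mult_left_mono nn_integral_level_error) auto
  also have "\<dots> = ennreal (\<Sum>w\<in>W. real d / M * (2 / (1 - lam) / sqrt (deg w)))"
  proof -
    have "ennreal (real d / M) * ennreal (2 / (1 - lam) / sqrt (deg w)) = ennreal (real d / M * (2 / (1 - lam) / sqrt (deg w)))" for w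
      using lam by (intro ennreal_mult[symmetric]) auto
    then show ?thesis using lam by (simp only:) (intro sum_ennreal, simp)
  qed
  also have "\<dots> \<le> ennreal (2 * real d / (1 - lam) * sqrt (graph_gamma G))"
  proof (rule ennreal_leI)
    have "(\<Sum>w\<in>W. real d / M * (2 / (1 - lam) / sqrt (deg w))) = 2 * real d / (1 - lam) * ((\<Sum>w\<in>W. 1 / sqrt (deg w)) / M)"
      unfolding sum_divide_distrib sum_distrib_left by (intro sum.cong refl) (simp add: field_simps)
    also have "\<dots> \<le> 2 * real d / (1 - lam) * sqrt (graph_gamma G)"
      using lam by (intro mult_left_mono average_inverse_sqrt_deg) auto
    finally show "(\<Sum>w\<in>W. real d / M * (2 / (1 - lam) / sqrt (deg w))) \<le> 2 * real d / (1 - lam) * sqrt (graph_gamma G)" .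
  qed
  finally show ?thesis .
qed

section \<open>The coupled chain\<close>

text \<open>The truncated subtractions make \<open>disc j\<close> ignore the tasks up to level \<open>j\<close>.\<close>

definition disc :: "nat \<Rightarrow> ('v \<Rightarrow> nat) \<Rightarrow> ('v \<Rightarrow> nat) \<Rightarrow> real" where
  "disc j x y = (\<Sum>v\<in>V. \<bar>real (x v - j) - real (y v - j)\<bar>)"

definition mismatch :: "nat \<Rightarrow> ('v \<Rightarrow> nat) \<Rightarrow> ('v \<Rightarrow> nat) \<Rightarrow> 'v set" where
  "mismatch j x y = {v \<in> V. (j \<le> x v) \<noteq> (j \<le> y v)}"

lemma disc_fun_upd_pair:
  "v \<in> V \<Longrightarrow> disc j (x(v := a)) (y(v := b)) = disc j x y
     + (\<bar>real (a - j) - real (b - j)\<bar> - \<bar>real (x v - j) - real (y v - j)\<bar>)"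
  unfolding disc_def by (rule sum_fun_upd_pair[of v "\<lambda>a b. \<bar>real (a - j) - real (b - j)\<bar>"])

lemma disc_nonneg: "0 \<le> disc j x y"
  unfolding disc_def by (intro sum_nonneg) auto

lemma disc_triangle: "disc j x z \<le> disc j x y + disc j y z"
proof -
  have "\<bar>a - c\<bar> \<le> \<bar>a - b\<bar> + \<bar>b - c\<bar>" for a b c :: real
    using abs_triangle_ineq[of "a - b" "b - c"] by simp
  then show ?thesis
    unfolding disc_def sum.distrib[symmetric] by (intro sum_mono)
qed

lemma disc_refl: "disc j x x = 0"
  by (simp add: disc_def)

lemma disc_commute: "disc j x y = disc j y x"
  by (simp add: disc_def abs_minus_commute)

lemma disc_le_total: "disc j x y \<le> real (total x) + real (total y)"
proof -
  have "disc j x y \<le> (\<Sum>v\<in>V. real (x v) + real (y v))"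
    unfolding disc_def by (intro sum_mono) auto
  then show ?thesis by (simp add: total_def sum.distrib)
qed

lemma disc_depart:
  assumes "v \<in> V"
  shows "disc j (depart x v) (depart y v) = disc j x y - indicator (mismatch (Suc j) x y) v"
proof -
  have "\<bar>real (a - 1 - j) - real (b - 1 - j)\<bar> - \<bar>real (a - j) - real (b - j)\<bar> = - (if (Suc j \<le> a) \<noteq> (Suc j \<le> b) then 1 else 0)" for a b :: nat
  proof (cases "Suc j \<le> a"; cases "Suc j \<le> b")
    assume "Suc j \<le> a" "Suc j \<le> b"
    then obtain a' b' where "a = Suc j + a'" "b = Suc j + b'" by (metis le_add_diff_inverse)
    then show ?thesis by simp
  next
    assume 1: "Suc j \<le> a" "\<not> Suc j \<le> b"
    then obtain a' where "a = Suc j + a'" by (metis le_add_diff_inverse)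
    then show ?thesis using 1 by simp
  next
    assume 1: "\<not> Suc j \<le> a" "Suc j \<le> b"
    then obtain b' where "b = Suc j + b'" by (metis le_add_diff_inverse)
    then show ?thesis using 1 by simp
  qed simp
  then show ?thesis
    using assms disc_fun_upd_pair[OF assms, of j x "x v - 1" y "y v - 1"]
    by (auto simp: mismatch_def indicator_def)
qed

lemma abs_diff_Suc_left:
  "\<bar>real (Suc a - j) - real (b - j)\<bar> = \<bar>real (a - j) - real (b - j)\<bar> + (if a < j then 0 else if b \<le> a then 1 else - 1)"
proof (cases "a < j")
  case False
  then obtain a' where a: "a = j + a'" by (metis le_add_diff_inverse not_less)
  show ?thesis
  proof (cases "b \<le> a")
    case True
    then have "b - j \<le> a'" using a by auto
    then have "real (b - j) \<le> real a'" by simp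
    then show ?thesis using True a by (simp add: abs_if)
  next
    case False
    then obtain b' where "b = Suc (j + a') + b'" using a by (metis le_add_diff_inverse not_less_eq_eq)
    then show ?thesis using False a by simp
  qed
qed simp

lemma disc_arrive_left:
  "u \<in> V \<Longrightarrow> disc j (x(u := x u + 1)) y = disc j x y + (if x u < j then 0 else if y u \<le> x u then 1 else - 1)"
  using disc_fun_upd_pair[of u j x "x u + 1" y "y u"] abs_diff_Suc_left[of "x u" j "y u"] by simp

lemma disc_arrive_right:
  "u \<in> V \<Longrightarrow> disc j x (y(u := y u + 1)) = disc j x y + (if y u < j then 0 else if x u \<le> y u then 1 else - 1)"
  using disc_arrive_left[of u j y x] by (simp only: disc_commute[of j x])

text \<open>
  Two joins of shortest queues among the same sample increase the discrepancy only if the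
  sample contains a mismatch: an increase at both \<open>u\<close> and \<open>v\<close> would force all four queue lengths
  to be equal, but then \<open>u\<close> and \<open>v\<close> are shortest for both configurations.
\<close>

lemma disc_arrive_both:
  assumes A: "A \<subseteq> V" and u: "u \<in> shortest x A" and v: "v \<in> shortest y A"
    and tie: "u = v \<or> u \<notin> shortest y A \<or> v \<notin> shortest x A"
  shows "disc j (x(u := x u + 1)) (y(v := y v + 1)) \<le> disc j x y + indicator {s. s \<inter> mismatch j x y \<noteq> {}} A"
proof -
  have uA: "u \<in> A" "v \<in> A" using u v by (auto simp: shortest_def)
  then have uV: "u \<in> V" "v \<in> V" using A by auto
  have min: "x u \<le> x v" "y v \<le> y u" using u v uA by (auto simp: shortest_def)
  show ?thesis
  proof (cases "u = v")
    case True
    have eq: "disc j (x(u := x u + 1)) (y(v := y v + 1))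
       = disc j x y + (if x u < j then 0 else if y u \<le> x u then 1 else - 1)
          + (if y u < j then 0 else if x u + 1 \<le> y u then 1 else - 1)"
      unfolding True[symmetric] disc_arrive_right[OF uV(1)] disc_arrive_left[OF uV(1)] by simp
    have "u \<in> mismatch j x y" if "(x u < j) \<noteq> (y u < j)"
      using that uV by (auto simp: mismatch_def)
    then show ?thesis unfolding eq using uA(1) by (auto simp: indicator_def)
  next
    case False
    have eq: "disc j (x(u := x u + 1)) (y(v := y v + 1))
       = disc j x y + (if x u < j then 0 else if y u \<le> x u then 1 else - 1)
          + (if y v < j then 0 else if x v \<le> y v then 1 else - 1)"
      unfolding disc_arrive_right[OF uV(2)] disc_arrive_left[OF uV(1)] using False by simp
    have notboth: "\<not> (y u \<le> x u \<and> x v \<le> y v)"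
    proof
      assume "y u \<le> x u \<and> x v \<le> y v"
      then have "x u = x v" "y u = y v" using min by auto
      then have "u \<in> shortest y A" "v \<in> shortest x A" using u v uA by (auto simp: shortest_def)
      then show False using tie False by blast
    qed
    \<comment> \<open>Without a mismatch in \<open>A\<close>, the lengths \<open>x u\<close> and
      \<open>y v\<close> lie on the same side of \<open>j\<close>: both servers being shortest, a
      crossing would show at \<open>v\<close> or at \<open>u\<close>. Below \<open>j\<close> nothing
      changes, and above it \<open>notboth\<close> makes one of the two changes negative.\<close>
    have mv: "v \<in> mismatch j x y" if "j \<le> x u" "y v < j"
      using that min uV by (auto simp: mismatch_def)
    have mu: "u \<in> mismatch j x y" if "x u < j" "j \<le> y v"
      using that min uV by (auto simp: mismatch_def)
    show ?thesis
    proof (cases "A \<inter> mismatch j x y = {}")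
      case True
      then have "(x u < j) = (y v < j)" using mv mu uA by (metis disjoint_iff not_le)
      then show ?thesis unfolding eq using notboth True by auto
    next
      case nonempty: False
      then show ?thesis unfolding eq using notboth by auto
    qed
  qed
qed

abbreviation "add_task x u \<equiv> x(u := x u + (1 :: nat))"

text \<open>A common sample, with ties broken alike as often as possible. Independent tie-breaking
  would fail the condition \<open>tie\<close> of \<open>disc_arrive_both\<close>: even equal
  configurations could be driven apart.\<close>

definition coupled_dispatch :: "('v \<Rightarrow> nat) \<Rightarrow> ('v \<Rightarrow> nat) \<Rightarrow> 'w \<Rightarrow> ('v \<times> 'v) pmf" where
  "coupled_dispatch x y w = sample w \<bind>
     (\<lambda>s. maximal_coupling (pmf_of_set (shortest x (set s))) (pmf_of_set (shortest y (set s))))"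

definition coupled_kernel :: "('v \<Rightarrow> nat) \<Rightarrow> ('v \<Rightarrow> nat) \<Rightarrow> (('v \<Rightarrow> nat) \<times> ('v \<Rightarrow> nat)) pmf" where
  "coupled_kernel x y = bernoulli_pmf depart_prob \<bind>
     (\<lambda>b. if b then map_pmf (\<lambda>v. (depart x v, depart y v)) (pmf_of_set V)
       else bernoulli_pmf (1 / d) \<bind> (\<lambda>a. if a
         then pmf_of_set W \<bind> (\<lambda>w. map_pmf (\<lambda>(u, v). (add_task x u, add_task y v)) (coupled_dispatch x y w))
         else return_pmf (x, y)))"

lemma depart_fun: "depart x = (\<lambda>v. x(v := x v - 1))"
  by (simp add: fun_eq_iff)

lemma shortest_pmf_facts:
  assumes "w \<in> W" "s \<in> set_pmf (sample w)"
  shows "finite (shortest x (set s))" "shortest x (set s) \<noteq> {}" "set_pmf (pmf_of_set (shortest x (set s))) = shortest x (set s)"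
  using set_sample[OF assms] shortest_nonempty[of "set s" x]
  by (auto intro!: finite_shortest simp: set_shortest_pmf[OF assms])

lemma map_coupled_dispatch:
  assumes w: "w \<in> W"
  shows "map_pmf fst (coupled_dispatch x y w) = dispatch_pmf d G x w"
    "map_pmf snd (coupled_dispatch x y w) = dispatch_pmf d G y w"
  unfolding coupled_dispatch_def map_bind_pmf dispatch_pmf_shortest
  by (intro bind_pmf_cong refl maximal_coupling; simp add: shortest_pmf_facts[OF w])+

lemma set_coupled_dispatch:
  assumes w: "w \<in> W"
  shows "set_pmf (coupled_dispatch x y w) \<subseteq> nbh w \<times> nbh w"
proof
  fix r assume r: "r \<in> set_pmf (coupled_dispatch x y w)"
  then have "fst r \<in> set_pmf (map_pmf fst (coupled_dispatch x y w))" "snd r \<in> set_pmf (map_pmf snd (coupled_dispatch x y w))"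
    by auto
  then show "r \<in> nbh w \<times> nbh w"
    unfolding map_coupled_dispatch[OF w] set_dispatch_eq[OF w] by (cases r) auto
qed

lemma finite_coupled_dispatch: "w \<in> W \<Longrightarrow> finite (set_pmf (coupled_dispatch x y w))"
  using finite_subset[OF set_coupled_dispatch] finite_nbh by auto

lemma map_arrive_jsq_target:
  "map_pmf (arrive x) (jsq_target x) = bernoulli_pmf (1 / d) \<bind> (\<lambda>a. if a
     then pmf_of_set W \<bind> (\<lambda>w. map_pmf (add_task x) (dispatch_pmf d G x w)) else return_pmf x)"
  unfolding jsq_target_def map_bind_pmf
  by (intro bind_pmf_cong refl) (auto simp: map_bind_pmf map_pmf_comp)

lemma map_coupled_kernel:
  "map_pmf fst (coupled_kernel x y) = queue_kernel x"
  "map_pmf snd (coupled_kernel x y) = queue_kernel y"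
proof -
  have W': "w \<in> W" if "w \<in> set_pmf (pmf_of_set W)" for w using that W by simp
  have 1: "map_pmf fst (map_pmf (\<lambda>(u, v). (add_task x u, add_task y v)) (coupled_dispatch x y w))
     = map_pmf (add_task x) (dispatch_pmf d G x w)" if "w \<in> W" for w
    unfolding map_coupled_dispatch(1)[OF that, of x y, symmetric] by (simp add: map_pmf_comp split_beta')
  have 2: "map_pmf snd (map_pmf (\<lambda>(u, v). (add_task x u, add_task y v)) (coupled_dispatch x y w))
     = map_pmf (add_task y) (dispatch_pmf d G y w)" if "w \<in> W" for w
    unfolding map_coupled_dispatch(2)[OF that, of x y, symmetric] by (simp add: map_pmf_comp split_beta')
  have 3: "map_pmf f (bernoulli_pmf (1 / d) \<bind> (\<lambda>a. if a then pmf_of_set W \<bind> A else return_pmf r))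
     = bernoulli_pmf (1 / d) \<bind> (\<lambda>a. if a then pmf_of_set W \<bind> B else return_pmf (f r))"
    if "\<And>w. w \<in> W \<Longrightarrow> map_pmf f (A w) = B w" for f :: "('v \<Rightarrow> nat) \<times> ('v \<Rightarrow> nat) \<Rightarrow> 'v \<Rightarrow> nat" and A B r
    unfolding map_bind_pmf using that W'
    by (intro bind_pmf_cong refl) (auto simp: map_bind_pmf intro!: bind_pmf_cong)
  show "map_pmf fst (coupled_kernel x y) = queue_kernel x"
    unfolding coupled_kernel_def step_pmf_def map_bind_pmf
  proof (intro bind_pmf_cong refl)
    fix b
    show "map_pmf fst (if b then map_pmf (\<lambda>v. (depart x v, depart y v)) (pmf_of_set V)
       else bernoulli_pmf (1 / d) \<bind> (\<lambda>a. if a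
         then pmf_of_set W \<bind> (\<lambda>w. map_pmf (\<lambda>(u, v). (add_task x u, add_task y v)) (coupled_dispatch x y w))
         else return_pmf (x, y)))
      = (if b then map_pmf (depart x) (pmf_of_set V) else map_pmf (arrive x) (jsq_target x))"
      unfolding map_arrive_jsq_target using 3[where f=fst and r="(x, y)" and A="\<lambda>w. map_pmf (\<lambda>(u, v). (add_task x u, add_task y v)) (coupled_dispatch x y w)"
          and B="\<lambda>w. map_pmf (add_task x) (dispatch_pmf d G x w)", OF 1, unfolded fst_conv] by (simp add: map_pmf_comp depart_fun)
  qed
  show "map_pmf snd (coupled_kernel x y) = queue_kernel y"
    unfolding coupled_kernel_def step_pmf_def map_bind_pmf
  proof (intro bind_pmf_cong refl)
    fix b
    show "map_pmf snd (if b then map_pmf (\<lambda>v. (depart x v, depart y v)) (pmf_of_set V)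
       else bernoulli_pmf (1 / d) \<bind> (\<lambda>a. if a
         then pmf_of_set W \<bind> (\<lambda>w. map_pmf (\<lambda>(u, v). (add_task x u, add_task y v)) (coupled_dispatch x y w))
         else return_pmf (x, y)))
      = (if b then map_pmf (depart y) (pmf_of_set V) else map_pmf (arrive y) (jsq_target y))"
      unfolding map_arrive_jsq_target using 3[where f=snd and r="(x, y)" and A="\<lambda>w. map_pmf (\<lambda>(u, v). (add_task x u, add_task y v)) (coupled_dispatch x y w)"
          and B="\<lambda>w. map_pmf (add_task y) (dispatch_pmf d G y w)", OF 2, unfolded snd_conv] by (simp add: map_pmf_comp depart_fun)
  qed
qed

lemma finite_coupled_kernel: "finite (set_pmf (coupled_kernel x y))"
proof (rule finite_subset)
  show "set_pmf (coupled_kernel x y) \<subseteq> set_pmf (queue_kernel x) \<times> set_pmf (queue_kernel y)"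
    unfolding map_coupled_kernel[of x y, symmetric] by force
  show "finite (set_pmf (queue_kernel x) \<times> set_pmf (queue_kernel y))"
    using V by (simp add: set_step_pmf finite_jsq_target)
qed

lemma expectation_coupled_kernel:
  fixes f :: "('v \<Rightarrow> nat) \<times> ('v \<Rightarrow> nat) \<Rightarrow> real"
  shows "measure_pmf.expectation (coupled_kernel x y) f = depart_prob * ((\<Sum>v\<in>V. f (depart x v, depart y v)) / N)
    + (1 - depart_prob) * ((\<Sum>w\<in>W. measure_pmf.expectation (coupled_dispatch x y w)
        (\<lambda>r. f (add_task x (fst r), add_task y (snd r)))) / M / d + (1 - 1 / d) * f (x, y))"
proof -
  define A where "A = (\<lambda>w. map_pmf (\<lambda>(u, v). (add_task x u, add_task y v)) (coupled_dispatch x y w))"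
  have W': "finite (set_pmf (pmf_of_set W))" using W by simp
  have fin: "finite (set_pmf (A w))" if "w \<in> set_pmf (pmf_of_set W)" for w
    using that finite_coupled_dispatch W by (simp add: A_def)
  have fin2: "finite (set_pmf (pmf_of_set W \<bind> A))" using fin W' by simp
  have EA: "measure_pmf.expectation (pmf_of_set W \<bind> A) f
     = (\<Sum>w\<in>W. measure_pmf.expectation (coupled_dispatch x y w) (\<lambda>r. f (add_task x (fst r), add_task y (snd r)))) / M"
    using W by (subst expectation_bind_finite[OF W' fin]) (auto simp: integral_pmf_of_set A_def split_beta')
  have fin3: "finite (set_pmf (bernoulli_pmf (1 / d) \<bind> (\<lambda>a. if a then pmf_of_set W \<bind> A else return_pmf (x, y))))"
    using fin2 by auto
  have EB: "measure_pmf.expectation (bernoulli_pmf (1 / d) \<bind> (\<lambda>a. if a then pmf_of_set W \<bind> A else return_pmf (x, y))) f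
     = measure_pmf.expectation (pmf_of_set W \<bind> A) f / d + (1 - 1 / d) * f (x, y)"
    by (subst expectation_bind_finite) (use d fin2 in auto)
  show ?thesis
    unfolding coupled_kernel_def A_def[symmetric]
    by (subst expectation_bind_finite) (use V fin3 depart_prob in \<open>auto simp: EA EB integral_pmf_of_set\<close>)
qed

lemma sum_indicator_real: "finite A \<Longrightarrow> (\<Sum>v\<in>A. indicator B v :: real) = real (card (A \<inter> B))"
  by (induction A rule: finite_induct) (auto simp: Int_insert_left)

text \<open>By \<open>disc_arrive_both\<close> the discrepancy grows by at most one, and only if one
  of the \<open>d\<close> sampled servers is a mismatch; the union bound gives the factor
  \<open>d\<close>.\<close>

lemma expectation_coupled_dispatch:
  assumes w: "w \<in> W"
  shows "measure_pmf.expectation (coupled_dispatch x y w) (\<lambda>r. disc j (add_task x (fst r)) (add_task y (snd r)))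
    \<le> disc j x y + d * ((\<Sum>v\<in>nbh w. indicator (mismatch j x y) v) / deg w)"
proof -
  let ?f = "\<lambda>r. disc j (add_task x (fst r)) (add_task y (snd r))"
  let ?C = "\<lambda>s. maximal_coupling (pmf_of_set (shortest x (set s))) (pmf_of_set (shortest y (set s)))"
  have C: "fst r \<in> shortest x (set s) \<and> snd r \<in> shortest y (set s) \<and>
      (fst r = snd r \<or> fst r \<notin> shortest y (set s) \<or> snd r \<notin> shortest x (set s))"
    if s: "s \<in> set_pmf (sample w)" and r: "r \<in> set_pmf (?C s)" for s r
  proof -
    note facts = shortest_pmf_facts[OF w s]
    have fin: "finite (set_pmf (pmf_of_set (shortest x (set s))))" for x by (simp add: facts)
    have "fst r \<in> set_pmf (map_pmf fst (?C s))" "snd r \<in> set_pmf (map_pmf snd (?C s))" using r by auto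
    then have 1: "fst r \<in> shortest x (set s)" "snd r \<in> shortest y (set s)"
      by (simp_all add: maximal_coupling(1,2)[OF fin fin] facts)
    have "fst r = snd r \<or> pmf (pmf_of_set (shortest y (set s))) (fst r) < pmf (pmf_of_set (shortest x (set s))) (fst r)
       \<and> pmf (pmf_of_set (shortest x (set s))) (snd r) < pmf (pmf_of_set (shortest y (set s))) (snd r)"
      using maximal_coupling(3)[OF fin fin, of "fst r" "snd r" x y] r by simp
    \<comment> \<open>If the first server were also shortest for \<open>y\<close> and the second
      also shortest for \<open>x\<close>, the two strict inequalities between the uniform weights
      would contradict each other.\<close>
    then show ?thesis
      using 1 by (auto simp: facts pmf_of_set indicator_def)
  qed
  have finC: "finite (set_pmf (?C s))" if s: "s \<in> set_pmf (sample w)" for s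
  proof (rule finite_subset)
    show "set_pmf (?C s) \<subseteq> shortest x (set s) \<times> shortest y (set s)" using C[OF s] by (auto simp: mem_Times_iff)
    show "finite (shortest x (set s) \<times> shortest y (set s))" by (simp add: shortest_pmf_facts[OF w s])
  qed
  have "measure_pmf.expectation (coupled_dispatch x y w) ?f
     = measure_pmf.expectation (sample w) (\<lambda>s. measure_pmf.expectation (?C s) ?f)"
    unfolding coupled_dispatch_def by (rule expectation_bind_finite[OF finite_sample[OF w] finC])
  also have "\<dots> \<le> measure_pmf.expectation (sample w) (\<lambda>s. disc j x y + indicator {s. set s \<inter> mismatch j x y \<noteq> {}} s)"
  proof (rule integral_mono_AE)
    show "AE s in measure_pmf (sample w). measure_pmf.expectation (?C s) ?f \<le> disc j x y + indicator {s. set s \<inter> mismatch j x y \<noteq> {}} s"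
    proof (rule AE_pmfI)
      fix s assume s: "s \<in> set_pmf (sample w)"
      have sV: "set s \<subseteq> V" using set_sample[OF w s] nbh_subset[of w] by auto
      show "measure_pmf.expectation (?C s) ?f \<le> disc j x y + indicator {s. set s \<inter> mismatch j x y \<noteq> {}} s"
      proof (rule measure_pmf.integral_le_const)
        show "integrable (measure_pmf (?C s)) ?f" by (rule integrable_measure_pmf_finite[OF finC[OF s]])
        show "AE r in measure_pmf (?C s). ?f r \<le> disc j x y + indicator {s. set s \<inter> mismatch j x y \<noteq> {}} s"
        proof (rule AE_pmfI)
          fix r assume "r \<in> set_pmf (?C s)"
          from C[OF s this] show "?f r \<le> disc j x y + indicator {s. set s \<inter> mismatch j x y \<noteq> {}} s"
            using disc_arrive_both[OF sV, of "fst r" x "snd r" y j] by (simp add: indicator_def)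
        qed
      qed
    qed
  qed (auto intro: integrable_measure_pmf_finite finite_sample[OF w])
  also have "\<dots> = disc j x y + measure_pmf.prob (sample w) {s. set s \<inter> mismatch j x y \<noteq> {}}"
    by (subst Bochner_Integration.integral_add) (auto intro: integrable_measure_pmf_finite finite_sample[OF w])
  also have "\<dots> \<le> disc j x y + d * measure_pmf.prob (pmf_of_set (nbh w)) (mismatch j x y)"
    using emeasure_replicate_pmf_meets[of d "pmf_of_set (nbh w)" "mismatch j x y"]
    by (simp add: measure_pmf.emeasure_eq_measure ennreal_of_nat_eq_real_of_nat ennreal_mult'[symmetric])
  also have "measure_pmf.prob (pmf_of_set (nbh w)) (mismatch j x y) = (\<Sum>v\<in>nbh w. indicator (mismatch j x y) v) / deg w"
    using nbh_nonempty[OF w] finite_nbh[of w] by (simp add: measure_pmf_of_set card_nbh sum_indicator_real)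
  finally show ?thesis .
qed

text \<open>In units of \<open>depart_prob / N\<close>, each mismatch at level \<open>Suc j\<close>
  is reduced by its departures at rate 1. Each mismatch at level \<open>j\<close> meets arriving
  samples at rate at most \<open>lam * d\<close>, by the union bound averaged over the
  types.\<close>

lemma expectation_disc:
  "measure_pmf.expectation (coupled_kernel x y) (\<lambda>r. disc j (fst r) (snd r))
     \<le> disc j x y + depart_prob / N * (lam * d * card (mismatch j x y) - card (mismatch (Suc j) x y))"
proof -
  have ind: "(\<Sum>v\<in>V. indicator (mismatch j x y) v) = real (card (mismatch j x y))" for j
  proof -
    have "V \<inter> mismatch j x y = mismatch j x y" by (auto simp: mismatch_def)
    then show ?thesis using V(1) by (simp add: sum_indicator_real)
  qed
  have dep: "(\<Sum>v\<in>V. disc j (depart x v) (depart y v)) / N = disc j x y - card (mismatch (Suc j) x y) / N"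
    using N_pos by (simp add: disc_depart sum_subtractf ind diff_divide_distrib del: depart.simps)
  have "(\<Sum>w\<in>W. measure_pmf.expectation (coupled_dispatch x y w) (\<lambda>r. disc j (add_task x (fst r)) (add_task y (snd r)))) / M
    \<le> (\<Sum>w\<in>W. disc j x y + d * ((\<Sum>v\<in>nbh w. indicator (mismatch j x y) v) / deg w)) / M"
    by (intro divide_right_mono sum_mono expectation_coupled_dispatch) auto
  also have "\<dots> = disc j x y + d * ((\<Sum>w\<in>W. (\<Sum>v\<in>nbh w. indicator (mismatch j x y) v) / deg w) / M)"
    using M_pos by (simp add: sum.distrib add_divide_distrib sum_distrib_left)
  also have "\<dots> = disc j x y + d * (card (mismatch j x y) / N)"
    unfolding average_over_types ind ..
  finally have arr: "(\<Sum>w\<in>W. measure_pmf.expectation (coupled_dispatch x y w) (\<lambda>r. disc j (add_task x (fst r)) (add_task y (snd r)))) / M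
    \<le> disc j x y + d * (card (mismatch j x y) / N)" .
  have "measure_pmf.expectation (coupled_kernel x y) (\<lambda>r. disc j (fst r) (snd r))
     = depart_prob * ((\<Sum>v\<in>V. disc j (depart x v) (depart y v)) / N)
    + (1 - depart_prob) * ((\<Sum>w\<in>W. measure_pmf.expectation (coupled_dispatch x y w)
        (\<lambda>r. disc j (add_task x (fst r)) (add_task y (snd r)))) / M / d + (1 - 1 / d) * disc j x y)"
    using expectation_coupled_kernel[of x y "\<lambda>r. disc j (fst r) (snd r)"] by simp
  also have "\<dots> \<le> depart_prob * (disc j x y - card (mismatch (Suc j) x y) / N)
    + (1 - depart_prob) * ((disc j x y + d * (card (mismatch j x y) / N)) / d + (1 - 1 / d) * disc j x y)"
    unfolding dep using depart_prob arr
    by (intro add_left_mono mult_left_mono add_right_mono divide_right_mono) auto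
  also have "\<dots> = disc j x y - depart_prob * card (mismatch (Suc j) x y) / N + (1 - depart_prob) / d * d * card (mismatch j x y) / N"
  proof -
    have "(D + real d * c) / d + (1 - 1 / d) * D = D + c" for D c :: real
      using d by (simp add: field_simps)
    moreover have "(1 - depart_prob) / d * d = 1 - depart_prob" using d by simp
    ultimately show ?thesis by (simp only:) (simp add: algebra_simps)
  qed
  also have "\<dots> = disc j x y + depart_prob / N * (lam * d * card (mismatch j x y) - card (mismatch (Suc j) x y))"
    unfolding depart_prob(3) by (simp add: right_diff_distrib diff_divide_distrib mult_ac)
  finally show ?thesis .
qed

text \<open>
  The weights \<open>(1 / (2 d)) ^ j\<close> decrease so fast that the decrease of \<open>disc j\<close> by mismatches at
  level \<open>Suc j\<close> absorbs the increase of \<open>disc (Suc j)\<close> which they cause.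
\<close>

definition cost :: "nat \<Rightarrow> ('v \<Rightarrow> nat) \<Rightarrow> ('v \<Rightarrow> nat) \<Rightarrow> real" where
  "cost J x y = (\<Sum>j\<le>J. (1 / (2 * real d)) ^ j * disc j x y)"

lemma cost_nonneg: "0 \<le> cost J x y"
  unfolding cost_def by (intro sum_nonneg mult_nonneg_nonneg disc_nonneg) auto

lemma cost_triangle: "cost J x z \<le> cost J x y + cost J y z"
proof -
  have "cost J x z \<le> (\<Sum>j\<le>J. (1 / (2 * real d)) ^ j * (disc j x y + disc j y z))"
    unfolding cost_def by (intro sum_mono mult_left_mono disc_triangle) auto
  then show ?thesis by (simp add: cost_def distrib_left sum.distrib)
qed

lemma sum_weights: "(\<Sum>j\<le>J. (1 / (2 * real d)) ^ j) \<le> 2"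
proof -
  have "(\<Sum>j\<le>J. (1 / (2 * real d)) ^ j) \<le> (\<Sum>j\<le>J. (1 / 2) ^ j)"
    using d by (intro sum_mono power_mono) (auto simp: field_simps)
  also have "\<dots> \<le> (\<Sum>j. (1 / 2) ^ j)"
    by (intro sum_le_suminf summable_geometric) auto
  also have "\<dots> = 2" by (simp add: suminf_geometric)
  finally show ?thesis .
qed

lemma cost_le:
  assumes "\<And>j. disc j x y \<le> B" "0 \<le> B"
  shows "cost J x y \<le> 2 * B"
proof -
  have "cost J x y \<le> (\<Sum>j\<le>J. (1 / (2 * real d)) ^ j * B)"
    unfolding cost_def using assms by (intro sum_mono mult_left_mono) auto
  also have "\<dots> \<le> 2 * B"
    unfolding sum_distrib_right[symmetric] using assms sum_weights by (intro mult_right_mono) auto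
  finally show ?thesis .
qed

text \<open>No server is mismatched at level 0, so nothing enters from below. Then half of the
  decrease at one level pays for the increase at the next, as
  \<open>lam * d / (2 * d) \<le> 1 / 2\<close>; the other half is left over at the last level
  \<open>J\<close>.\<close>

lemma weighted_mismatch_le:
  "(\<Sum>j\<le>J. (1 / (2 * real d)) ^ j * (lam * d * card (mismatch j x y) - card (mismatch (Suc j) x y)))
    \<le> - (1 / 2) * (1 / (2 * real d)) ^ J * card (mismatch (Suc J) x y)"
proof (induction J)
  case 0
  have "mismatch 0 x y = {}" by (auto simp: mismatch_def)
  then show ?case by simp
next
  case (Suc J)
  have "(1 / (2 * real d)) ^ Suc J * (lam * d) \<le> (1 / 2) * (1 / (2 * real d)) ^ J"
    using lam d by (simp add: field_simps)
  then have "(1 / (2 * real d)) ^ Suc J * (lam * d) * card (mismatch (Suc J) x y)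
     \<le> (1 / 2) * (1 / (2 * real d)) ^ J * card (mismatch (Suc J) x y)"
    by (rule mult_right_mono) simp
  moreover have "0 \<le> (1 / (2 * real d)) ^ Suc J * card (mismatch (Suc (Suc J)) x y)" by simp
  ultimately show ?case using Suc by (simp only: sum.atMost_Suc right_diff_distrib mult.assoc)
qed

lemma expectation_cost:
  "measure_pmf.expectation (coupled_kernel x y) (\<lambda>r. cost J (fst r) (snd r))
     + depart_prob / (2 * N) * (1 / (2 * real d)) ^ J * card (mismatch (Suc J) x y) \<le> cost J x y"
proof -
  have "measure_pmf.expectation (coupled_kernel x y) (\<lambda>r. cost J (fst r) (snd r))
    = (\<Sum>j\<le>J. (1 / (2 * real d)) ^ j * measure_pmf.expectation (coupled_kernel x y) (\<lambda>r. disc j (fst r) (snd r)))"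
    unfolding cost_def
    by (subst Bochner_Integration.integral_sum) (auto intro: integrable_measure_pmf_finite[OF finite_coupled_kernel])
  also have "\<dots> \<le> (\<Sum>j\<le>J. (1 / (2 * real d)) ^ j * (disc j x y + depart_prob / N * (lam * d * card (mismatch j x y) - card (mismatch (Suc j) x y))))"
    by (intro sum_mono mult_left_mono expectation_disc) auto
  also have "\<dots> = cost J x y + depart_prob / N * (\<Sum>j\<le>J. (1 / (2 * real d)) ^ j * (lam * d * card (mismatch j x y) - card (mismatch (Suc j) x y)))"
    by (simp add: cost_def distrib_left sum.distrib sum_distrib_left mult_ac)
  also have "\<dots> \<le> cost J x y + depart_prob / N * (- (1 / 2) * (1 / (2 * real d)) ^ J * card (mismatch (Suc J) x y))"
    using depart_prob N_pos by (intro add_left_mono mult_left_mono weighted_mismatch_le) auto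
  finally show ?thesis by (simp add: mult_ac)
qed

text \<open>One step from the same state under both kernels, with common departures. Only the
  arrival targets can differ, and they do so as rarely as possible.\<close>

definition replaced_kernel :: "('v \<Rightarrow> nat) \<Rightarrow> (('v \<Rightarrow> nat) \<times> ('v \<Rightarrow> nat)) pmf" where
  "replaced_kernel y = bernoulli_pmf depart_prob \<bind>
     (\<lambda>b. if b then map_pmf (\<lambda>v. (depart y v, depart y v)) (pmf_of_set V)
       else map_pmf (\<lambda>(r, r'). (arrive y r, arrive y r')) (maximal_coupling (jsq_target y) (indep_target y)))"

lemma set_indep_target: "set_pmf (indep_target y) \<subseteq> insert None (Some ` V)"
  using V by (auto simp: indep_target_def split: if_splits)

lemma finite_indep_target: "finite (set_pmf (indep_target y))"
  using finite_subset[OF set_indep_target] V by simp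

lemma map_replaced_kernel:
  "map_pmf fst (replaced_kernel y) = queue_kernel y"
  "map_pmf snd (replaced_kernel y) = step_pmf indep_target y"
proof -
  note mc = maximal_coupling[OF finite_jsq_target[of y] finite_indep_target[of y]]
  have 1: "map_pmf (arrive y) (jsq_target y) = map_pmf (\<lambda>r. arrive y (fst r)) (maximal_coupling (jsq_target y) (indep_target y))"
    using mc(1) by (metis map_pmf_comp)
  have 2: "map_pmf (arrive y) (indep_target y) = map_pmf (\<lambda>r. arrive y (snd r)) (maximal_coupling (jsq_target y) (indep_target y))"
    using mc(2) by (metis map_pmf_comp)
  show "map_pmf fst (replaced_kernel y) = queue_kernel y"
    unfolding replaced_kernel_def step_pmf_def map_bind_pmf 1
    by (intro bind_pmf_cong refl) (auto simp: map_pmf_comp split_beta' depart_fun)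
  show "map_pmf snd (replaced_kernel y) = step_pmf indep_target y"
    unfolding replaced_kernel_def step_pmf_def map_bind_pmf 2
    by (intro bind_pmf_cong refl) (auto simp: map_pmf_comp split_beta' depart_fun)
qed

lemma disc_arrive_le: "r \<in> insert None (Some ` V) \<Longrightarrow> disc j (arrive y r) y \<le> 1"
  by (auto simp: disc_refl disc_arrive_left simp del: fun_upd_apply One_nat_def add_Suc_right)

text \<open>Different targets leave every \<open>disc j\<close> at most 2, and the weights add up to
  at most 2; this is the constant 4.\<close>

lemma nn_integral_replaced_kernel:
  "(\<integral>\<^sup>+r. ennreal (cost J (fst r) (snd r)) \<partial>replaced_kernel y) \<le> ennreal (4 * target_error y)"
proof -
  let ?mc = "maximal_coupling (jsq_target y) (indep_target y)"
  note mc = maximal_coupling[OF finite_jsq_target[of y] finite_indep_target[of y]]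
  have c0: "cost J z z = 0" for z by (simp add: cost_def disc_refl)
  have err: "measure_pmf.prob ?mc {r. fst r \<noteq> snd r} \<le> target_error y"
  proof -
    have "measure_pmf.prob ?mc {r. fst r \<noteq> snd r}
      \<le> (\<Sum>u\<in>insert None (Some ` V) - {None}. \<bar>pmf (jsq_target y) u - pmf (indep_target y) u\<bar>)"
      using V set_indep_target by (intro prob_maximal_coupling_neq) (auto simp: set_jsq_target)
    also have "insert None (Some ` V) - {None} = Some ` V" by auto
    finally show ?thesis by (simp add: target_error_def sum.reindex)
  qed
  have pt: "ennreal (cost J (arrive y (fst r)) (arrive y (snd r))) \<le> 4 * indicator {r. fst r \<noteq> snd r} r"
    if r: "r \<in> set_pmf ?mc" for r
  proof (cases "fst r = snd r")
    case False
    have "fst r \<in> set_pmf (map_pmf fst ?mc)" "snd r \<in> set_pmf (map_pmf snd ?mc)" using r by auto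
    then have mem: "fst r \<in> insert None (Some ` V)" "snd r \<in> insert None (Some ` V)"
      unfolding mc(1,2) using set_indep_target by (auto simp: set_jsq_target)
    have "disc j (arrive y (fst r)) (arrive y (snd r)) \<le> 2" for j
      using disc_triangle[of j "arrive y (fst r)" "arrive y (snd r)" y] disc_arrive_le[OF mem(1), of j y]
        disc_arrive_le[OF mem(2), of j y] disc_commute[of j y "arrive y (snd r)"] by linarith
    then have "cost J (arrive y (fst r)) (arrive y (snd r)) \<le> 2 * 2" by (rule cost_le) simp
    then have "ennreal (cost J (arrive y (fst r)) (arrive y (snd r))) \<le> ennreal 4" by (intro ennreal_leI) simp
    then show ?thesis using False by simp
  qed (simp add: c0)
  have "(\<integral>\<^sup>+r. ennreal (cost J (fst r) (snd r)) \<partial>replaced_kernel y)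
     \<le> (\<integral>\<^sup>+b. 4 * ennreal (target_error y) \<partial>bernoulli_pmf depart_prob)"
    unfolding replaced_kernel_def nn_integral_bind_pmf
  proof (intro nn_integral_mono)
    fix b
    show "(\<integral>\<^sup>+r. ennreal (cost J (fst r) (snd r)) \<partial>(if b then map_pmf (\<lambda>v. (depart y v, depart y v)) (pmf_of_set V)
       else map_pmf (\<lambda>(r, r'). (arrive y r, arrive y r')) ?mc)) \<le> 4 * ennreal (target_error y)"
    proof (cases b)
      case False
      have "(\<integral>\<^sup>+r. ennreal (cost J (arrive y (fst r)) (arrive y (snd r))) \<partial>?mc) \<le> (\<integral>\<^sup>+r. 4 * indicator {r. fst r \<noteq> snd r} r \<partial>?mc)"
        using pt by (intro nn_integral_mono_AE) (auto simp: AE_measure_pmf_iff)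
      also have "\<dots> = 4 * ennreal (measure_pmf.prob ?mc {r. fst r \<noteq> snd r})"
        by (simp add: nn_integral_cmult measure_pmf.emeasure_eq_measure)
      also have "\<dots> \<le> 4 * ennreal (target_error y)" by (intro mult_left_mono ennreal_leI err) simp
      finally show ?thesis using False by (simp add: split_beta')
    qed (simp add: c0)
  qed
  also have "\<dots> = ennreal (4 * target_error y)"
    by (simp add: ennreal_mult' target_error_def)
  finally show ?thesis .
qed

section \<open>Global occupancies under the product law and across a coupling\<close>

lemma expectation_product_occupancy:
  "measure_pmf.expectation product_law (occupancy G i) = qs i"
proof -
  have "measure_pmf.expectation product_law (occupancy G i)
     = measure_pmf.expectation product_law (\<lambda>x. (\<Sum>w\<in>W. local_occ w i x) / M)"
    by (simp add: average_local_occ)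
  also have "\<dots> = (\<Sum>w\<in>W. measure_pmf.expectation product_law (local_occ w i)) / M"
    using integrable_local_occ by (simp add: Bochner_Integration.integral_sum)
  also have "\<dots> = qs i"
    using M_pos by (simp add: expectation_local_occ)
  finally show ?thesis .
qed

lemma expectation_product_occupancy_diff:
  "measure_pmf.expectation product_law (\<lambda>y. \<bar>occupancy G i y - qs i\<bar>) \<le> sqrt (graph_gamma G)"
proof -
  have b: "\<bar>local_occ w i y - qs i\<bar> \<le> 1" for w y
    using local_occ_bounds[of w i y] qs_pos[of i] qs_le_1[of i] by (auto simp: abs_le_iff)
  have int: "integrable (measure_pmf product_law) (\<lambda>y. \<bar>local_occ w i y - qs i\<bar>)" for w
    using b by (intro integrable_pmf_bounded[of _ 1]) simp
  have "measure_pmf.expectation product_law (\<lambda>y. \<bar>occupancy G i y - qs i\<bar>)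
     \<le> measure_pmf.expectation product_law (\<lambda>y. (\<Sum>w\<in>W. \<bar>local_occ w i y - qs i\<bar>) / M)"
  proof (rule integral_mono)
    show "integrable (measure_pmf product_law) (\<lambda>y. \<bar>occupancy G i y - qs i\<bar>)"
      using integrable_occupancy by simp
    show "integrable (measure_pmf product_law) (\<lambda>y. (\<Sum>w\<in>W. \<bar>local_occ w i y - qs i\<bar>) / M)"
      using int by simp
    fix y
    have "occupancy G i y - qs i = (\<Sum>w\<in>W. local_occ w i y - qs i) / M"
      using M_pos by (simp add: average_local_occ[symmetric] sum_subtractf diff_divide_distrib)
    then have "\<bar>occupancy G i y - qs i\<bar> = \<bar>\<Sum>w\<in>W. local_occ w i y - qs i\<bar> / M" by simp
    also have "\<dots> \<le> (\<Sum>w\<in>W. \<bar>local_occ w i y - qs i\<bar>) / M" by (intro divide_right_mono sum_abs) auto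
    finally show "\<bar>occupancy G i y - qs i\<bar> \<le> (\<Sum>w\<in>W. \<bar>local_occ w i y - qs i\<bar>) / M" .
  qed
  also have "\<dots> = (\<Sum>w\<in>W. measure_pmf.expectation product_law (\<lambda>y. \<bar>local_occ w i y - qs i\<bar>)) / M"
    using int by (simp add: Bochner_Integration.integral_sum)
  also have "\<dots> \<le> (\<Sum>w\<in>W. 1 / sqrt (deg w)) / M"
    by (intro divide_right_mono sum_mono expectation_local_occ_diff_le) auto
  also have "\<dots> \<le> sqrt (graph_gamma G)" by (rule average_inverse_sqrt_deg)
  finally show ?thesis .
qed

lemma occupancy_diff_le: "\<bar>occupancy G i x - occupancy G i y\<bar> \<le> card (mismatch i x y) / N"
proof -
  have "\<bar>\<Sum>v\<in>V. indicator {i..} (x v) - indicator {i..} (y v) :: real\<bar>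
     \<le> (\<Sum>v\<in>V. \<bar>indicator {i..} (x v) - indicator {i..} (y v)\<bar>)" by (rule sum_abs)
  also have "\<dots> = (\<Sum>v\<in>V. indicator (mismatch i x y) v)"
    by (intro sum.cong refl) (auto simp: mismatch_def indicator_def)
  also have "\<dots> = card (mismatch i x y)"
  proof -
    have "V \<inter> mismatch i x y = mismatch i x y" by (auto simp: mismatch_def)
    then show ?thesis using V(1) by (simp add: sum_indicator_real)
  qed
  finally have "\<bar>\<Sum>v\<in>V. indicator {i..} (x v) - indicator {i..} (y v) :: real\<bar> / N \<le> card (mismatch i x y) / N"
    by (rule divide_right_mono) simp
  then show ?thesis
    by (simp add: occupancy_sum diff_divide_distrib[symmetric] sum_subtractf)
qed

lemma card_mismatch_le: "card (mismatch i x y) / N \<le> 1"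
  using card_mono[OF V(1), of "mismatch i x y"] N_pos by (auto simp: mismatch_def divide_le_eq_1)

section \<open>Stationary occupancies\<close>

definition couplings :: "('v \<Rightarrow> nat) pmf \<Rightarrow> (('v \<Rightarrow> nat) \<times> ('v \<Rightarrow> nat)) pmf set" where
  "couplings \<pi> = {\<mu>. map_pmf fst \<mu> = \<pi> \<and> map_pmf snd \<mu> = product_law}"

abbreviation coupling_cost :: "nat \<Rightarrow> (('v \<Rightarrow> nat) \<times> ('v \<Rightarrow> nat)) pmf \<Rightarrow> ennreal" where
  "coupling_cost J \<mu> \<equiv> \<integral>\<^sup>+r. ennreal (cost J (fst r) (snd r)) \<partial>measure_pmf \<mu>"

text \<open>Any one coupling of finite cost shows that the infimum is finite, and for the
  independent one only the mean totals of the two laws matter.\<close>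

lemma finite_coupling_cost:
  assumes inv: "bind_pmf \<pi> queue_kernel = \<pi>"
  shows "coupling_cost J (pair_pmf \<pi> product_law) < \<infinity>"
proof -
  have "coupling_cost J (pair_pmf \<pi> product_law)
     \<le> (\<integral>\<^sup>+r. 2 * (of_nat (total (fst r)) + of_nat (total (snd r))) \<partial>pair_pmf \<pi> product_law)"
  proof (rule nn_integral_mono)
    fix r :: "('v \<Rightarrow> nat) \<times> ('v \<Rightarrow> nat)"
    have "cost J (fst r) (snd r) \<le> 2 * (real (total (fst r)) + real (total (snd r)))"
      by (rule cost_le[OF disc_le_total]) simp
    then have "ennreal (cost J (fst r) (snd r)) \<le> ennreal (2 * (real (total (fst r)) + real (total (snd r))))"
      by (rule ennreal_leI)
    then show "ennreal (cost J (fst r) (snd r)) \<le> 2 * (of_nat (total (fst r)) + of_nat (total (snd r)))"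
      by (simp add: ennreal_mult' ennreal_of_nat_eq_real_of_nat)
  qed
  also have "\<dots> = 2 * ((\<integral>\<^sup>+x. of_nat (total x) \<partial>map_pmf fst (pair_pmf \<pi> product_law))
      + (\<integral>\<^sup>+y. of_nat (total y) \<partial>map_pmf snd (pair_pmf \<pi> product_law)))"
    by (simp add: nn_integral_cmult nn_integral_add del: map_fst_pair_pmf map_snd_pair_pmf)
  also have "\<dots> = 2 * ((\<integral>\<^sup>+x. of_nat (total x) \<partial>\<pi>) + (\<integral>\<^sup>+y. of_nat (total y) \<partial>product_law))"
    unfolding map_fst_pair_pmf map_snd_pair_pmf ..
  also have "\<dots> < \<infinity>"
    using nn_integral_total[OF expectation_occupancy_le[OF inv]] nn_integral_total[of product_law]
      qs_le_power by (simp add: expectation_product_occupancy ennreal_mult_less_top)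
  finally show ?thesis .
qed

text \<open>
  Run the coupled chain for one step, and glue it along its second component to a maximal coupling
  of the two kernels at \<open>y\<close>, so that the second marginal is again \<open>product_law\<close>.
\<close>

lemma coupling_step:
  assumes inv: "bind_pmf \<pi> queue_kernel = \<pi>" and \<mu>: "\<mu> \<in> couplings \<pi>"
  shows "\<exists>\<mu>'\<in>couplings \<pi>. coupling_cost J \<mu>'
      + (\<integral>\<^sup>+r. ennreal (depart_prob / (2 * N) * (1 / (2 * real d)) ^ J * real (card (mismatch (Suc J) (fst r) (snd r)))) \<partial>\<mu>)
    \<le> coupling_cost J \<mu> + ennreal (8 * real d / (1 - lam) * sqrt (graph_gamma G))"
proof -
  define b where "b = (\<lambda>r. depart_prob / (2 * N) * (1 / (2 * real d)) ^ J * real (card (mismatch (Suc J) (fst r) (snd r))))"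
  have b: "0 \<le> b r" for r
    using depart_prob by (simp add: b_def)
  define J1 where "J1 = bind_pmf \<mu> (\<lambda>r. coupled_kernel (fst r) (snd r))"
  define J2 where "J2 = bind_pmf product_law replaced_kernel"
  have J1: "map_pmf fst J1 = \<pi>" "map_pmf snd J1 = bind_pmf product_law queue_kernel"
  proof -
    have "map_pmf fst J1 = bind_pmf (map_pmf fst \<mu>) queue_kernel"
      by (simp add: J1_def map_bind_pmf map_coupled_kernel bind_map_pmf)
    then show "map_pmf fst J1 = \<pi>" using \<mu> inv by (simp add: couplings_def)
    have "map_pmf snd J1 = bind_pmf (map_pmf snd \<mu>) queue_kernel"
      by (simp add: J1_def map_bind_pmf map_coupled_kernel bind_map_pmf)
    then show "map_pmf snd J1 = bind_pmf product_law queue_kernel" using \<mu> by (simp add: couplings_def)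
  qed
  have J2: "map_pmf fst J2 = bind_pmf product_law queue_kernel" "map_pmf snd J2 = product_law"
    using bind_product_law by (simp_all add: J2_def map_bind_pmf map_replaced_kernel)
  have "map_pmf snd J1 = map_pmf fst J2" by (simp add: J1 J2)
  from glue_pmf[OF this] obtain J3 where J3: "map_pmf (\<lambda>(a, b, c). (a, b)) J3 = J1" "map_pmf (\<lambda>(a, b, c). (b, c)) J3 = J2"
    by blast
  \<comment> \<open>The middle law, \<open>product_law\<close> moved by one step of
    \<open>queue_kernel\<close>, serves only as a link and is dropped. The cost across it is bounded
    by \<open>cost_triangle\<close>.\<close>
  define \<mu>' where "\<mu>' = map_pmf (\<lambda>(a, b, c). (a, c)) J3"
  have "map_pmf fst \<mu>' = map_pmf fst J1" "map_pmf snd \<mu>' = map_pmf snd J2"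
    unfolding J3[symmetric] \<mu>'_def by (simp_all add: map_pmf_comp split_beta')
  then have "\<mu>' \<in> couplings \<pi>" by (simp add: couplings_def J1 J2)
  moreover have "coupling_cost J \<mu>' + (\<integral>\<^sup>+r. ennreal (b r) \<partial>\<mu>)
     \<le> coupling_cost J \<mu> + ennreal (8 * real d / (1 - lam) * sqrt (graph_gamma G))"
  proof -
    have "coupling_cost J \<mu>' \<le> (\<integral>\<^sup>+t. ennreal (cost J (fst t) (fst (snd t))) + ennreal (cost J (fst (snd t)) (snd (snd t))) \<partial>J3)"
      unfolding \<mu>'_def nn_integral_map_pmf
    proof (rule nn_integral_mono)
      fix t :: "('v \<Rightarrow> nat) \<times> ('v \<Rightarrow> nat) \<times> ('v \<Rightarrow> nat)"
      obtain a b c where t: "t = (a, b, c)" by (cases t)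
      have "ennreal (cost J a c) \<le> ennreal (cost J a b + cost J b c)"
        by (intro ennreal_leI cost_triangle)
      then show "ennreal (cost J (fst (case t of (a, b, c) \<Rightarrow> (a, c))) (snd (case t of (a, b, c) \<Rightarrow> (a, c))))
        \<le> ennreal (cost J (fst t) (fst (snd t))) + ennreal (cost J (fst (snd t)) (snd (snd t)))"
        by (simp add: t cost_nonneg)
    qed
    also have "\<dots> = coupling_cost J J1 + coupling_cost J J2"
      unfolding J3[symmetric] by (simp add: nn_integral_add split_beta')
    finally have tri: "coupling_cost J \<mu>' \<le> coupling_cost J J1 + coupling_cost J J2" .
    have "coupling_cost J J2 \<le> (\<integral>\<^sup>+y. 4 * ennreal (target_error y) \<partial>product_law)"
      unfolding J2_def nn_integral_bind_pmf
    proof (rule nn_integral_mono)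
      fix y
      show "(\<integral>\<^sup>+r. ennreal (cost J (fst r) (snd r)) \<partial>replaced_kernel y) \<le> 4 * ennreal (target_error y)"
        using nn_integral_replaced_kernel[where J=J and y=y] by (simp add: ennreal_mult')
    qed
    also have "\<dots> = 4 * (\<integral>\<^sup>+y. ennreal (target_error y) \<partial>product_law)"
      by (rule nn_integral_cmult) simp
    also have "\<dots> \<le> 4 * ennreal (2 * real d / (1 - lam) * sqrt (graph_gamma G))"
      by (intro mult_left_mono nn_integral_target_error) simp
    also have "\<dots> = ennreal (4 * (2 * real d / (1 - lam) * sqrt (graph_gamma G)))"
      by (simp only: ennreal_mult' ennreal_numeral zero_le_numeral)
    also have "4 * (2 * real d / (1 - lam) * sqrt (graph_gamma G)) = 8 * real d / (1 - lam) * sqrt (graph_gamma G)"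
      by simp
    finally have err: "coupling_cost J J2 \<le> ennreal (8 * real d / (1 - lam) * sqrt (graph_gamma G))" .
    have "coupling_cost J J1 + (\<integral>\<^sup>+r. ennreal (b r) \<partial>\<mu>)
      = (\<integral>\<^sup>+r. (\<integral>\<^sup>+s. ennreal (cost J (fst s) (snd s)) \<partial>coupled_kernel (fst r) (snd r)) + ennreal (b r) \<partial>\<mu>)"
      unfolding J1_def nn_integral_bind_pmf by (rule nn_integral_add[symmetric]) auto
    also have "\<dots> \<le> coupling_cost J \<mu>"
    proof (rule nn_integral_mono)
      fix r :: "('v \<Rightarrow> nat) \<times> ('v \<Rightarrow> nat)"
      have "(\<integral>\<^sup>+s. ennreal (cost J (fst s) (snd s)) \<partial>coupled_kernel (fst r) (snd r))
         = ennreal (measure_pmf.expectation (coupled_kernel (fst r) (snd r)) (\<lambda>s. cost J (fst s) (snd s)))"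
        by (intro nn_integral_eq_integral integrable_measure_pmf_finite finite_coupled_kernel) (simp add: cost_nonneg)
      also have "\<dots> + ennreal (b r) = ennreal (measure_pmf.expectation (coupled_kernel (fst r) (snd r)) (\<lambda>s. cost J (fst s) (snd s)) + b r)"
        using b[of r] cost_nonneg by (intro ennreal_plus[symmetric] Bochner_Integration.integral_nonneg) auto
      also have "\<dots> \<le> ennreal (cost J (fst r) (snd r))"
        unfolding b_def by (intro ennreal_leI expectation_cost)
      finally show "(\<integral>\<^sup>+s. ennreal (cost J (fst s) (snd s)) \<partial>coupled_kernel (fst r) (snd r)) + ennreal (b r)
         \<le> ennreal (cost J (fst r) (snd r))" .
    qed
    finally have "coupling_cost J J1 + (\<integral>\<^sup>+r. ennreal (b r) \<partial>\<mu>) \<le> coupling_cost J \<mu>" .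
    have "coupling_cost J \<mu>' + (\<integral>\<^sup>+r. ennreal (b r) \<partial>\<mu>)
       \<le> (coupling_cost J J1 + coupling_cost J J2) + (\<integral>\<^sup>+r. ennreal (b r) \<partial>\<mu>)"
      by (intro add_right_mono tri)
    also have "\<dots> = (coupling_cost J J1 + (\<integral>\<^sup>+r. ennreal (b r) \<partial>\<mu>)) + coupling_cost J J2"
      by (simp only: add_ac)
    also have "\<dots> \<le> coupling_cost J \<mu> + ennreal (8 * real d / (1 - lam) * sqrt (graph_gamma G))"
      by (intro add_mono err) fact
    finally show ?thesis .
  qed
  ultimately show ?thesis unfolding b_def by blast
qed

text \<open>Provides a positive slack for the choice of a nearly optimal coupling.\<close>

lemma graph_gamma_pos: "0 < graph_gamma G"
proof -
  have "0 < (\<Sum>w\<in>W. 1 / deg w)"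
    using W deg_pos by (intro sum_pos) (fastforce simp: zero_less_divide_iff)+
  then show ?thesis using M_pos by (simp add: graph_gamma_def)
qed

text \<open>
  A step of the coupled chain from a nearly optimal coupling cannot decrease the cost by much,
  so nearly optimal couplings have few mismatches.
\<close>

lemma coupling_few_mismatches:
  assumes inv: "bind_pmf \<pi> queue_kernel = \<pi>"
  shows "\<exists>\<mu>\<in>couplings \<pi>. measure_pmf.expectation \<mu> (\<lambda>r. real (card (mismatch (Suc J) (fst r) (snd r))) / N)
    \<le> 2 * (2 * real d) ^ J * (1 + lam * d) * (1 + 8 * real d / (1 - lam)) * sqrt (graph_gamma G)"
proof -
  define g where "g = sqrt (graph_gamma G)"
  have g: "0 < g" using graph_gamma_pos by (simp add: g_def)
  define K where "K = 8 * real d / (1 - lam)"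
  have K: "0 \<le> K" using lam by (simp add: K_def)
  define I where "I = (INF \<mu>\<in>couplings \<pi>. coupling_cost J \<mu>)"
  have "pair_pmf \<pi> product_law \<in> couplings \<pi>"
    by (simp add: couplings_def map_fst_pair_pmf map_snd_pair_pmf)
  then have "I \<le> coupling_cost J (pair_pmf \<pi> product_law)"
    unfolding I_def by (rule INF_lower)
  then have I_fin: "I < \<infinity>" using finite_coupling_cost[OF inv, of J] by (rule le_less_trans)
  \<comment> \<open>An optimal coupling is not claimed to exist. A slack of the same order as the
    error is enough and accounts for the summand 1 in \<open>1 + K\<close>.\<close>
  have "I < I + ennreal g" using I_fin g
    by (cases I) (auto simp: ennreal_plus[symmetric] ennreal_less_iff simp del: ennreal_plus)
  then obtain \<mu> where \<mu>: "\<mu> \<in> couplings \<pi>" "coupling_cost J \<mu> < I + ennreal g"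
    unfolding I_def INF_less_iff by blast
  obtain \<mu>' where \<mu>': "\<mu>' \<in> couplings \<pi>" and step: "coupling_cost J \<mu>'
      + (\<integral>\<^sup>+r. ennreal (depart_prob / (2 * N) * (1 / (2 * real d)) ^ J * real (card (mismatch (Suc J) (fst r) (snd r)))) \<partial>\<mu>)
    \<le> coupling_cost J \<mu> + ennreal (K * g)"
    using coupling_step[OF inv \<mu>(1), of J] unfolding K_def g_def by blast
  define m where "m = measure_pmf.expectation \<mu> (\<lambda>r. real (card (mismatch (Suc J) (fst r) (snd r))) / N)"
  define c where "c = depart_prob / 2 * (1 / (2 * real d)) ^ J"
  have c: "0 < c" using depart_prob d by (simp add: c_def)
  have int: "integrable (measure_pmf \<mu>) (\<lambda>r. real (card (mismatch (Suc J) (fst r) (snd r))) / N)"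
    using card_mismatch_le by (intro integrable_pmf_bounded[of _ 1]) simp
  have m: "0 \<le> m" unfolding m_def by (intro Bochner_Integration.integral_nonneg) simp
  have "(\<integral>\<^sup>+r. ennreal (depart_prob / (2 * N) * (1 / (2 * real d)) ^ J * real (card (mismatch (Suc J) (fst r) (snd r)))) \<partial>\<mu>)
     = (\<integral>\<^sup>+r. ennreal (c * (real (card (mismatch (Suc J) (fst r) (snd r))) / N)) \<partial>\<mu>)"
    by (simp add: c_def mult_ac)
  also have "\<dots> = ennreal (c * m)"
  proof -
    have "integrable (measure_pmf \<mu>) (\<lambda>r. c * (real (card (mismatch (Suc J) (fst r) (snd r))) / N))"
      by (intro integrable_mult_right int)
    then show ?thesis
      unfolding m_def using c
      by (subst nn_integral_eq_integral) (auto simp del: times_divide_eq_right)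
  qed
  finally have bm: "(\<integral>\<^sup>+r. ennreal (depart_prob / (2 * N) * (1 / (2 * real d)) ^ J * real (card (mismatch (Suc J) (fst r) (snd r)))) \<partial>\<mu>)
     = ennreal (c * m)" .
  have "I + ennreal (c * m) \<le> coupling_cost J \<mu>' + ennreal (c * m)"
    unfolding I_def by (intro add_right_mono INF_lower \<mu>')
  also have "\<dots> \<le> coupling_cost J \<mu> + ennreal (K * g)" using step unfolding bm .
  also have "\<dots> \<le> (I + ennreal g) + ennreal (K * g)"
    using \<mu>(2) by (intro add_right_mono less_imp_le)
  also have "\<dots> = I + ennreal (g + K * g)"
    using g K by (simp add: add.assoc)
  finally have "ennreal (c * m) \<le> ennreal (g + K * g)"
    using I_fin by (auto simp: ennreal_add_left_cancel_le)
  then have "c * m \<le> g + K * g" using g K by (subst (asm) ennreal_le_iff) auto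
  then have "c * m \<le> (1 + K) * g" by (simp add: algebra_simps)
  then have "m \<le> (1 + K) * g / c" using c by (simp add: field_simps)
  \<comment> \<open>Here enter the inverse of the weight at level \<open>J\<close>, hence the growth
    in \<open>J\<close>, and \<open>1 + lam * d = 1 / depart_prob\<close>.\<close>
  also have "1 / c = 2 * (2 * real d) ^ J * (1 + lam * d)"
    by (simp add: c_def depart_prob_def power_one_over)
  then have "(1 + K) * g / c = 2 * (2 * real d) ^ J * (1 + lam * d) * (1 + K) * g"
    by (metis divide_inverse inverse_eq_divide mult.commute mult.assoc)
  finally show ?thesis using \<mu>(1) unfolding m_def K_def g_def by blast
qed

text \<open>Depends only on \<open>lam\<close>, \<open>d\<close> and the level, so it is common to
  all graphs of a sequence. The last summand 1 stands for the fluctuation of the occupancy under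
  \<open>product_law\<close>.\<close>

definition occupancy_const :: "nat \<Rightarrow> real" where
  "occupancy_const J = 2 * (2 * real d) ^ J * (1 + lam * d) * (1 + 8 * real d / (1 - lam)) + 1"

lemma expectation_occupancy_diff:
  assumes inv: "bind_pmf \<pi> queue_kernel = \<pi>"
  shows "measure_pmf.expectation \<pi> (\<lambda>x. \<bar>occupancy G (Suc J) x - qs (Suc J)\<bar>) \<le> occupancy_const J * sqrt (graph_gamma G)"
proof -
  obtain \<mu> where \<mu>: "map_pmf fst \<mu> = \<pi>" "map_pmf snd \<mu> = product_law"
    and mm: "measure_pmf.expectation \<mu> (\<lambda>r. real (card (mismatch (Suc J) (fst r) (snd r))) / N)
    \<le> 2 * (2 * real d) ^ J * (1 + lam * d) * (1 + 8 * real d / (1 - lam)) * sqrt (graph_gamma G)"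
    using coupling_few_mismatches[OF inv, of J] by (auto simp: couplings_def)
  have int: "integrable (measure_pmf \<mu>) (\<lambda>r. real (card (mismatch (Suc J) (fst r) (snd r))) / N)"
    using card_mismatch_le by (intro integrable_pmf_bounded[of _ 1]) simp
  have b: "\<bar>occupancy G i x - qs i\<bar> \<le> 1" for i x
    using occupancy_bounds[of i x] qs_pos[of i] qs_le_1[of i] by (auto simp: abs_le_iff)
  have int1: "integrable (measure_pmf p) (\<lambda>r. \<bar>occupancy G (Suc J) (f r) - qs (Suc J)\<bar>)" for p :: "'c pmf" and f
    using b by (intro integrable_pmf_bounded[of _ 1]) simp
  have "measure_pmf.expectation \<pi> (\<lambda>x. \<bar>occupancy G (Suc J) x - qs (Suc J)\<bar>)
     = measure_pmf.expectation \<mu> (\<lambda>r. \<bar>occupancy G (Suc J) (fst r) - qs (Suc J)\<bar>)"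
    unfolding \<mu>(1)[symmetric] by simp
  also have "\<dots> \<le> measure_pmf.expectation \<mu> (\<lambda>r. real (card (mismatch (Suc J) (fst r) (snd r))) / N
      + \<bar>occupancy G (Suc J) (snd r) - qs (Suc J)\<bar>)"
  proof (rule integral_mono)
    fix r :: "('v \<Rightarrow> nat) \<times> ('v \<Rightarrow> nat)"
    show "\<bar>occupancy G (Suc J) (fst r) - qs (Suc J)\<bar> \<le> real (card (mismatch (Suc J) (fst r) (snd r))) / N
      + \<bar>occupancy G (Suc J) (snd r) - qs (Suc J)\<bar>"
      using occupancy_diff_le[of "Suc J" "fst r" "snd r"] by linarith
  qed (use int int1 in \<open>auto intro!: Bochner_Integration.integrable_add\<close>)
  also have "\<dots> = measure_pmf.expectation \<mu> (\<lambda>r. real (card (mismatch (Suc J) (fst r) (snd r))) / N)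
      + measure_pmf.expectation \<mu> (\<lambda>r. \<bar>occupancy G (Suc J) (snd r) - qs (Suc J)\<bar>)"
    using int int1 by (intro Bochner_Integration.integral_add) auto
  also have "measure_pmf.expectation \<mu> (\<lambda>r. \<bar>occupancy G (Suc J) (snd r) - qs (Suc J)\<bar>)
     = measure_pmf.expectation product_law (\<lambda>y. \<bar>occupancy G (Suc J) y - qs (Suc J)\<bar>)"
    unfolding \<mu>(2)[symmetric] by simp
  finally show ?thesis
    using mm expectation_product_occupancy_diff[of "Suc J"] by (simp add: occupancy_const_def distrib_right)
qed

text \<open>Deviations are at most one, so squares are bounded by absolute values. The first bound
  vanishes with \<open>graph_gamma\<close>, but its constant grows with the level; the second is
  uniform in the graph and summable over the levels.\<close>

lemma occupancy_square_error:
  assumes inv: "bind_pmf \<pi> queue_kernel = \<pi>"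
  shows "measure_pmf.expectation \<pi> (\<lambda>x. (occupancy G (Suc J) x - qs (Suc J))\<^sup>2) \<le> occupancy_const J * sqrt (graph_gamma G)"
    "measure_pmf.expectation \<pi> (\<lambda>x. (occupancy G (Suc J) x - qs (Suc J))\<^sup>2) \<le> 2 * lam ^ Suc J"
proof -
  have b: "\<bar>occupancy G i x - qs i\<bar> \<le> 1" for i x
    using occupancy_bounds[of i x] qs_pos[of i] qs_le_1[of i] by (auto simp: abs_le_iff)
  have int1: "integrable (measure_pmf \<pi>) (\<lambda>x. \<bar>occupancy G (Suc J) x - qs (Suc J)\<bar>)"
    using b by (intro integrable_pmf_bounded[of _ 1]) simp
  have int2: "integrable (measure_pmf \<pi>) (\<lambda>x. (occupancy G (Suc J) x - qs (Suc J))\<^sup>2)"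
    using b by (intro integrable_pmf_bounded[of _ 1]) (simp add: abs_square_le_1)
  have sq: "(occupancy G (Suc J) x - qs (Suc J))\<^sup>2 \<le> \<bar>occupancy G (Suc J) x - qs (Suc J)\<bar>" for x
    using mult_left_mono[OF b[of "Suc J" x] abs_ge_zero[of "occupancy G (Suc J) x - qs (Suc J)"]]
    by (simp add: power2_eq_square)
  have le: "measure_pmf.expectation \<pi> (\<lambda>x. (occupancy G (Suc J) x - qs (Suc J))\<^sup>2)
     \<le> measure_pmf.expectation \<pi> (\<lambda>x. \<bar>occupancy G (Suc J) x - qs (Suc J)\<bar>)"
    by (rule integral_mono[OF int2 int1 sq])
  then show "measure_pmf.expectation \<pi> (\<lambda>x. (occupancy G (Suc J) x - qs (Suc J))\<^sup>2) \<le> occupancy_const J * sqrt (graph_gamma G)"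
    using expectation_occupancy_diff[OF inv, of J] by linarith
  have "measure_pmf.expectation \<pi> (\<lambda>x. \<bar>occupancy G (Suc J) x - qs (Suc J)\<bar>)
     \<le> measure_pmf.expectation \<pi> (\<lambda>x. occupancy G (Suc J) x + qs (Suc J))"
    using int1 integrable_occupancy occupancy_bounds less_imp_le[OF qs_pos]
    by (intro integral_mono) (auto simp: abs_le_iff add_increasing add_increasing2)
  also have "\<dots> = measure_pmf.expectation \<pi> (occupancy G (Suc J)) + qs (Suc J)"
    using integrable_occupancy by simp
  also have "\<dots> \<le> lam ^ Suc J + lam ^ Suc J"
    by (intro add_mono expectation_occupancy_le[OF inv] qs_le_power)
  finally show "measure_pmf.expectation \<pi> (\<lambda>x. (occupancy G (Suc J) x - qs (Suc J))\<^sup>2) \<le> 2 * lam ^ Suc J"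
    using le by simp
qed

end

section \<open>Convergence\<close>

text \<open>Tannery's theorem, transferred to series in \<open>ennreal\<close>; it combines the two
  bounds of \<open>occupancy_square_error\<close>.\<close>

lemma suminf_tendsto_0_dominated:
  fixes e :: "nat \<Rightarrow> nat \<Rightarrow> real"
  assumes nonneg: "\<And>N i. 0 \<le> e N i" and bound: "\<And>N i. e N i \<le> B i"
    and B: "summable B" and lim: "\<And>i. (\<lambda>N. e N i) \<longlonglongrightarrow> 0"
  shows "(\<lambda>N. \<Sum>i. ennreal (e N i)) \<longlonglongrightarrow> 0"
proof -
  have summ: "summable (e N)" for N
    using nonneg bound by (intro summable_comparison_test'[OF B]) simp
  have "eventually (\<lambda>(i, N). norm (e N i) \<le> B i) (at_top \<times>\<^sub>F sequentially)"
    using nonneg bound by (intro always_eventually) simp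
  then have "(\<lambda>N. \<Sum>i. e N i) \<longlonglongrightarrow> (\<Sum>i. 0)"
    using tannerys_theorem[where a="\<lambda>i N. e N i" and b="\<lambda>_. 0" and F=sequentially, OF lim _ B] by simp
  then have "(\<lambda>N. ennreal (\<Sum>i. e N i)) \<longlonglongrightarrow> ennreal 0"
    by (intro tendsto_ennrealI) simp
  moreover have "ennreal (\<Sum>i. e N i) = (\<Sum>i. ennreal (e N i))" for N
    using nonneg summ by (intro suminf_ennreal2[symmetric])
  ultimately show ?thesis by simp
qed

lemma graph_gamma_le:
  assumes "bipartite_graph G"
  shows "graph_gamma G \<le> 1 / real (Min (task_degree G ` task_types G))"
proof -
  define m where "m = Min (task_degree G ` task_types G)"
  have W: "finite (task_types G)" "task_types G \<noteq> {}" and deg: "\<And>w. w \<in> task_types G \<Longrightarrow> 1 \<le> task_degree G w"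
    using assms by (auto simp: bipartite_graph_def)
  have m: "m \<le> task_degree G w" if "w \<in> task_types G" for w
    unfolding m_def using W that by (intro Min_le) auto
  have "m \<in> task_degree G ` task_types G" unfolding m_def using W by (intro Min_in) auto
  then have "1 \<le> m" using deg by auto
  then have "(\<Sum>w\<in>task_types G. 1 / real (task_degree G w)) \<le> (\<Sum>w\<in>task_types G. 1 / real m)"
    using m by (intro sum_mono) (auto simp: frac_le)
  then have "graph_gamma G \<le> (\<Sum>w\<in>task_types G. 1 / real m) / real (card (task_types G))"
    unfolding graph_gamma_def by (rule divide_right_mono) simp
  also have "\<dots> = 1 / real m" using W by simp
  finally show ?thesis by (simp add: m_def)
qed

lemma graph_gamma_nonneg: "0 \<le> graph_gamma G"
  unfolding graph_gamma_def by (intro divide_nonneg_nonneg sum_nonneg) auto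

lemma graph_gamma_tendsto_0:
  assumes "\<And>N. N \<ge> 1 \<Longrightarrow> bipartite_graph (G N)"
    and "filterlim (\<lambda>N. Min (task_degree (G N) ` task_types (G N))) at_top sequentially"
  shows "(\<lambda>N :: nat. graph_gamma (G N)) \<longlonglongrightarrow> 0"
proof (rule tendsto_sandwich[OF _ _ tendsto_const])
  show "eventually (\<lambda>N. 0 \<le> graph_gamma (G N)) sequentially"
    by (simp add: graph_gamma_nonneg)
  show "eventually (\<lambda>N. graph_gamma (G N) \<le> 1 / real (Min (task_degree (G N) ` task_types (G N)))) sequentially"
    using eventually_ge_at_top[of 1] by eventually_elim (use assms(1) in \<open>auto intro: graph_gamma_le\<close>)
  show "(\<lambda>N. 1 / real (Min (task_degree (G N) ` task_types (G N)))) \<longlonglongrightarrow> 0"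
    by (rule filterlim_compose[OF lim_1_over_n assms(2)])
qed

theorem corollary3p8:
  fixes lam :: real and d :: nat and G :: "nat \<Rightarrow> ('v, 'w) bigraph"
  assumes "0 < lam" and "lam < 1" and "d \<ge> 2"
    and "\<And>N. N \<ge> 1 \<Longrightarrow> regular_bipartite_graph (G N)"
    and "\<And>N. N \<ge> 1 \<Longrightarrow> card (servers (G N)) = N"
  shows
    "((\<lambda>N. graph_gamma (G N)) \<longlonglongrightarrow> 0 \<longrightarrow>
       (\<forall>N\<ge>1. ergodic_on (queue_states (G N)) (queue_rates lam d (G N))) \<and>
       (\<forall>\<pi>. (\<forall>N\<ge>1. stationary_on (queue_states (G N)) (queue_rates lam d (G N)) (\<pi> N)) \<longrightarrow>
         (\<lambda>N. occupancy_error lam d (G N) (\<pi> N)) \<longlonglongrightarrow> 0)) \<and>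
     (filterlim (\<lambda>N. Min (task_degree (G N) ` task_types (G N))) at_top sequentially \<longrightarrow>
       (\<forall>N\<ge>1. ergodic_on (queue_states (G N)) (queue_rates lam d (G N))) \<and>
       (\<forall>\<pi>. (\<forall>N\<ge>1. stationary_on (queue_states (G N)) (queue_rates lam d (G N)) (\<pi> N)) \<longrightarrow>
         (\<lambda>N. occupancy_error lam d (G N) (\<pi> N)) \<longlonglongrightarrow> 0))"
proof -
  have network: "queue_network lam d (G N)" if "N \<ge> 1" for N
    using assms that by (intro queue_network.intro) auto
  have ergodic: "ergodic_on (queue_states (G N)) (queue_rates lam d (G N))" if "N \<ge> 1" for N
    by (rule queue_network.ergodic_queue[OF network[OF that]])
  have conv: "(\<lambda>N. occupancy_error lam d (G N) (\<pi> N)) \<longlonglongrightarrow> 0"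
    if gamma: "(\<lambda>N. graph_gamma (G N)) \<longlonglongrightarrow> 0"
      and st: "\<forall>N\<ge>1. stationary_on (queue_states (G N)) (queue_rates lam d (G N)) (\<pi> N)" for \<pi>
  proof -
    \<comment> \<open>Nothing is assumed of the graph and the law at index 0. The value 0 there lets
      the domination hold for every index and does not affect the limit.\<close>
    define e where "e = (\<lambda>N i. if N \<ge> 1 then measure_pmf.expectation (\<pi> N)
       (\<lambda>x. (occupancy (G N) (Suc i) x - qstar lam d (Suc i))\<^sup>2) else 0)"
    have e: "0 \<le> e N i" "e N i \<le> 2 * lam ^ Suc i"
      "e N i \<le> queue_network.occupancy_const lam d i * sqrt (graph_gamma (G N)) \<or> N = 0" for N i
    proof -
      show "0 \<le> e N i" by (simp add: e_def)
      have "e N i \<le> 2 * lam ^ Suc i \<and> e N i \<le> queue_network.occupancy_const lam d i * sqrt (graph_gamma (G N))"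
        if N: "N \<ge> 1"
      proof -
        interpret queue_network lam d "G N" by (rule network[OF N])
        have "bind_pmf (\<pi> N) queue_kernel = \<pi> N"
          using st N by (intro stationary_onD) auto
        from occupancy_square_error[OF this, of i] show ?thesis using N by (simp add: e_def)
      qed
      then show "e N i \<le> 2 * lam ^ Suc i" "e N i \<le> queue_network.occupancy_const lam d i * sqrt (graph_gamma (G N)) \<or> N = 0"
        using assms(1) by (cases "N \<ge> 1"; simp add: e_def)+
    qed
    have lim: "(\<lambda>N. e N i) \<longlonglongrightarrow> 0" for i
    proof (rule tendsto_sandwich[OF _ _ tendsto_const])
      show "eventually (\<lambda>N. e N i \<le> queue_network.occupancy_const lam d i * sqrt (graph_gamma (G N))) sequentially"
        using eventually_ge_at_top[of 1] by eventually_elim (use e(3) in force)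
      show "(\<lambda>N. queue_network.occupancy_const lam d i * sqrt (graph_gamma (G N))) \<longlonglongrightarrow> 0"
        using tendsto_mult_right_zero[OF tendsto_real_sqrt[OF gamma, simplified]] .
    qed (simp add: e(1))
    have "summable (\<lambda>i. 2 * lam ^ Suc i)"
      using assms by (intro summable_mult) (simp add: summable_geometric)
    from suminf_tendsto_0_dominated[OF e(1,2) this lim]
    have "(\<lambda>N. \<Sum>i. ennreal (e N i)) \<longlonglongrightarrow> 0" .
    moreover have "eventually (\<lambda>N. (\<Sum>i. ennreal (e N i)) = occupancy_error lam d (G N) (\<pi> N)) sequentially"
      using eventually_ge_at_top[of 1] by eventually_elim (simp add: e_def occupancy_error_def)
    ultimately show ?thesis by (rule Lim_transform_eventually)
  qed
  have gamma: "(\<lambda>N. graph_gamma (G N)) \<longlonglongrightarrow> 0"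
    if "filterlim (\<lambda>N. Min (task_degree (G N) ` task_types (G N))) at_top sequentially"
    using assms(4) that by (intro graph_gamma_tendsto_0) (auto simp: regular_bipartite_graph_def)
  show ?thesis using ergodic conv gamma by blast
qed

end
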